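(* Let $q$ be a prime power, $V,W$ finite-dimensional vector spaces over $\mathbb{F}_q$, $0\le d\le \dim V+\dim W$ an integer, $\epsilon>0$, and let $f\in L^2(\mathcal{L}(V,W))$ be $(d,\epsilon)$-global and of degree $d$. Let $\ell\ge2$ be a power of $2$. Then $$\|f\|_\ell^\ell\le q^{200d^2\ell^2}\|f\|_2^2\,\epsilon^{\ell/2-1}.$$
   Context: $\mathcal{L}(V,W)$ is the space of linear maps $V\to W$. For a finite set $X$, $L^2(X)$ is the space of functions $X\to\mathbb{C}$ with $\langle f,g\rangle=\mathbb{E}_{x\in X}[f(x)\overline{g(x)}]$ and $\|f\|_\ell=(\mathbb{E}_{x\in X}|f(x)|^\ell)^{1/\ell}$ (uniform $x$). Degree: write $q=p^m$, $p$ prime, and $\varphi:\mathbb{F}_q\to\mathbb{C}^\times$, $\varphi(x)=e^{\frac{2\pi i}{p}\sum_{i=0}^{m-1}x^{p^i}}$. For $X\in\mathcal{L}(W,V)$ put $u_X(A)=\varphi(\mathrm{tr}(XA))$; these form an orthonormal basis of $L^2(\mathcal{L}(V,W))$. With $\hat f(X)=\langle f,u_X\rangle$, set $f^{\le d}=\sum_{\mathrm{rank}(X)\le d}\hat f(X)u_X$. $f$ is of degree $d$ if $f=f^{\le d}$. Globalness: for $V'\le V$, $W'\le W$, identify $\mathcal{L}(V/V',W')$ with $\{S\in\mathcal{L}(V,W): V'\le\ker S,\ \mathrm{im}\,S\le W'\}$. For $T\in\mathcal{L}(V,W)$ the restriction $f_{(V',W')\to T}\in L^2(\mathcal{L}(V/V',W'))$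 is $f_{(V',W')\to T}(S)=f(S+T)$; it is a $d$-restriction if $d=\dim V'+\mathrm{codim}\,W'$. $f$ is $(d,\epsilon)$-global if $\|f_{(V',W')\to T}\|_2^2\le\epsilon$ for every $d$-restriction. *)

theory Defs
  imports Complex_Main "HOL-Library.Cardinality" "HOL-Computational_Algebra.Primes"
begin

definition expect :: "'x set \<Rightarrow> ('x \<Rightarrow> 'b::field) \<Rightarrow> 'b" where
  "expect X g = (\<Sum>x\<in>X. g x) / of_nat (card X)"

definition L2_inner :: "'x set \<Rightarrow> ('x \<Rightarrow> complex) \<Rightarrow> ('x \<Rightarrow> complex) \<Rightarrow> complex" where
  "L2_inner X f g = expect X (\<lambda>x. f x * cnj (g x))"

definition Lnorm :: "'x set \<Rightarrow> nat \<Rightarrow> ('x \<Rightarrow> complex) \<Rightarrow> real" where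
  "Lnorm X l f = root l (expect X (\<lambda>x. cmod (f x) ^ l))"

text \<open>A vector space is a type together with a scalar multiplication, as in the theory
  \<^theory>\<open>HOL.Vector_Spaces\<close>. An element of \<open>L\<^sup>2\<close> of the space of linear maps is represented by a
  function on all maps; only its values on \<open>linmaps\<close> matter below.\<close>

definition linmaps ::
    "('k::field \<Rightarrow> 'v::ab_group_add \<Rightarrow> 'v) \<Rightarrow> ('k \<Rightarrow> 'w::ab_group_add \<Rightarrow> 'w) \<Rightarrow> ('v \<Rightarrow> 'w) set" where
  "linmaps sV sW = {A. Vector_Spaces.linear sV sW A}"

definition rank ::
    "('k::field \<Rightarrow> 'v::ab_group_add \<Rightarrow> 'v) \<Rightarrow> ('w \<Rightarrow> 'v) \<Rightarrow> nat" where
  "rank sV X = vector_space.dim sV (range X)"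

text \<open>The trace is the sum of the diagonal entries in a basis. The term
  \<open>vector_space.extend_basis s {}\<close> denotes some basis of the whole space; as usual, the value
  does not depend on which one.\<close>

definition trace :: "('k::field \<Rightarrow> 'v::ab_group_add \<Rightarrow> 'v) \<Rightarrow> ('v \<Rightarrow> 'v) \<Rightarrow> 'k" where
  "trace s g =
    (let B = vector_space.extend_basis s {} in \<Sum>b\<in>B. module.representation s B (g b) b)"

text \<open>The exponent in the additive character is the absolute trace of \<open>x\<close>, an element of the prime
  field. It is lifted to a natural number, which is unique modulo \<open>p\<close>.\<close>

definition add_char :: "nat \<Rightarrow> nat \<Rightarrow> 'k::field \<Rightarrow> complex" where
  "add_char p m x =
    exp (2 * of_real pi * \<i> / of_nat p
         * of_nat (LEAST n. of_nat n = (\<Sum>i<m. x ^ (p ^ i))))"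

definition fourier_char ::
    "nat \<Rightarrow> nat \<Rightarrow> ('k::field \<Rightarrow> 'v::ab_group_add \<Rightarrow> 'v) \<Rightarrow> ('w \<Rightarrow> 'v) \<Rightarrow> ('v \<Rightarrow> 'w) \<Rightarrow> complex" where
  "fourier_char p m sV X A = add_char p m (trace sV (X \<circ> A))"

definition fourier_coeff ::
    "nat \<Rightarrow> nat \<Rightarrow> ('k::field \<Rightarrow> 'v::ab_group_add \<Rightarrow> 'v) \<Rightarrow> ('k \<Rightarrow> 'w::ab_group_add \<Rightarrow> 'w) \<Rightarrow>
     (('v \<Rightarrow> 'w) \<Rightarrow> complex) \<Rightarrow> ('w \<Rightarrow> 'v) \<Rightarrow> complex" where
  "fourier_coeff p m sV sW f X = L2_inner (linmaps sV sW) f (fourier_char p m sV X)"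

definition low_degree_part ::
    "nat \<Rightarrow> nat \<Rightarrow> ('k::field \<Rightarrow> 'v::ab_group_add \<Rightarrow> 'v) \<Rightarrow> ('k \<Rightarrow> 'w::ab_group_add \<Rightarrow> 'w) \<Rightarrow>
     nat \<Rightarrow> (('v \<Rightarrow> 'w) \<Rightarrow> complex) \<Rightarrow> ('v \<Rightarrow> 'w) \<Rightarrow> complex" where
  "low_degree_part p m sV sW d f A =
    (\<Sum>X\<in>{X \<in> linmaps sW sV. rank sV X \<le> d}.
       fourier_coeff p m sV sW f X * fourier_char p m sV X A)"

definition of_degree ::
    "nat \<Rightarrow> nat \<Rightarrow> ('k::field \<Rightarrow> 'v::ab_group_add \<Rightarrow> 'v) \<Rightarrow> ('k \<Rightarrow> 'w::ab_group_add \<Rightarrow> 'w) \<Rightarrow>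
     nat \<Rightarrow> (('v \<Rightarrow> 'w) \<Rightarrow> complex) \<Rightarrow> bool" where
  "of_degree p m sV sW d f \<longleftrightarrow>
    (\<forall>A\<in>linmaps sV sW. f A = low_degree_part p m sV sW d f A)"

text \<open>The linear maps from \<open>V/V'\<close> to \<open>W'\<close>, identified with the linear maps from \<open>V\<close> to \<open>W\<close> that
  vanish on \<open>V'\<close> and have image in \<open>W'\<close>.\<close>

definition restr_linmaps ::
    "('k::field \<Rightarrow> 'v::ab_group_add \<Rightarrow> 'v) \<Rightarrow> ('k \<Rightarrow> 'w::ab_group_add \<Rightarrow> 'w) \<Rightarrow>
     'v set \<Rightarrow> 'w set \<Rightarrow> ('v \<Rightarrow> 'w) set" where
  "restr_linmaps sV sW V' W' =
    {S \<in> linmaps sV sW. V' \<subseteq> {v. S v = 0} \<and> range S \<subseteq> W'}"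

definition restriction ::
    "(('v \<Rightarrow> 'w::ab_group_add) \<Rightarrow> complex) \<Rightarrow> ('v \<Rightarrow> 'w) \<Rightarrow> ('v \<Rightarrow> 'w) \<Rightarrow> complex" where
  "restriction f T S = f (\<lambda>v. S v + T v)"

definition codim :: "('k::field \<Rightarrow> 'w::ab_group_add \<Rightarrow> 'w) \<Rightarrow> 'w set \<Rightarrow> nat" where
  "codim s W' = vector_space.dim s UNIV - vector_space.dim s W'"

definition global ::
    "('k::field \<Rightarrow> 'v::ab_group_add \<Rightarrow> 'v) \<Rightarrow> ('k \<Rightarrow> 'w::ab_group_add \<Rightarrow> 'w) \<Rightarrow>
     nat \<Rightarrow> real \<Rightarrow> (('v \<Rightarrow> 'w) \<Rightarrow> complex) \<Rightarrow> bool" where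
  "global sV sW d \<epsilon> f \<longleftrightarrow>
    (\<forall>V' W' T. module.subspace sV V' \<longrightarrow> module.subspace sW W' \<longrightarrow> T \<in> linmaps sV sW \<longrightarrow>
       vector_space.dim sV V' + codim sW W' = d \<longrightarrow>
       (Lnorm (restr_linmaps sV sW V' W') 2 (restriction f T))\<^sup>2 \<le> \<epsilon>)"

end

theory Submission
  imports Defs "HOL-Analysis.L2_Norm" "HOL-Library.Function_Algebras" "HOL-Number_Theory.Cong"
    "HOL-Computational_Algebra.Polynomial"
begin

text \<open>
  Write \<open>f = \<Sum>X. x(X) u\<^sub>X\<close>. It suffices to multiply by \<open>f\<close> repeatedly: if \<open>g\<close> has degree at most
  \<open>D\<close>, then \<open>\<parallel>f g\<parallel>\<^sub>2\<^sup>2 \<le> q\<^bsup>O(d\<^sup>2 + d D)\<^esup> \<epsilon> \<parallel>g\<parallel>\<^sub>2\<^sup>2\<close>, and \<open>l/2 - 1\<close> such steps, starting from \<open>g = f\<close>,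
  bound \<open>\<parallel>f\<^bsup>l/2\<^esup>\<parallel>\<^sub>2\<^sup>2 = \<parallel>f\<parallel>\<^sub>l\<^sup>l\<close>. One may assume that \<open>x\<close> is supported on maps of one rank \<open>a \<le> d\<close>.

  A triple \<open>X + Y = Z\<close> is good if no vector lies in all three images and no functional lies in
  all three coimages. Then \<open>X = \<alpha> + \<gamma>\<close>, \<open>Y = \<beta> - \<gamma>\<close>, \<open>Z = \<alpha> + \<beta>\<close> with summands adapted to images and
  kernels, so that by Cauchy-Schwarz the good part of \<open>f g\<close> has squared norm at most \<open>q\<^bsup>O(d\<^sup>2 + d D)\<^esup> \<parallel>f\<parallel>\<^sub>2\<^sup>2 \<parallel>g\<parallel>\<^sub>2\<^sup>2\<close>.
  Moebius inversion over independent lists of common vectors and functionals expresses the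
  rest by products of derivatives. A list of \<open>k\<close> vectors (or \<open>k\<close> functionals) lowers the rank \<open>a\<close> by
  \<open>k\<close>, and its cost is only \<open>q\<^bsup>O((d + D) k)\<^esup>\<close>: masking the coefficients of a pure function
  preserves globalness up to a factor \<open>q\<^bsup>O(d)\<^esup>\<close> per list element, and \<open>Z\<close> admits few lists. Induction
  on \<open>a\<close> concludes. Keeping \<open>g\<close> arbitrary avoids any globalness of \<open>f\<^sup>2, f\<^sup>4, \<dots>\<close>.
\<close>

section \<open>The additive character\<close>

text \<open>Restrictions never change the spaces. They are realised by the substitution of \<rho> A
  \<pi> + T for A with endomorphisms \<pi>, \<rho>; the dual operation on coefficients, X to \<pi> X
  \<rho>, strips a known vector from every image or a known functional from every coimage. So one
  locale serves all stages of the induction.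

  The bad part contains products of the same kind as the claim, so their sum has to be absorbed
  rather than merely bounded. Weights do this: q^-(a+D+1) per list entry makes the weights of the
  tests that Z passes add up to at most 4, and after all costs q^-(D+4) per entry is left for the
  masks of y, whose nonempty tests then contribute at most \<open>nsq y / 7\<close>. The resulting
  factor 4/7 < 1 closes the induction. Of a pair of lists only the longer one lowers the rank; as it
  holds at least half of the entries, a constant that grows geometrically in a pays for both.

  Masks are cheap because the number of functionals that kill an image depends only on its rank;
  this is why parts of one rank are treated separately.\<close>

lemma power_CARD_eq_same:
  fixes x :: "'k::{field,finite}"
  shows "x ^ CARD('k) = x"
proof (cases "x = 0")
  case False
  let ?U = "UNIV - {0 :: 'k}"
  have "\<Prod>?U = (\<Prod>y\<in>?U. x * y)"
    by (rule prod.reindex_bij_witness[of _ "\<lambda>y. x * y" "\<lambda>y. y / x"]) (use False in auto)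
  also have "\<dots> = x ^ card ?U * \<Prod>?U"
    by (simp add: prod.distrib)
  finally have "x ^ card ?U = 1"
    by simp
  moreover have "CARD('k) = Suc (card ?U)"
    by (rule card.remove) simp_all
  ultimately show ?thesis
    by (simp only: power_Suc mult_1_right)
qed simp

lemma CHAR_eq_of_CARD_eq_prime_power:
  assumes "prime p" "CARD('k::{field,finite}) = p ^ m"
  shows "CHAR('k) = p"
proof -
  have "CHAR('k) > 0"
    by (rule finite_imp_CHAR_pos) simp
  hence pr: "prime CHAR('k)"
    by (rule prime_CHAR_semidom)
  \<comment> \<open>Adding 1 permutes the field, so comparing the two sums forces
    \<open>of_nat CARD('k)\<close> to vanish.\<close>
  have "(\<Sum>x\<in>(UNIV::'k set). x) = (\<Sum>x\<in>(UNIV::'k set). x + 1)"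
    by (rule sum.reindex_bij_witness[of _ "\<lambda>x. x + 1" "\<lambda>x. x - 1"]) auto
  hence "of_nat CARD('k) = (0::'k)"
    by (simp add: sum.distrib)
  hence "CHAR('k) dvd p ^ m"
    unfolding of_nat_eq_0_iff_char_dvd assms(2) .
  with pr have "CHAR('k) dvd p"
    using prime_dvd_power by blast
  with pr assms(1) show ?thesis
    using primes_dvd_imp_eq by blast
qed

context
  fixes p m :: nat
  assumes p: "prime p" and card_k: "CARD('k::{field,finite}) = p ^ m"
begin

definition abs_trace :: "'k \<Rightarrow> 'k" where
  "abs_trace x = (\<Sum>i<m. x ^ (p ^ i))"

lemma char_k: "CHAR('k) = p"
  by (rule CHAR_eq_of_CARD_eq_prime_power[OF p card_k])

lemma prime_CHAR_k: "prime CHAR('k)"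
  using char_k p by simp

lemma abs_trace_add: "abs_trace (x + y) = abs_trace x + abs_trace y"
  unfolding abs_trace_def sum.distrib[symmetric]
  by (rule sum.cong[OF refl], rule freshmans_dream'[OF prime_CHAR_k]) (simp add: char_k)

text \<open>The Frobenius map shifts the summands x^(p^i) cyclically, since x^(p^m) = x. The value
  therefore lies in the prime field, as \<open>ex_of_nat_if_power_eq\<close> makes explicit.\<close>

lemma abs_trace_power: "abs_trace x ^ p = abs_trace x"
proof -
  have "abs_trace x ^ p = (\<Sum>i<m. x ^ (p ^ Suc i))"
    unfolding abs_trace_def
    by (subst freshmans_dream_sum[OF prime_CHAR_k])
       (auto simp: char_k mult.commute simp flip: power_mult)
  also have "\<dots> = (\<Sum>i<Suc m. x ^ (p ^ i)) - x ^ (p ^ 0)"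
    by (subst sum.lessThan_Suc_shift) simp
  also have "\<dots> = abs_trace x"
    unfolding abs_trace_def using power_CARD_eq_same[of x] by (simp add: card_k)
  finally show ?thesis .
qed

text \<open>X^p - X has at most p roots, and the images of 0, ..., p - 1 are p of them. This makes
  the \<open>LEAST\<close> in \<open>add_char\<close> meaningful.\<close>

lemma ex_of_nat_if_power_eq:
  assumes "(y::'k) ^ p = y"
  shows "\<exists>n. of_nat n = y"
proof -
  define P :: "'k poly" where "P = monom 1 p - monom 1 1"
  have p2: "p \<ge> 2"
    using p prime_ge_2_nat by blast
  have deg: "degree P \<le> p"
    unfolding P_def by (rule degree_diff_le) (use p2 in \<open>auto simp: degree_monom_eq\<close>)
  have "coeff P p = 1"
    unfolding P_def using p2 by simp
  hence P0: "P \<noteq> 0"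
    by auto
  have fin: "finite {x. poly P x = 0}"
    by (rule poly_roots_finite[OF P0])
  have le: "card {x. poly P x = 0} \<le> p"
    using card_poly_roots_bound[OF P0] deg by linarith
  have inj: "inj_on (of_nat :: nat \<Rightarrow> 'k) {..<p}"
    by (rule inj_onI) (auto simp: of_nat_eq_iff_cong_CHAR char_k cong_def)
  have pw: "(of_nat n :: 'k) ^ p = of_nat n" for n
  proof (induction n)
    case (Suc n)
    have "(1 + of_nat n :: 'k) ^ p = 1 ^ p + of_nat n ^ p"
      by (rule freshmans_dream[OF prime_CHAR_k]) (simp add: char_k)
    with Suc show ?case by simp
  qed (use p2 in auto)
  have sub: "(of_nat ` {..<p} :: 'k set) \<subseteq> {x. poly P x = 0}"
    by (auto simp: P_def poly_monom pw)
  have "(of_nat ` {..<p} :: 'k set) = {x. poly P x = 0}"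
    by (rule card_seteq[OF fin sub]) (use le inj in \<open>simp add: card_image\<close>)
  moreover have "y \<in> {x. poly P x = 0}"
    using assms by (simp add: P_def poly_monom)
  ultimately have "y \<in> of_nat ` {..<p}"
    by simp
  thus ?thesis by auto
qed

definition tr_nat :: "'k \<Rightarrow> nat" where
  "tr_nat x = (LEAST n. of_nat n = abs_trace x)"

lemma of_nat_tr_nat: "of_nat (tr_nat x) = abs_trace x"
  unfolding tr_nat_def by (rule LeastI_ex) (rule ex_of_nat_if_power_eq[OF abs_trace_power])

lemma add_char_eq: "add_char p m x = exp (2 * of_real pi * \<i> * of_nat (tr_nat x) / of_nat p)"
  unfolding add_char_def tr_nat_def abs_trace_def by simp

lemma exp_cong_mod:
  assumes "[a = b] (mod p)"
  shows "exp (2 * of_real pi * \<i> * of_nat a / of_nat p) =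
         (exp (2 * of_real pi * \<i> * of_nat b / of_nat p) :: complex)"
proof -
  define z :: complex where "z = exp (2 * of_real pi * \<i> / of_nat p)"
  have e: "exp (2 * of_real pi * \<i> * of_nat a / of_nat p) = z ^ a" for a
    unfolding z_def exp_of_nat_mult[symmetric] by (simp add: mult_ac)
  have p0: "p \<noteq> 0"
    using p by (metis not_prime_0)
  hence "z ^ p = 1"
    unfolding z_def exp_of_nat_mult[symmetric] by simp
  hence *: "z ^ a = z ^ (a mod p)" for a
    using power_add[of z "p * (a div p)" "a mod p"] by (simp add: power_mult)
  show ?thesis
    unfolding e using assms * unfolding cong_def by metis
qed

text \<open>\<open>tr_nat\<close> is additive only modulo p, which the periodicity in
  \<open>exp_cong_mod\<close> absorbs.\<close>

lemma add_char_add: "add_char p m (x + y) = add_char p m x * add_char p m (y::'k)"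
proof -
  have "of_nat (tr_nat (x + y)) = (of_nat (tr_nat x + tr_nat y) :: 'k)"
    by (simp add: of_nat_tr_nat abs_trace_add)
  hence c: "[tr_nat (x + y) = tr_nat x + tr_nat y] (mod p)"
    by (simp add: of_nat_eq_iff_cong_CHAR char_k del: of_nat_add)
  show ?thesis
    unfolding add_char_eq exp_cong_mod[OF c] exp_add[symmetric]
    by (simp add: algebra_simps add_divide_distrib)
qed

lemma norm_add_char: "cmod (add_char p m (x::'k)) = 1"
  unfolding add_char_eq by simp

text \<open>The absolute trace is a polynomial of degree at most p^(m-1) < q, and it is not the zero
  polynomial because its coefficient of X is 1; so it does not vanish on the whole field.\<close>

lemma add_char_nontrivial: "\<exists>x::'k. add_char p m x \<noteq> 1"
proof -
  have p2: "p \<ge> 2"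
    using p prime_ge_2_nat by blast
  have "CARD('k) > 1"
    by (metis UNIV_I card_gt_0_iff card_eq_0_iff card_1_singletonE finite_code less_one
        linorder_neqE_nat singletonD zero_neq_one empty_iff)
  hence m0: "m > 0"
    using card_k by (cases m) auto
  define P :: "'k poly" where "P = (\<Sum>i<m. monom 1 (p ^ i))"
  have "coeff P 1 = (\<Sum>i<m. if i = 0 then 1 else 0)"
    unfolding P_def coeff_sum by (rule sum.cong) (use p2 in auto)
  also have "\<dots> = 1"
    using m0 by simp
  finally have P0: "P \<noteq> 0"
    by auto
  have "degree P \<le> p ^ (m - 1)"
    unfolding P_def
  proof (rule degree_sum_le)
    fix i assume "i \<in> {..<m}"
    hence "p ^ i \<le> p ^ (m - 1)"
      using p2 by (intro power_increasing) auto
    thus "degree (monom (1::'k) (p ^ i)) \<le> p ^ (m - 1)"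
      by (simp add: degree_monom_eq)
  qed simp
  also have "\<dots> < p ^ m"
    using p2 m0 by (intro power_strict_increasing) auto
  finally have "card {x. poly P x = 0} < CARD('k)"
    using card_poly_roots_bound[OF P0] card_k by linarith
  then obtain x where x: "poly P x \<noteq> 0"
    by (metis (mono_tags, lifting) UNIV_eq_I less_irrefl mem_Collect_eq)
  have "poly P x = abs_trace x"
    by (simp add: P_def abs_trace_def poly_sum poly_monom)
  with x have "of_nat (tr_nat x) \<noteq> (0::'k)"
    by (simp add: of_nat_tr_nat)
  hence nd: "\<not> p dvd tr_nat x"
    by (simp add: of_nat_eq_0_iff_char_dvd char_k)
  have "add_char p m x \<noteq> 1"
  proof
    assume "add_char p m x = 1"
    hence "cis (2 * pi * real (tr_nat x) / real p) = 1"
      unfolding add_char_eq cis_conv_exp by (simp add: mult_ac)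
    hence "cos (2 * pi * real (tr_nat x) / real p) = 1"
      by (metis cis.sel(1) one_complex.sel(1))
    then obtain n :: int where "2 * pi * real (tr_nat x) / real p = of_int n * 2 * pi"
      unfolding cos_one_2pi_int by blast
    hence "real_of_int (int (tr_nat x)) = real_of_int (n * int p)"
      using p2 by (simp add: field_simps)
    hence "int (tr_nat x) = n * int p"
      by (simp only: of_int_eq_iff)
    hence "int p dvd int (tr_nat x)"
      by simp
    with nd show False
      by simp
  qed
  thus ?thesis by blast
qed

end

section \<open>Counting in finite vector spaces\<close>

text \<open>All fibres over the image are translates of the kernel. Only additivity is assumed, so
  that the count applies to vectors, to functionals and to a map restricted to a subspace U.\<close>

lemma card_image_times_card_kernel:
  fixes f :: "'a::ab_group_add \<Rightarrow> 'b::ab_group_add"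
  assumes fin: "finite U" and diff: "\<And>u v. u \<in> U \<Longrightarrow> v \<in> U \<Longrightarrow> u - v \<in> U"
    and add: "\<And>u v. f (u + v) = f u + f v"
  shows "card U = card (f ` U) * card {u\<in>U. f u = 0}"
proof -
  have fd: "f (u - v) = f u - f v" for u v
    using add[of "u - v" v] by simp
  have "card {u\<in>U. f u = y} = card {u\<in>U. f u = 0}" if "y \<in> f ` U" for y
  proof -
    from that obtain u0 where u0: "u0 \<in> U" "f u0 = y"
      by blast
    have neg: "- u \<in> U" if "u \<in> U" for u
      using diff[OF diff[OF that that] that] by simp
    have plus: "u + v \<in> U" if "u \<in> U" "v \<in> U" for u v
      using diff[OF that(1) neg[OF that(2)]] by simp
    show ?thesis
      by (rule bij_betw_same_card[where f = "\<lambda>u. u - u0"],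
          rule bij_betw_byWitness[where f' = "\<lambda>u. u + u0"])
         (use u0 diff plus in \<open>auto simp: fd add\<close>)
  qed
  moreover have "card U = (\<Sum>y\<in>f ` U. card {u\<in>U. f u = y})"
    using sum.group[of U "f ` U" f "\<lambda>_. 1::nat"] fin by (simp add: sum.If_cases)
  ultimately show ?thesis by simp
qed

text \<open>Translating by some v with \<psi> v \<noteq> 1 multiplies the sum by \<psi> v. The
  orthogonality relations below are instances.\<close>

lemma sum_character:
  fixes \<psi> :: "'a::ab_group_add \<Rightarrow> complex"
  assumes plus: "\<And>u v. u \<in> U \<Longrightarrow> v \<in> U \<Longrightarrow> u + v \<in> U"
    and diff: "\<And>u v. u \<in> U \<Longrightarrow> v \<in> U \<Longrightarrow> u - v \<in> U"
    and mult: "\<And>u v. u \<in> U \<Longrightarrow> v \<in> U \<Longrightarrow> \<psi> (u + v) = \<psi> u * \<psi> v"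
  shows "(\<Sum>u\<in>U. \<psi> u) = (if \<forall>u\<in>U. \<psi> u = 1 then of_nat (card U) else 0)"
proof (cases "\<forall>u\<in>U. \<psi> u = 1")
  case False
  then obtain v where v: "v \<in> U" "\<psi> v \<noteq> 1"
    by blast
  have "(\<Sum>u\<in>U. \<psi> u) = (\<Sum>u\<in>U. \<psi> (u + v))"
    by (rule sum.reindex_bij_witness[of _ "\<lambda>u. u + v" "\<lambda>u. u - v"]) (use v plus diff in auto)
  also have "\<dots> = (\<Sum>u\<in>U. \<psi> u) * \<psi> v"
    unfolding sum_distrib_right by (rule sum.cong) (use v mult in auto)
  finally have "(\<Sum>u\<in>U. \<psi> u) * (1 - \<psi> v) = 0"
    by (simp add: algebra_simps)
  with v False show ?thesis by auto
qed simp

locale vector_space_over_finite_field = vector_space scale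
  for scale :: "'k::{field,finite} \<Rightarrow> 'b::ab_group_add \<Rightarrow> 'b"
begin

lemma card_span_insert:
  assumes "a \<notin> span S"
  shows "card (span (insert a S)) = CARD('k) * card (span S)"
proof -
  have "bij_betw (\<lambda>(c, u). scale c a + u) (UNIV \<times> span S) (span (insert a S))"
  proof (rule bij_betw_imageI)
    show "inj_on (\<lambda>(c, u). scale c a + u) (UNIV \<times> span S)"
    proof (rule inj_onI, clarify)
      fix c u c' u'
      assume u: "u \<in> span S" "u' \<in> span S" and eq: "scale c a + u = scale c' a + u'"
      have *: "scale (c - c') a = u' - u"
        using eq by (simp add: scale_left_diff_distrib algebra_simps)
      have "c = c'"
      proof (rule ccontr)
        assume "c \<noteq> c'"
        moreover have "scale (c - c') a \<in> span S"
          unfolding * using u by (simp add: span_diff)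
        hence "scale (inverse (c - c')) (scale (c - c') a) \<in> span S"
          by (rule span_scale)
        ultimately show False
          using assms by simp
      qed
      with eq show "c = c' \<and> u = u'" by simp
    qed
    show "(\<lambda>(c, u). scale c a + u) ` (UNIV \<times> span S) = span (insert a S)"
    proof safe
      fix c u assume "u \<in> span S"
      thus "scale c a + u \<in> span (insert a S)"
        by (intro span_add span_scale span_base[of a]) (auto intro: span_mono[THEN subsetD])
    next
      fix x assume "x \<in> span (insert a S)"
      then obtain k where "x - scale k a \<in> span S"
        unfolding span_breakdown_eq by blast
      thus "x \<in> (\<lambda>(c, u). scale c a + u) ` (UNIV \<times> span S)"
        by (intro image_eqI[of _ _ "(k, x - scale k a)"]) auto
    qed
  qed
  from bij_betw_same_card[OF this] show ?thesis
    by (simp add: card_cartesian_product)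
qed

lemma card_span_independent:
  assumes "finite B" "independent B"
  shows "card (span B) = CARD('k) ^ card B"
  using assms
proof (induction B)
  case (insert a B)
  thus ?case
    by (simp add: independent_insert card_span_insert)
qed simp

text \<open>Ordered lists, unlike independent sets, are counted by a product of factors card U -
  q^j, the Newton basis used for the inversion; and the head can be split off as the vector to be
  projected away.\<close>

primrec indep_list :: "'b list \<Rightarrow> bool" where
  "indep_list [] = True"
| "indep_list (v # vs) = (v \<notin> span (set vs) \<and> indep_list vs)"

lemma card_span_indep_list: "indep_list vs \<Longrightarrow> card (span (set vs)) = CARD('k) ^ length vs"
  by (induction vs) (auto simp: card_span_insert)

text \<open>Independence of the whole list means that the tail is independent modulo v, where
  subtracting multiples of v does not matter. With c a functional that is 1 at v this gives the
  image of the tail under a projection along v.\<close>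

lemma indep_list_eliminate:
  assumes "indep_list (v # vs)"
  shows "indep_list (map (\<lambda>u. u - scale (c u) v) vs)"
  using assms
proof (induction vs)
  case (Cons u vs)
  have v: "v \<notin> span (insert u (set vs))" and u: "u \<notin> span (set vs)" and i: "indep_list vs"
    using Cons.prems by auto
  have v': "v \<notin> span (set vs)"
    using v span_mono[of "set vs" "insert u (set vs)"] by blast
  have "u - scale (c u) v \<notin> span ((\<lambda>u. u - scale (c u) v) ` set vs)"
  proof
    assume a: "u - scale (c u) v \<in> span ((\<lambda>u. u - scale (c u) v) ` set vs)"
    have "span ((\<lambda>u. u - scale (c u) v) ` set vs) \<subseteq> span (insert v (set vs))"
      by (rule span_minimal) (auto intro!: span_diff span_scale intro: span_base)
    with a have "u - scale (c u) v \<in> span (insert v (set vs))"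
      by blast
    hence "(u - scale (c u) v) + scale (c u) v \<in> span (insert v (set vs))"
      by (intro span_add span_scale) (auto intro: span_base)
    hence "u \<in> span (insert v (set vs))"
      by simp
    with u have "v \<in> span (insert u (set vs))"
      using in_span_insert by blast
    with v show False ..
  qed
  with Cons.IH v' i show ?case
    by simp
qed simp

definition indep_lists :: "'b set \<Rightarrow> nat \<Rightarrow> 'b list set" where
  "indep_lists U k = {vs. length vs = k \<and> set vs \<subseteq> U \<and> indep_list vs}"

lemma finite_indep_lists: "finite U \<Longrightarrow> finite (indep_lists U k)"
  unfolding indep_lists_def
  by (rule finite_subset[OF _ finite_lists_length_eq[of U k]]) auto

lemma card_indep_lists_le: "finite U \<Longrightarrow> card (indep_lists U k) \<le> card U ^ k"
  unfolding indep_lists_def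
  using card_mono[OF finite_lists_length_eq[of U k], of "{vs. length vs = k \<and> set vs \<subseteq> U \<and> indep_list vs}"]
  by (auto simp: card_lists_length_eq)

lemma card_indep_lists_Suc:
  assumes fin: "finite U" and U: "subspace U"
  shows "real (card (indep_lists U (Suc k))) =
    real (card (indep_lists U k)) * (real (card U) - real CARD('k) ^ k)"
proof -
  have sub: "span (set vs) \<subseteq> U" if "vs \<in> indep_lists U k" for vs
    using that U unfolding indep_lists_def by (auto intro: span_minimal[THEN subsetD])
  have "bij_betw (\<lambda>(vs, v). v # vs) (SIGMA vs:indep_lists U k. U - span (set vs)) (indep_lists U (Suc k))"
    by (rule bij_betw_byWitness[where f' = "\<lambda>vs. (tl vs, hd vs)"])
       (auto simp: indep_lists_def length_Suc_conv)
  from bij_betw_same_card[OF this]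
  have "card (indep_lists U (Suc k)) = card (SIGMA vs:indep_lists U k. U - span (set vs))"
    by simp
  also have "\<dots> = (\<Sum>vs\<in>indep_lists U k. card (U - span (set vs)))"
    using finite_indep_lists[OF fin] fin by (intro card_SigmaI) auto
  also have "real \<dots> = (\<Sum>vs\<in>indep_lists U k. real (card U) - real CARD('k) ^ k)"
    unfolding of_nat_sum
  proof (rule sum.cong[OF refl])
    fix vs assume vs: "vs \<in> indep_lists U k"
    have "card (span (set vs)) \<le> card U"
      using sub[OF vs] fin by (rule card_mono[rotated])
    moreover have "card (U - span (set vs)) = card U - card (span (set vs))"
      using sub[OF vs] fin by (simp add: card_Diff_subset finite_subset)
    moreover have "card (span (set vs)) = CARD('k) ^ k"
      using card_span_indep_list[of vs] vs by (simp add: indep_lists_def)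
    ultimately show "real (card (U - span (set vs))) = real (card U) - real CARD('k) ^ k"
      by (simp add: of_nat_diff)
  qed
  also have "\<dots> = real (card (indep_lists U k)) * (real (card U) - real CARD('k) ^ k)"
    by simp
  finally show ?thesis .
qed

text \<open>Subtraction of reals keeps the formula valid for k above the dimension: the factor with
  q^j = card U vanishes.\<close>

lemma card_indep_lists:
  assumes "finite U" "subspace U"
  shows "real (card (indep_lists U k)) = (\<Prod>j<k. real (card U) - real CARD('k) ^ j)"
proof (induction k)
  case 0
  have "indep_lists U 0 = {[]}"
    by (auto simp: indep_lists_def)
  thus ?case by simp
qed (simp add: card_indep_lists_Suc[OF assms])

end

section \<open>Moebius inversion over independent lists\<close>

lemma CARD_field_ge_2: "CARD('k::{field,finite}) \<ge> 2"
proof -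
  have "card {0, 1::'k} \<le> CARD('k)"
    by (rule card_mono) auto
  thus ?thesis by simp
qed

text \<open>The Moebius function (-1)^k q^(k choose 2) of the lattice of subspaces, divided by the
  number of ordered bases of a k-dimensional space. It is also the Newton coefficient at the nodes
  1, q, q^2, ..., independent of where the expansion is cut off.\<close>

definition moebius_coeff :: "real \<Rightarrow> nat \<Rightarrow> real" where
  "moebius_coeff q k = (\<Prod>i=1..k. - (1 / (q ^ i - 1)))"

lemma abs_moebius_coeff_le_1:
  assumes "q \<ge> 2"
  shows "\<bar>moebius_coeff q k\<bar> \<le> 1"
  unfolding moebius_coeff_def abs_prod
proof (rule prod_le_1)
  fix i assume "i \<in> {1..k}"
  hence "q ^ 1 \<le> q ^ i"
    using assms by (intro power_increasing) auto
  with assms have "q ^ i - 1 \<ge> 1"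
    by simp
  thus "0 \<le> \<bar>- (1 / (q ^ i - 1))\<bar> \<and> \<bar>- (1 / (q ^ i - 1))\<bar> \<le> 1"
    by (simp add: divide_simps)
qed

text \<open>Newton interpolation of the function that is \<open>1\<close> at \<open>1\<close> and \<open>0\<close> at \<open>q, \<dots>, q\<^sup>m\<close>.\<close>

lemma newton_interpolation:
  fixes q x :: real
  assumes "q \<ge> 2"
  shows "(\<Sum>k\<le>m. moebius_coeff q k * (\<Prod>j<k. x - q ^ j)) = (\<Prod>j=1..m. (q ^ j - x) / (q ^ j - 1))"
proof (induction m)
  case 0
  show ?case by (simp add: moebius_coeff_def)
next
  case (Suc m)
  have nz: "q ^ j - 1 \<noteq> 0" if "j \<ge> 1" for j
  proof -
    have "q ^ 1 \<le> q ^ j"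
      using assms that by (intro power_increasing) auto
    with assms show ?thesis by simp
  qed
  define P where "P = (\<Prod>j=1..m. (q ^ j - x) / (q ^ j - 1))"
  have "moebius_coeff q (Suc m) * (\<Prod>j<Suc m. x - q ^ j) = P * ((1 - x) / (q ^ Suc m - 1))"
  proof -
    define A where "A = (\<Prod>j=1..m. x - q ^ j)"
    define r where "r = 1 / (q ^ Suc m - 1)"
    have a: "moebius_coeff q (Suc m) = moebius_coeff q m * - r"
      by (simp add: moebius_coeff_def r_def)
    have b: "(\<Prod>j<Suc m. x - q ^ j) = (x - 1) * A"
      unfolding A_def by (subst prod.lessThan_Suc_shift) (simp add: prod.atLeast1_atMost_eq)
    have c: "moebius_coeff q m * A = P"
      unfolding moebius_coeff_def P_def A_def prod.distrib[symmetric]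
      by (rule prod.cong) (auto simp: divide_simps nz)
    have "moebius_coeff q (Suc m) * (\<Prod>j<Suc m. x - q ^ j) = (moebius_coeff q m * A) * ((1 - x) * r)"
      unfolding a b by (simp add: algebra_simps)
    thus ?thesis
      unfolding c r_def by simp
  qed
  moreover have "(\<Prod>j=1..Suc m. (q ^ j - x) / (q ^ j - 1)) = P * ((q ^ Suc m - x) / (q ^ Suc m - 1))"
    by (simp add: P_def)
  moreover have "P + P * ((1 - x) / (q ^ Suc m - 1)) = P * ((q ^ Suc m - x) / (q ^ Suc m - 1))"
    using nz[of "Suc m"] by (simp add: field_simps)
  ultimately show ?case
    using Suc.IH by (simp add: P_def)
qed

context vector_space_over_finite_field
begin

text \<open>This is \<open>newton_interpolation\<close> at x = card U = q^t: for t = 0 every factor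
  is 1, for 1 \<le> t \<le> m the factor j = t vanishes. So a signed count of independent lists
  detects the zero subspace, with any cut-off that is at least the dimension.\<close>

lemma sum_moebius_indep_lists:
  assumes fin: "finite U" and U: "subspace U" and card: "card U = CARD('k) ^ t" and t: "t \<le> m"
  shows "(\<Sum>k\<le>m. moebius_coeff (real CARD('k)) k * real (card (indep_lists U k))) =
    (if U = {0} then 1 else 0)"
proof -
  define q where "q = real CARD('k)"
  have q2: "q \<ge> 2"
    using CARD_field_ge_2[where 'k = 'k] by (simp add: q_def)
  have nz: "q ^ j - 1 \<noteq> 0" if "j \<ge> 1" for j
  proof -
    have "q ^ 1 \<le> q ^ j"
      using q2 that by (intro power_increasing) auto
    with q2 show ?thesis by simp
  qed
  have "(\<Sum>k\<le>m. moebius_coeff q k * real (card (indep_lists U k))) =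
      (\<Prod>j=1..m. (q ^ j - q ^ t) / (q ^ j - 1))"
    using newton_interpolation[OF q2, where x = "q ^ t" and m = m]
    by (simp add: card_indep_lists[OF fin U] card q_def)
  also have "\<dots> = (if t = 0 then 1 else 0)"
  proof (cases "t = 0")
    case True
    thus ?thesis
      using nz by (simp add: prod.neutral)
  next
    case False
    hence "t \<in> {1..m}"
      using t by auto
    thus ?thesis
      using False by (auto intro!: prod_zero)
  qed
  also have "t = 0 \<longleftrightarrow> U = {0}"
  proof
    assume "t = 0"
    hence "card U = 1"
      using card by simp
    thus "U = {0}"
      using subspace_0[OF U] by (auto simp: card_1_singleton_iff)
  next
    assume "U = {0}"
    hence "CARD('k) ^ t = 1"
      using card by simp
    thus "t = 0"
      using CARD_field_ge_2[where 'k = 'k] by (simp add: nat_power_eq_Suc_0_iff)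
  qed
  finally show ?thesis
    by (simp add: q_def)
qed

end

section \<open>Characters on spaces of linear maps\<close>

lemma vector_space_field: "vector_space ((*) :: 'k::field \<Rightarrow> 'k \<Rightarrow> 'k)"
  by unfold_locales (auto simp: algebra_simps)

lemma vector_space_functions: "vector_space (\<lambda>(c::'k::field) (f::'a \<Rightarrow> 'k) x. c * f x)"
  by unfold_locales (auto simp: algebra_simps fun_eq_iff)

lemma finite_maps: "finite (UNIV::'a set) \<Longrightarrow> finite (UNIV::'b set) \<Longrightarrow> finite (S :: ('a \<Rightarrow> 'b) set)"
  by (rule finite_subset[OF subset_UNIV])
     (use finite_set_of_finite_funs[of "UNIV::'a set" "UNIV::'b set" undefined] in simp)

lemma linmaps_iff:
  "vector_space s1 \<Longrightarrow> vector_space s2 \<Longrightarrow>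
    A \<in> linmaps s1 s2 \<longleftrightarrow> (\<forall>x y. A (x + y) = A x + A y) \<and> (\<forall>c x. A (s1 c x) = s2 c (A x))"
  unfolding linmaps_def Vector_Spaces.linear_iff by auto

lemma linmaps_module_hom: "A \<in> linmaps s1 s2 \<Longrightarrow> module_hom s1 s2 A"
  by (simp add: linmaps_def module_hom_iff_linear)

lemmas linmaps_zero = module_hom.zero[OF linmaps_module_hom]
  and linmaps_add = module_hom.add[OF linmaps_module_hom]
  and linmaps_diff = module_hom.diff[OF linmaps_module_hom]
  and linmaps_scale = module_hom.scale[OF linmaps_module_hom]
  and linmaps_sum = module_hom.sum[OF linmaps_module_hom]

lemma linmaps_comp: "A \<in> linmaps s2 s3 \<Longrightarrow> B \<in> linmaps s1 s2 \<Longrightarrow> A \<circ> B \<in> linmaps s1 s3"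
  unfolding linmaps_def using Vector_Spaces.linear_compose by blast

text \<open>The elementary tensor of a vector and a functional; these are the maps of rank at most
  one.\<close>

definition outer :: "('k \<Rightarrow> 'w \<Rightarrow> 'w) \<Rightarrow> 'w \<Rightarrow> ('v \<Rightarrow> 'k) \<Rightarrow> 'v \<Rightarrow> 'w" where
  "outer s t \<xi> = (\<lambda>x. s (\<xi> x) t)"

context vector_space
begin

lemma trace_add: "trace scale (g + h) = trace scale g + trace scale h"
  unfolding trace_def Let_def
  by (simp add: representation_add independent_extend_basis independent_empty sum.distrib)

lemma trace_outer:
  assumes "finite (UNIV::'b set)" "\<xi> \<in> linmaps scale (*)"
  shows "trace scale (outer scale v \<xi>) = \<xi> v"
proof -
  define B where "B = extend_basis {}"
  have B: "independent B" "span B = UNIV"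
    by (simp_all add: B_def independent_extend_basis independent_empty)
  have fin: "finite B"
    by (rule finite_subset[OF subset_UNIV assms(1)])
  have "trace scale (outer scale v \<xi>) = (\<Sum>b\<in>B. \<xi> (scale (representation B v b) b))"
    unfolding trace_def Let_def B_def[symmetric] outer_def linmaps_scale[OF assms(2)]
    using B by (intro sum.cong refl) (simp add: representation_scale)
  also have "\<dots> = \<xi> (\<Sum>b\<in>B. scale (representation B v b) b)"
    by (rule linmaps_sum[OF assms(2), symmetric])
  also have "(\<Sum>b\<in>B. scale (representation B v b) b) = v"
    using B fin by (intro sum_representation_eq) auto
  finally show ?thesis .
qed

lemma trace_comp_commute:
  assumes "finite (UNIV::'b set)" "M \<in> linmaps scale scale" "N \<in> linmaps scale scale"
  shows "trace scale (M \<circ> N) = trace scale (N \<circ> M)"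
proof -
  define B where "B = extend_basis {}"
  have B: "independent B" "span B = UNIV"
    by (simp_all add: B_def independent_extend_basis independent_empty)
  have fin: "finite B"
    by (rule finite_subset[OF subset_UNIV assms(1)])
  have *: "trace scale (M \<circ> N) = (\<Sum>b\<in>B. \<Sum>b'\<in>B. representation B (N b) b' * representation B (M b') b)"
    if M: "M \<in> linmaps scale scale" for M N
  proof -
    have "representation B (M (N b)) b = (\<Sum>b'\<in>B. representation B (N b) b' * representation B (M b') b)" for b
    proof -
      have "M (N b) = M (\<Sum>b'\<in>B. scale (representation B (N b) b') b')"
        using B fin by (subst sum_representation_eq) auto
      also have "\<dots> = (\<Sum>b'\<in>B. scale (representation B (N b) b') (M b'))"
        by (simp add: linmaps_sum[OF M] linmaps_scale[OF M])
      finally show ?thesis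
        using B by (simp add: representation_sum representation_scale)
    qed
    thus ?thesis
      unfolding trace_def Let_def B_def[symmetric] by simp
  qed
  show ?thesis
    unfolding *[OF assms(2)] *[OF assms(3)]
    by (subst sum.swap) (simp add: mult.commute)
qed

lemma ex_linear_functional:
  assumes "v \<noteq> 0"
  shows "\<exists>\<xi>\<in>linmaps scale (*). \<xi> v = c"
proof -
  interpret F: vector_space "(*) :: 'a \<Rightarrow> 'a \<Rightarrow> 'a"
    by (rule vector_space_field)
  interpret vector_space_pair scale "(*)" ..
  have "independent {v}"
    using assms by simp
  from linear_independent_extend[OF this, of "\<lambda>_. c"] show ?thesis
    by (auto simp: linmaps_def)
qed

end

text \<open>The three assumptions on \<phi> are all that the argument uses about the additive
  character, so p and m disappear until the final theorem.\<close>

locale bilinear_scheme =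
  V: finite_dimensional_vector_space sV BV + W: finite_dimensional_vector_space sW BW
  for sV :: "'k::{field,finite} \<Rightarrow> 'v::ab_group_add \<Rightarrow> 'v" and BV
    and sW :: "'k \<Rightarrow> 'w::ab_group_add \<Rightarrow> 'w" and BW +
  fixes \<phi> :: "'k \<Rightarrow> complex"
  assumes phi_add: "\<phi> (x + y) = \<phi> x * \<phi> y"
    and norm_phi: "cmod (\<phi> x) = 1"
    and phi_nontrivial: "\<exists>x. \<phi> x \<noteq> 1"
begin

sublocale VF: vector_space_over_finite_field sV ..
sublocale WF: vector_space_over_finite_field sW ..

abbreviation "sD \<equiv> \<lambda>(c::'k) (\<eta>::'w \<Rightarrow> 'k) w. c * \<eta> w"

sublocale DF: vector_space_over_finite_field sD
  by (rule vector_space_over_finite_field.intro) (rule vector_space_functions)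

lemma finite_V: "finite (UNIV::'v set)"
proof -
  have "card (UNIV::'v set) = CARD('k) ^ card BV"
    using VF.card_span_independent[OF V.finite_Basis V.independent_Basis] by (simp add: V.span_Basis)
  hence "card (UNIV::'v set) > 0"
    by simp
  thus ?thesis
    by (rule card_ge_0_finite)
qed

lemma finite_W: "finite (UNIV::'w set)"
proof -
  have "card (UNIV::'w set) = CARD('k) ^ card BW"
    using WF.card_span_independent[OF W.finite_Basis W.independent_Basis] by (simp add: W.span_Basis)
  hence "card (UNIV::'w set) > 0"
    by simp
  thus ?thesis
    by (rule card_ge_0_finite)
qed

lemma finite_V_set [simp]: "finite (S::'v set)"
  by (rule finite_subset[OF subset_UNIV finite_V])

lemma finite_W_set [simp]: "finite (S::'w set)"
  by (rule finite_subset[OF subset_UNIV finite_W])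

lemma finite_VW [simp]: "finite (S::('v \<Rightarrow> 'w) set)"
  by (rule finite_maps) (rule finite_V finite_W)+

lemma finite_WV [simp]: "finite (S::('w \<Rightarrow> 'v) set)"
  by (rule finite_maps) (rule finite_V finite_W)+

lemma finite_VK [simp]: "finite (S::('v \<Rightarrow> 'k) set)"
  by (rule finite_maps) (rule finite_V finite)+

lemma finite_WK [simp]: "finite (S::('w \<Rightarrow> 'k) set)"
  by (rule finite_maps) (rule finite_W finite)+

abbreviation "G \<equiv> linmaps sV sW"
abbreviation "H \<equiv> linmaps sW sV"
abbreviation "EV \<equiv> linmaps sV sV"
abbreviation "EW \<equiv> linmaps sW sW"
abbreviation "DV \<equiv> linmaps sV ((*) :: 'k \<Rightarrow> 'k \<Rightarrow> 'k)"
abbreviation "DW \<equiv> linmaps sW ((*) :: 'k \<Rightarrow> 'k \<Rightarrow> 'k)"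

definition q :: real where "q = real CARD('k)"

lemma q_ge_2: "q \<ge> 2"
  unfolding q_def using CARD_field_ge_2[where 'k = 'k] by simp

lemma q_gt_0: "q > 0" and q_ge_1: "q \<ge> 1" and q_neq_0: "q \<noteq> 0"
  using q_ge_2 by auto

lemmas lin_iff =
  linmaps_iff[OF V.vector_space_axioms W.vector_space_axioms]
  linmaps_iff[OF W.vector_space_axioms V.vector_space_axioms]
  linmaps_iff[OF V.vector_space_axioms V.vector_space_axioms]
  linmaps_iff[OF W.vector_space_axioms W.vector_space_axioms]
  linmaps_iff[OF V.vector_space_axioms vector_space_field]
  linmaps_iff[OF W.vector_space_axioms vector_space_field]

lemmas scale_simps = V.scale_right_distrib W.scale_right_distrib V.scale_left_distrib
  W.scale_left_distrib V.scale_right_diff_distrib W.scale_right_diff_distrib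
  V.scale_left_diff_distrib W.scale_left_diff_distrib V.scale_left_commute W.scale_left_commute

lemmas linear_simps = linmaps_zero linmaps_diff linmaps_add linmaps_scale

lemma linear_closed:
  "A \<in> G \<Longrightarrow> B \<in> G \<Longrightarrow> A + B \<in> G" "A \<in> G \<Longrightarrow> B \<in> G \<Longrightarrow> A - B \<in> G" "0 \<in> G"
  "X \<in> H \<Longrightarrow> Y \<in> H \<Longrightarrow> X + Y \<in> H" "X \<in> H \<Longrightarrow> Y \<in> H \<Longrightarrow> X - Y \<in> H" "0 \<in> H"
  "\<xi> \<in> DV \<Longrightarrow> \<xi>' \<in> DV \<Longrightarrow> \<xi> + \<xi>' \<in> DV" "\<xi> \<in> DV \<Longrightarrow> \<xi>' \<in> DV \<Longrightarrow> \<xi> - \<xi>' \<in> DV" "0 \<in> DV"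
  "\<eta> \<in> DW \<Longrightarrow> \<eta>' \<in> DW \<Longrightarrow> \<eta> + \<eta>' \<in> DW" "\<eta> \<in> DW \<Longrightarrow> \<eta>' \<in> DW \<Longrightarrow> \<eta> - \<eta>' \<in> DW" "0 \<in> DW"
  "\<xi> \<in> DV \<Longrightarrow> outer sW t \<xi> \<in> G" "\<eta> \<in> DW \<Longrightarrow> outer sV v \<eta> \<in> H"
  "\<xi> \<in> DV \<Longrightarrow> outer sV v \<xi> \<in> EV" "\<eta> \<in> DW \<Longrightarrow> outer sW t \<eta> \<in> EW" "id \<in> EV" "id \<in> EW"
  unfolding lin_iff outer_def by (auto simp: algebra_simps scale_simps)

definition chi :: "('w \<Rightarrow> 'v) \<Rightarrow> ('v \<Rightarrow> 'w) \<Rightarrow> complex" where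
  "chi X A = \<phi> (trace sV (X \<circ> A))"

lemma phi_0: "\<phi> 0 = 1"
  using phi_add[of 0 0] norm_phi[of 0] by auto

lemma norm_chi [simp]: "cmod (chi X A) = 1"
  by (simp add: chi_def norm_phi)

lemma chi_add_left: "chi (X + Y) A = chi X A * chi Y A"
proof -
  have "(X + Y) \<circ> A = (X \<circ> A) + (Y \<circ> A)"
    by (auto simp: fun_eq_iff)
  thus ?thesis
    by (simp add: chi_def V.trace_add phi_add)
qed

lemma chi_add_right:
  assumes "X \<in> H"
  shows "chi X (A + B) = chi X A * chi X B"
proof -
  have "X \<circ> (A + B) = (X \<circ> A) + (X \<circ> B)"
    using assms by (auto simp: fun_eq_iff linear_simps)
  thus ?thesis
    by (simp add: chi_def V.trace_add phi_add)
qed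

lemma chi_0_left [simp]: "chi 0 A = 1"
proof -
  have "chi 0 A = chi 0 A * chi 0 A"
    using chi_add_left[of 0 0 A] by simp
  moreover have "chi 0 A \<noteq> 0"
    using norm_chi[of 0 A] norm_zero zero_neq_one by metis
  ultimately show ?thesis by simp
qed

lemma chi_mult_cnj: "chi X A * cnj (chi Y A) = chi (X - Y) A"
proof -
  have 1: "chi Y A * cnj (chi Y A) = 1"
    using complex_norm_square[of "chi Y A"] by simp
  have "chi X A = chi (X - Y) A * chi Y A"
    using chi_add_left[of "X - Y" Y A] by simp
  hence "chi X A * cnj (chi Y A) = chi (X - Y) A * (chi Y A * cnj (chi Y A))"
    by (simp only: mult.assoc)
  thus ?thesis
    unfolding 1 by simp
qed

text \<open>Cyclicity of the trace moves \<pi> to the front. Hence the substitution A to \<rho> A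
  \<pi> is adjoint to X to \<pi> X \<rho>, the basis of all restrictions below.\<close>

lemma chi_comp:
  assumes "X \<in> H" "A \<in> G" "\<pi> \<in> EV" "\<rho> \<in> EW"
  shows "chi X (\<rho> \<circ> A \<circ> \<pi>) = chi (\<pi> \<circ> X \<circ> \<rho>) A"
  unfolding chi_def using V.trace_comp_commute[OF finite_V, of "X \<circ> \<rho> \<circ> A" \<pi>] assms
  by (simp add: linmaps_comp comp_assoc)

lemma chi_outer:
  assumes "X \<in> H" "\<xi> \<in> DV"
  shows "chi X (outer sW t \<xi>) = \<phi> (\<xi> (X t))"
proof -
  have "X \<circ> outer sW t \<xi> = outer sV (X t) \<xi>"
    using assms by (auto simp: outer_def fun_eq_iff linear_simps)
  thus ?thesis
    using V.trace_outer[OF finite_V assms(2)] by (simp add: chi_def)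
qed

section \<open>Orthogonality relations and Parseval\<close>

lemma ex_functional_phi:
  assumes "v \<noteq> 0"
  shows "\<exists>\<xi>\<in>DV. \<phi> (\<xi> v) \<noteq> 1"
proof -
  from phi_nontrivial obtain c where "\<phi> c \<noteq> 1" ..
  with V.ex_linear_functional[OF assms, of c] show ?thesis by auto
qed

lemma sum_chi:
  assumes "X \<in> H"
  shows "(\<Sum>A\<in>G. chi X A) = (if X = 0 then of_nat (card G) else 0)"
proof -
  have "(\<Sum>A\<in>G. chi X A) = (if \<forall>A\<in>G. chi X A = 1 then of_nat (card G) else 0)"
    by (rule sum_character) (use assms in \<open>auto simp: linear_closed chi_add_right\<close>)
  \<comment> \<open>If X t \<noteq> 0, the rank-one maps \<open>outer sW t \<xi>\<close> already
    witness that the character is nontrivial.\<close>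
  moreover have "\<exists>A\<in>G. chi X A \<noteq> 1" if "X \<noteq> 0"
  proof -
    from that obtain t where "X t \<noteq> 0"
      by (auto simp: fun_eq_iff)
    then obtain \<xi> where "\<xi> \<in> DV" "\<phi> (\<xi> (X t)) \<noteq> 1"
      using ex_functional_phi by blast
    thus ?thesis
      using chi_outer[OF assms, of \<xi> t] by (intro bexI[of _ "outer sW t \<xi>"]) (auto simp: linear_closed)
  qed
  ultimately show ?thesis
    by (cases "X = 0") auto
qed

lemma sum_DV: "(\<Sum>\<xi>\<in>DV. \<phi> (\<xi> v)) = (if v = 0 then of_nat (card DV) else 0)"
proof -
  have "(\<Sum>\<xi>\<in>DV. \<phi> (\<xi> v)) = (if \<forall>\<xi>\<in>DV. \<phi> (\<xi> v) = 1 then of_nat (card DV) else 0)"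
    by (rule sum_character) (auto simp: linear_closed phi_add)
  thus ?thesis
    using ex_functional_phi[of v] by (cases "v = 0") (auto simp: linmaps_zero phi_0)
qed

lemma sum_phi_mult: "(\<Sum>c\<in>UNIV. \<phi> (c * a)) = (if a = 0 then of_real q else 0)"
proof -
  have "(\<Sum>c\<in>UNIV. \<phi> (c * a)) = (if \<forall>c\<in>(UNIV::'k set). \<phi> (c * a) = 1 then of_nat CARD('k) else 0)"
    by (rule sum_character) (auto simp: phi_add algebra_simps)
  moreover have "\<exists>c. \<phi> (c * a) \<noteq> 1" if "a \<noteq> 0"
  proof -
    from phi_nontrivial obtain c where "\<phi> c \<noteq> 1" ..
    with that show ?thesis by (intro exI[of _ "c / a"]) simp
  qed
  ultimately show ?thesis
    by (cases "a = 0") (auto simp: phi_0 q_def)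
qed

definition F :: "(('w \<Rightarrow> 'v) \<Rightarrow> complex) \<Rightarrow> ('v \<Rightarrow> 'w) \<Rightarrow> complex" where
  "F x A = (\<Sum>X\<in>H. x X * chi X A)"

text \<open>Coefficients carry counting measure while functions on G are averaged, so by
  \<open>parseval\<close> this is the squared norm of \<open>F x\<close> in the second
  space.\<close>

definition nsq :: "(('w \<Rightarrow> 'v) \<Rightarrow> complex) \<Rightarrow> real" where
  "nsq x = (\<Sum>X\<in>H. (cmod (x X))\<^sup>2)"

definition conv where
  "conv x y Z = (\<Sum>X\<in>H. x X * (y (Z - X) :: complex))" for x :: "('w \<Rightarrow> 'v) \<Rightarrow> complex"

lemma nsq_nonneg [simp]: "nsq x \<ge> 0"
  by (simp add: nsq_def sum_nonneg)

lemma card_G_pos: "card G > 0"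
  using linear_closed(3) by (auto simp: card_gt_0_iff)

lemma parseval: "(\<Sum>A\<in>G. (cmod (F x A))\<^sup>2) = real (card G) * nsq x"
proof -
  have "complex_of_real (\<Sum>A\<in>G. (cmod (F x A))\<^sup>2) = (\<Sum>A\<in>G. F x A * cnj (F x A))"
    unfolding of_real_sum by (intro sum.cong refl complex_norm_square)
  also have "\<dots> = (\<Sum>A\<in>G. \<Sum>X\<in>H. \<Sum>Y\<in>H. x X * cnj (x Y) * chi (X - Y) A)"
    unfolding F_def cnj_sum sum_product
    by (intro sum.cong refl) (simp flip: chi_mult_cnj)
  also have "\<dots> = (\<Sum>X\<in>H. \<Sum>Y\<in>H. \<Sum>A\<in>G. x X * cnj (x Y) * chi (X - Y) A)"
    by (subst sum.swap, rule sum.cong[OF refl], rule sum.swap)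
  also have "\<dots> = (\<Sum>X\<in>H. \<Sum>Y\<in>H. if Y = X then x X * cnj (x X) * of_nat (card G) else 0)"
    by (intro sum.cong refl) (auto simp: sum_chi linear_closed simp flip: sum_distrib_left)
  also have "\<dots> = (\<Sum>X\<in>H. x X * cnj (x X) * of_nat (card G))"
    by (simp add: sum.delta)
  also have "\<dots> = of_real (real (card G) * nsq x)"
    unfolding nsq_def of_real_mult of_real_sum complex_norm_square sum_distrib_left
    by (simp add: mult_ac)
  finally show ?thesis
    using of_real_eq_iff by blast
qed

lemma F_conv:
  assumes "A \<in> G"
  shows "F (conv x y) A = F x A * F y A"
proof -
  have "F (conv x y) A = (\<Sum>Z\<in>H. \<Sum>X\<in>H. x X * y (Z - X) * chi Z A)"
    unfolding F_def conv_def by (simp add: sum_distrib_right)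
  also have "\<dots> = (\<Sum>X\<in>H. \<Sum>Z\<in>H. x X * y (Z - X) * chi Z A)"
    by (rule sum.swap)
  also have "\<dots> = (\<Sum>X\<in>H. \<Sum>Y\<in>H. x X * y Y * chi (X + Y) A)"
  proof (rule sum.cong[OF refl])
    fix X assume "X \<in> H"
    thus "(\<Sum>Z\<in>H. x X * y (Z - X) * chi Z A) = (\<Sum>Y\<in>H. x X * y Y * chi (X + Y) A)"
      by (intro sum.reindex_bij_witness[of _ "\<lambda>Y. X + Y" "\<lambda>Z. Z - X"]) (auto simp: linear_closed)
  qed
  also have "\<dots> = F x A * F y A"
    unfolding F_def sum_product by (simp add: chi_add_left mult_ac)
  finally show ?thesis .
qed

end

section \<open>Ranks, images and coimages\<close>

lemma (in vector_space_over_finite_field) card_subspace: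
  assumes "finite S" "subspace S"
  shows "card S = CARD('k) ^ dim S"
proof -
  obtain B where B: "B \<subseteq> S" "independent B" "S \<subseteq> span B" "card B = dim S"
    using basis_exists by blast
  have "finite B"
    using B(1) assms(1) by (rule finite_subset)
  moreover have "span B = S"
    by (rule span_subspace[OF B(1,3) assms(2)])
  ultimately show ?thesis
    using card_span_independent[of B] B by simp
qed

context bilinear_scheme
begin

abbreviation "rk X \<equiv> rank sV X"

text \<open>The annihilator of the kernel, which is the range of the transpose of X. Transposition
  exchanges images with coimages, which explains the paired lemmas from here on.\<close>

definition cim :: "('w \<Rightarrow> 'v) \<Rightarrow> ('w \<Rightarrow> 'k) set" where
  "cim X = {\<eta>\<in>DW. \<forall>w. X w = 0 \<longrightarrow> \<eta> w = 0}"

lemma subspace_range: "X \<in> H \<Longrightarrow> V.subspace (range X)"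
  by (rule module_hom.subspace_image[OF linmaps_module_hom W.subspace_UNIV])

lemma subspace_cim: "DF.subspace (cim X)"
proof (rule DF.subspaceI)
  fix c and \<eta> assume "\<eta> \<in> cim X"
  thus "sD c \<eta> \<in> cim X"
    unfolding cim_def lin_iff by (auto simp: algebra_simps)
qed (auto simp: cim_def linear_closed)

lemma card_range: "X \<in> H \<Longrightarrow> card (range X) = CARD('k) ^ rk X"
  unfolding rank_def by (rule VF.card_subspace[OF finite_V_set subspace_range])

lemma real_card_range: "X \<in> H \<Longrightarrow> real (card (range X)) = q ^ rk X"
  by (simp add: card_range q_def)

lemma CARD_power_le_iff [simp]: "CARD('k) ^ a \<le> CARD('k) ^ b \<longleftrightarrow> a \<le> b"
  using CARD_field_ge_2[where 'k = 'k] by (simp add: power_increasing_iff)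

lemma q_power_le_iff [simp]: "q ^ a \<le> q ^ b \<longleftrightarrow> a \<le> b"
  using q_ge_2 by (simp add: power_increasing_iff)

lemma card_W_eq: "X \<in> H \<Longrightarrow> card (UNIV::'w set) = card (range X) * card {w. X w = 0}"
  using card_image_times_card_kernel[of "UNIV::'w set" X] by (simp add: linmaps_add)

text \<open>A functional that is nonzero somewhere on U takes every value of the field there, by
  scaling, so a nontrivial \<phi> notices it.\<close>

lemma sum_annihilator:
  fixes s :: "'k \<Rightarrow> 'x::ab_group_add \<Rightarrow> 'x"
  assumes s: "vector_space s" and U: "module.subspace s U" and \<xi>: "\<xi> \<in> linmaps s (*)"
  shows "(\<Sum>u\<in>U. \<phi> (\<xi> u)) = (if \<forall>u\<in>U. \<xi> u = 0 then of_nat (card U) else 0)"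
proof -
  interpret S: vector_space s by (rule s)
  have "(\<Sum>u\<in>U. \<phi> (\<xi> u)) = (if \<forall>u\<in>U. \<phi> (\<xi> u) = 1 then of_nat (card U) else 0)"
    by (rule sum_character)
       (use U \<xi> in \<open>auto simp: linmaps_add phi_add S.subspace_add S.subspace_diff\<close>)
  moreover have "\<exists>u\<in>U. \<phi> (\<xi> u) \<noteq> 1" if u: "u \<in> U" "\<xi> u \<noteq> 0" for u
  proof -
    from phi_nontrivial obtain c where "\<phi> c \<noteq> 1" ..
    thus ?thesis
      using u U \<xi> by (intro bexI[of _ "s (c / \<xi> u) u"]) (auto simp: linmaps_scale S.subspace_scale)
  qed
  ultimately show ?thesis
    by (auto simp: phi_0)
qed

text \<open>The double sum of \<phi> (\<xi> u) is evaluated in both orders: over u first it sees the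
  functionals that kill U, over \<xi> first only u = 0.\<close>

lemma card_annihilator:
  assumes U: "V.subspace U"
  shows "card {\<xi>\<in>DV. \<forall>u\<in>U. \<xi> u = 0} * card U = card DV"
proof -
  have "complex_of_nat (card {\<xi>\<in>DV. \<forall>u\<in>U. \<xi> u = 0} * card U) = (\<Sum>\<xi>\<in>DV. \<Sum>u\<in>U. \<phi> (\<xi> u))"
    by (simp add: sum_annihilator[OF V.vector_space_axioms U] sum.If_cases Int_def)
  also have "\<dots> = (\<Sum>u\<in>U. if u = 0 then of_nat (card DV) else 0)"
    by (subst sum.swap) (simp add: sum_DV)
  also have "\<dots> = of_nat (card DV)"
    using V.subspace_0[OF U] by (simp add: sum.delta)
  finally show ?thesis
    by (simp only: of_nat_eq_iff)
qed

lemma card_DV_pos: "card DV > 0"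
  using linear_closed(9) by (auto simp: card_gt_0_iff)

text \<open>A functional that vanishes on the kernel factors through X, a right inverse of X
  supplying the factor. So \<open>cim X\<close> is covered by the functionals on V modulo those that
  kill \<open>range X\<close>.\<close>

lemma card_cim_le:
  assumes X: "X \<in> H"
  shows "card (cim X) \<le> CARD('k) ^ rk X"
proof -
  interpret WV: vector_space_pair sW sV ..
  obtain g where g: "Vector_Spaces.linear sV sW g" "\<And>y. y \<in> range X \<Longrightarrow> X (g y) = y"
    using WV.linear_exists_right_inverse_on[of X UNIV] X by (auto simp: linmaps_def)
  have sub: "cim X \<subseteq> (\<lambda>\<zeta>. \<zeta> \<circ> X) ` DV"
  proof
    fix \<eta> assume "\<eta> \<in> cim X"
    hence \<eta>: "\<eta> \<in> DW" "\<And>w. X w = 0 \<Longrightarrow> \<eta> w = 0"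
      by (auto simp: cim_def)
    have "\<eta> w = \<eta> (g (X w))" for w
    proof -
      have "X (w - g (X w)) = 0"
        using X g(2)[of "X w"] by (simp add: linmaps_diff)
      hence "\<eta> (w - g (X w)) = 0"
        by (rule \<eta>(2))
      thus ?thesis
        using \<eta>(1) by (simp add: linmaps_diff)
    qed
    moreover have "\<eta> \<circ> g \<in> DV"
      using \<eta>(1) g(1) by (intro linmaps_comp) (auto simp: linmaps_def)
    ultimately show "\<eta> \<in> (\<lambda>\<zeta>. \<zeta> \<circ> X) ` DV"
      by (intro image_eqI[of _ _ "\<eta> \<circ> g"]) auto
  qed
  have eq: "{\<zeta>\<in>DV. \<zeta> \<circ> X = 0} = {\<zeta>\<in>DV. \<forall>u\<in>range X. \<zeta> u = 0}"
    by (auto simp: fun_eq_iff)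
  have "card DV = card ((\<lambda>\<zeta>. \<zeta> \<circ> X) ` DV) * card {\<zeta>\<in>DV. \<zeta> \<circ> X = 0}"
    by (rule card_image_times_card_kernel) (auto simp: linear_closed fun_eq_iff)
  moreover have ann: "card {\<zeta>\<in>DV. \<zeta> \<circ> X = 0} * card (range X) = card DV"
    unfolding eq by (rule card_annihilator[OF subspace_range[OF X]])
  moreover have "card {\<zeta>\<in>DV. \<zeta> \<circ> X = 0} \<noteq> 0"
    using ann card_DV_pos by (intro notI) simp
  ultimately have "card ((\<lambda>\<zeta>. \<zeta> \<circ> X) ` DV) = card (range X)"
    by (simp add: mult.commute[of "card {\<zeta>\<in>DV. \<zeta> \<circ> X = 0}"])
  thus ?thesis
    using card_mono[OF _ sub] card_range[OF X] by simp
qed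

lemma real_card_cim_le: "X \<in> H \<Longrightarrow> real (card (cim X)) \<le> q ^ rk X"
  unfolding q_def using card_cim_le by (metis of_nat_le_iff of_nat_power)

lemma rk_add_le:
  assumes "X \<in> H" "Y \<in> H"
  shows "rk (X + Y) \<le> rk X + rk Y"
proof -
  have "range (X + Y) \<subseteq> (\<lambda>(u, v). u + v) ` (range X \<times> range Y)"
    by auto
  hence "card (range (X + Y)) \<le> card (range X \<times> range Y)"
    by (rule surj_card_le[rotated]) simp
  thus ?thesis
    unfolding card_cartesian_product card_range[OF assms(1)] card_range[OF assms(2)]
      card_range[OF linear_closed(4)[OF assms]] power_add[symmetric] CARD_power_le_iff .
qed

text \<open>For \<xi> v = 1 this is the projection along v onto the kernel of \<xi>. It replaces the
  quotient map of V by the line of v, but stays inside V.\<close>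

definition projV :: "'v \<Rightarrow> ('v \<Rightarrow> 'k) \<Rightarrow> 'v \<Rightarrow> 'v" where
  "projV v \<xi> = id - outer sV v \<xi>"

definition projW :: "'w \<Rightarrow> ('w \<Rightarrow> 'k) \<Rightarrow> 'w \<Rightarrow> 'w" where
  "projW t \<eta> = id - outer sW t \<eta>"

lemma projV_apply: "projV v \<xi> u = u - sV (\<xi> u) v"
  and projW_apply: "projW t \<eta> w = w - sW (\<eta> w) t"
  by (simp_all add: projV_def projW_def outer_def)

lemma projV_linear: "\<xi> \<in> DV \<Longrightarrow> projV v \<xi> \<in> EV"
  and projW_linear: "\<eta> \<in> DW \<Longrightarrow> projW t \<eta> \<in> EW"
  unfolding lin_iff projV_apply projW_apply by (auto simp: algebra_simps scale_simps)

lemma card_scale_range: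
  "(v::'v) \<noteq> 0 \<Longrightarrow> card (range (\<lambda>c. sV c v)) = CARD('k)"
  "(t::'w) \<noteq> 0 \<Longrightarrow> card (range (\<lambda>c. sW c t)) = CARD('k)"
  by (auto intro!: card_image inj_onI)

lemma projV_kernel: "\<xi> \<in> DV \<Longrightarrow> \<xi> v = 1 \<Longrightarrow> {u. projV v \<xi> u = 0} = range (\<lambda>c. sV c v)"
  by (auto simp: projV_apply linmaps_scale)

lemma projW_kernel: "\<eta> \<in> DW \<Longrightarrow> \<eta> t = 1 \<Longrightarrow> {w. projW t \<eta> w = 0} = range (\<lambda>c. sW c t)"
  by (auto simp: projW_apply linmaps_scale)

lemma card_projV_kernel: "\<xi> \<in> DV \<Longrightarrow> \<xi> v = 1 \<Longrightarrow> card {u. projV v \<xi> u = 0} = CARD('k)"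
  by (subst projV_kernel) (auto intro!: card_scale_range simp: linmaps_zero)

lemma card_projW_kernel: "\<eta> \<in> DW \<Longrightarrow> \<eta> t = 1 \<Longrightarrow> card {w. projW t \<eta> w = 0} = CARD('k)"
  by (subst projW_kernel) (auto intro!: card_scale_range simp: linmaps_zero)

text \<open>The kernel of the projection is the line of v, which lies inside \<open>range X\<close>;
  so exactly one dimension is lost.\<close>

lemma rk_projV:
  assumes X: "X \<in> H" and \<xi>: "\<xi> \<in> DV" "\<xi> v = 1" and v: "v \<in> range X"
  shows "rk X = Suc (rk (projV v \<xi> \<circ> X))"
proof -
  have XV: "projV v \<xi> \<circ> X \<in> H"
    by (rule linmaps_comp[OF projV_linear[OF \<xi>(1)] X])
  have "card (range X) = card (projV v \<xi> ` range X) * card {u\<in>range X. projV v \<xi> u = 0}"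
    by (rule card_image_times_card_kernel)
       (use subspace_range[OF X] in \<open>auto simp: V.subspace_diff linmaps_add[OF projV_linear[OF \<xi>(1)]]
         simp del: image_iff\<close>)
  also have "{u\<in>range X. projV v \<xi> u = 0} = {u. projV v \<xi> u = 0}"
  proof -
    have "{u. projV v \<xi> u = 0} \<subseteq> range X"
      unfolding projV_kernel[OF \<xi>] using V.subspace_scale[OF subspace_range[OF X] v] by blast
    thus ?thesis by blast
  qed
  also have "projV v \<xi> ` range X = range (projV v \<xi> \<circ> X)"
    by (simp add: image_comp)
  finally have "CARD('k) ^ rk X = CARD('k) ^ Suc (rk (projV v \<xi> \<circ> X))"
    unfolding card_range[OF X] card_range[OF XV] card_projV_kernel[OF \<xi>] by simp
  thus ?thesis
    using CARD_power_le_iff by (metis le_antisym order_refl)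
qed

text \<open>The range of the projection is the hyperplane \<eta> = 0. It contains the kernel of X
  because \<eta> is in \<open>cim X\<close>, so X restricted to it keeps its kernel and loses one
  dimension of its range.\<close>

lemma rk_projW:
  assumes X: "X \<in> H" and \<eta>: "\<eta> t = 1" "\<eta> \<in> cim X"
  shows "rk X = Suc (rk (X \<circ> projW t \<eta>))"
proof -
  have \<eta>W: "\<eta> \<in> DW" and ker: "\<And>w. X w = 0 \<Longrightarrow> \<eta> w = 0"
    using \<eta> by (auto simp: cim_def)
  have XW: "X \<circ> projW t \<eta> \<in> H"
    by (rule linmaps_comp[OF X projW_linear[OF \<eta>W]])
  have "range (projW t \<eta>) = {w. \<eta> w = 0}"
  proof safe
    fix w show "\<eta> (projW t \<eta> w) = 0"
      using \<eta>W \<eta>(1) by (simp add: projW_apply linmaps_diff linmaps_scale)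
  next
    fix w assume "\<eta> w = 0"
    thus "w \<in> range (projW t \<eta>)"
      by (intro image_eqI[of _ _ w]) (simp_all add: projW_apply)
  qed
  hence r: "range (X \<circ> projW t \<eta>) = X ` {w. \<eta> w = 0}"
    by (metis image_comp)
  have "card {w. \<eta> w = 0} = card (X ` {w. \<eta> w = 0}) * card {w\<in>{w. \<eta> w = 0}. X w = 0}"
    by (rule card_image_times_card_kernel) (use X \<eta>W in \<open>auto simp: linmaps_diff linmaps_add\<close>)
  also have "{w\<in>{w. \<eta> w = 0}. X w = 0} = {w. X w = 0}"
    using ker by blast
  finally have 1: "card {w. \<eta> w = 0} = card (range (X \<circ> projW t \<eta>)) * card {w. X w = 0}"
    by (simp only: r)
  have "range \<eta> = UNIV"
  proof -
    have "c = \<eta> (sW c t)" for c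
      using \<eta>W \<eta>(1) by (simp add: linmaps_scale)
    thus ?thesis by blast
  qed
  hence 2: "card (UNIV::'w set) = CARD('k) * card {w. \<eta> w = 0}"
    using card_image_times_card_kernel[of "UNIV::'w set" \<eta>] \<eta>W by (simp add: linmaps_add)
  have 3: "card {w. X w = 0} > 0"
    using linmaps_zero[OF X] by (auto simp: card_gt_0_iff)
  have "card (range X) * card {w. X w = 0} = (CARD('k) * card (range (X \<circ> projW t \<eta>))) * card {w. X w = 0}"
    unfolding card_W_eq[OF X, symmetric] 2 1 by (simp only: mult_ac)
  hence "card (range X) = CARD('k) * card (range (X \<circ> projW t \<eta>))"
    using 3 by (metis mult_cancel2 less_irrefl)
  hence "CARD('k) ^ rk X = CARD('k) ^ Suc (rk (X \<circ> projW t \<eta>))"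
    unfolding card_range[OF X] card_range[OF XW] by simp
  thus ?thesis
    using CARD_power_le_iff by (metis le_antisym order_refl)
qed

lemma cim_projW:
  assumes "\<eta> \<in> DW" "\<eta>' \<in> cim X"
  shows "\<eta>' \<circ> projW t \<eta> \<in> cim (X \<circ> projW t \<eta>)"
  using assms linmaps_comp[OF _ projW_linear[OF assms(1)], of \<eta>'] by (auto simp: cim_def)

section \<open>Restrictions and globalness\<close>

text \<open>All X with the same \<pi> X \<rho> become the same character after the substitution, and
  the translation T leaves a phase; \<open>F_res\<close> is the resulting identity of
  functions.\<close>

definition res ::
    "('v \<Rightarrow> 'v) \<Rightarrow> ('w \<Rightarrow> 'w) \<Rightarrow> ('v \<Rightarrow> 'w) \<Rightarrow> (('w \<Rightarrow> 'v) \<Rightarrow> complex) \<Rightarrow> ('w \<Rightarrow> 'v) \<Rightarrow> complex" where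
  "res \<pi> \<rho> T x X' = (\<Sum>X\<in>{X\<in>H. \<pi> \<circ> X \<circ> \<rho> = X'}. x X * chi X T)"

lemma F_res:
  assumes "\<pi> \<in> EV" "\<rho> \<in> EW" "T \<in> G" "A \<in> G"
  shows "F (res \<pi> \<rho> T x) A = F x ((\<rho> \<circ> A \<circ> \<pi>) + T)"
proof -
  have "F (res \<pi> \<rho> T x) A = (\<Sum>X'\<in>H. \<Sum>X\<in>{X\<in>H. \<pi> \<circ> X \<circ> \<rho> = X'}. x X * chi X T * chi (\<pi> \<circ> X \<circ> \<rho>) A)"
    unfolding F_def res_def sum_distrib_right by (intro sum.cong refl) auto
  also have "\<dots> = (\<Sum>X\<in>H. x X * chi X T * chi (\<pi> \<circ> X \<circ> \<rho>) A)"
    by (rule sum.group) (use assms in \<open>auto intro!: linmaps_comp\<close>)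
  also have "\<dots> = F x ((\<rho> \<circ> A \<circ> \<pi>) + T)"
    unfolding F_def using assms by (intro sum.cong refl) (simp add: chi_add_right chi_comp)
  finally show ?thesis .
qed

lemma res_res:
  assumes "\<pi> \<in> EV" "\<rho> \<in> EW" "T \<in> G" "\<pi>' \<in> EV" "\<rho>' \<in> EW" "T' \<in> G"
  shows "res \<pi> \<rho> T (res \<pi>' \<rho>' T' x) Y = res (\<pi> \<circ> \<pi>') (\<rho>' \<circ> \<rho>) ((\<rho>' \<circ> T \<circ> \<pi>') + T') x Y"
proof -
  have "res \<pi> \<rho> T (res \<pi>' \<rho>' T' x) Y =
     (\<Sum>X'\<in>{X\<in>H. \<pi> \<circ> X \<circ> \<rho> = Y}. \<Sum>X\<in>{X\<in>{X\<in>H. \<pi> \<circ> (\<pi>' \<circ> X \<circ> \<rho>') \<circ> \<rho> = Y}. \<pi>' \<circ> X \<circ> \<rho>' = X'}.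
        x X * chi X T' * chi (\<pi>' \<circ> X \<circ> \<rho>') T)"
    unfolding res_def sum_distrib_right by (intro sum.cong refl) auto
  also have "\<dots> = (\<Sum>X\<in>{X\<in>H. \<pi> \<circ> (\<pi>' \<circ> X \<circ> \<rho>') \<circ> \<rho> = Y}. x X * chi X T' * chi (\<pi>' \<circ> X \<circ> \<rho>') T)"
    by (rule sum.group) (use assms in \<open>auto intro!: linmaps_comp\<close>)
  also have "\<dots> = res (\<pi> \<circ> \<pi>') (\<rho>' \<circ> \<rho>) ((\<rho>' \<circ> T \<circ> \<pi>') + T') x Y"
    unfolding res_def using assms
    by (intro sum.cong) (auto simp: chi_add_right chi_comp[unfolded comp_assoc] comp_assoc)
  finally show ?thesis .
qed

text \<open>Restrictions are parametrised by endomorphisms: ker \<pi> plays V' and range \<rho>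
  plays W', so the product of the kernel sizes is q to the power dim V' + codim W'. All sizes up to
  s are allowed, in contrast to \<open>global\<close>, and e bounds the norm instead of its square;
  this provides monotonicity and the triangle inequality.\<close>

definition glob :: "nat \<Rightarrow> real \<Rightarrow> (('w \<Rightarrow> 'v) \<Rightarrow> complex) \<Rightarrow> bool" where
  "glob s e x \<longleftrightarrow> (\<forall>\<pi>\<in>EV. \<forall>\<rho>\<in>EW. \<forall>T\<in>G. card {v. \<pi> v = 0} * card {w. \<rho> w = 0} \<le> CARD('k) ^ s \<longrightarrow>
     L2_set (\<lambda>X. cmod (res \<pi> \<rho> T x X)) H \<le> e)"

lemma globI:
  assumes "\<And>\<pi> \<rho> T. \<pi> \<in> EV \<Longrightarrow> \<rho> \<in> EW \<Longrightarrow> T \<in> G \<Longrightarrow>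
    card {v. \<pi> v = 0} * card {w. \<rho> w = 0} \<le> CARD('k) ^ s \<Longrightarrow>
    L2_set (\<lambda>X. cmod (res \<pi> \<rho> T x X)) H \<le> e"
  shows "glob s e x"
  using assms unfolding glob_def by blast

lemma globD:
  assumes "glob s e x" "\<pi> \<in> EV" "\<rho> \<in> EW" "T \<in> G"
    "card {v. \<pi> v = 0} * card {w. \<rho> w = 0} \<le> CARD('k) ^ s"
  shows "L2_set (\<lambda>X. cmod (res \<pi> \<rho> T x X)) H \<le> e"
  using assms unfolding glob_def by blast

lemma glob_cong:
  assumes "\<And>X. X \<in> H \<Longrightarrow> x X = y X"
  shows "glob s e x \<longleftrightarrow> glob s e y"
proof -
  have "res \<pi> \<rho> T x = res \<pi> \<rho> T y" for \<pi> \<rho> T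
    unfolding res_def using assms by (intro ext sum.cong) auto
  thus ?thesis by (simp add: glob_def)
qed

lemma glob_L2_set:
  assumes "glob s e x"
  shows "L2_set (\<lambda>X. cmod (x X)) H \<le> e"
proof -
  have [simp]: "{v. id v = (0::'v)} = {0}" "{v. id v = (0::'w)} = {0}"
    by auto
  have "L2_set (\<lambda>X. cmod (res id id 0 x X)) H \<le> e"
    by (rule globD[OF assms]) (auto simp: linear_closed)
  moreover have "res id id 0 x X = x X" if "X \<in> H" for X
  proof -
    have "chi X 0 = chi X 0 * chi X 0"
      using chi_add_right[OF that, of 0 0] by simp
    hence "chi X 0 = 1"
      using norm_chi[of X 0] norm_zero zero_neq_one by (metis mult_cancel_left1)
    moreover have "{Y\<in>H. id \<circ> Y \<circ> id = X} = {X}"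
      using that by auto
    ultimately show ?thesis
      by (simp add: res_def)
  qed
  ultimately show ?thesis
    by (simp cong: L2_set_cong)
qed

lemma glob_nonneg: "glob s e x \<Longrightarrow> e \<ge> 0"
  using glob_L2_set L2_set_nonneg order_trans by blast

lemma L2_set_power2: "(L2_set f A)\<^sup>2 = (\<Sum>i\<in>A. (f i)\<^sup>2)"
  unfolding L2_set_def by (simp add: sum_nonneg)

lemma glob_nsq: "glob s e x \<Longrightarrow> nsq x \<le> e\<^sup>2"
  using power_mono[OF glob_L2_set L2_set_nonneg, of s e x 2]
  by (simp add: nsq_def L2_set_power2)

lemma glob_mono: "glob s e x \<Longrightarrow> s' \<le> s \<Longrightarrow> e \<le> e' \<Longrightarrow> glob s' e' x"
  unfolding glob_def using CARD_power_le_iff by (meson order_trans)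

lemma glob_add:
  assumes "glob s e x" "glob s e' y"
  shows "glob s (e + e') (\<lambda>X. x X + y X)"
proof (rule globI)
  fix \<pi> \<rho> T
  assume a: "\<pi> \<in> EV" "\<rho> \<in> EW" "T \<in> G" "card {v. \<pi> v = 0} * card {w. \<rho> w = 0} \<le> CARD('k) ^ s"
  have "res \<pi> \<rho> T (\<lambda>X. x X + y X) X' = res \<pi> \<rho> T x X' + res \<pi> \<rho> T y X'" for X'
    by (simp add: res_def sum.distrib algebra_simps)
  hence "L2_set (\<lambda>X. cmod (res \<pi> \<rho> T (\<lambda>X. x X + y X) X)) H
      \<le> L2_set (\<lambda>X. cmod (res \<pi> \<rho> T x X) + cmod (res \<pi> \<rho> T y X)) H"
    by (intro L2_set_mono) (auto intro: norm_triangle_ineq)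
  also have "\<dots> \<le> L2_set (\<lambda>X. cmod (res \<pi> \<rho> T x X)) H + L2_set (\<lambda>X. cmod (res \<pi> \<rho> T y X)) H"
    by (rule L2_set_triangle_ineq)
  also have "\<dots> \<le> e + e'"
    by (intro add_mono globD[OF assms(1) a] globD[OF assms(2) a])
  finally show "L2_set (\<lambda>X. cmod (res \<pi> \<rho> T (\<lambda>X. x X + y X) X)) H \<le> e + e'" .
qed

lemma glob_scale:
  assumes "glob s e x"
  shows "glob s (cmod c * e) (\<lambda>X. c * x X)"
proof (rule globI)
  fix \<pi> \<rho> T
  assume a: "\<pi> \<in> EV" "\<rho> \<in> EW" "T \<in> G" "card {v. \<pi> v = 0} * card {w. \<rho> w = 0} \<le> CARD('k) ^ s"
  have "res \<pi> \<rho> T (\<lambda>X. c * x X) X' = c * res \<pi> \<rho> T x X'" for X'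
    by (simp add: res_def sum_distrib_left mult.assoc)
  hence "L2_set (\<lambda>X. cmod (res \<pi> \<rho> T (\<lambda>X. c * x X) X)) H = cmod c * L2_set (\<lambda>X. cmod (res \<pi> \<rho> T x X)) H"
    by (simp add: norm_mult L2_set_right_distrib)
  thus "L2_set (\<lambda>X. cmod (res \<pi> \<rho> T (\<lambda>X. c * x X) X)) H \<le> cmod c * e"
    using globD[OF assms a] by (simp add: mult_left_mono)
qed

lemma glob_shift:
  assumes "glob s e x" "B \<in> G"
  shows "glob s e (\<lambda>X. chi X B * x X)"
proof (rule globI)
  fix \<pi> \<rho> T
  assume a: "\<pi> \<in> EV" "\<rho> \<in> EW" "T \<in> G" "card {v. \<pi> v = 0} * card {w. \<rho> w = 0} \<le> CARD('k) ^ s"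
  have "res \<pi> \<rho> T (\<lambda>X. chi X B * x X) = res \<pi> \<rho> (B + T) x"
    unfolding res_def by (intro ext sum.cong refl) (auto simp: chi_add_right mult_ac)
  thus "L2_set (\<lambda>X. cmod (res \<pi> \<rho> T (\<lambda>X. chi X B * x X) X)) H \<le> e"
    using globD[OF assms(1) a(1,2) _ a(4), of "B + T"] assms(2) a(3) by (simp add: linear_closed)
qed

lemma glob_zero: "0 \<le> e \<Longrightarrow> glob s e (\<lambda>X. 0)"
  by (rule globI) (simp add: res_def L2_set_def)

lemma glob_sum:
  assumes "finite I" "\<And>i. i \<in> I \<Longrightarrow> glob s (e i) (x i)"
  shows "glob s (\<Sum>i\<in>I. e i) (\<lambda>X. \<Sum>i\<in>I. x i X)"
  using assms by (induction I) (auto simp: glob_zero intro!: glob_add)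

text \<open>Multiplying coefficients by a character is a translation, which globalness does not
  notice; hence a combination of characters costs at most its total mass. Agreement on the support
  of x is enough, so a fixed rank on that support may enter the representation of m.\<close>

lemma glob_multiplier:
  assumes x: "glob s e x" and "finite I" and B: "\<And>i. i \<in> I \<Longrightarrow> B i \<in> G"
    and m: "\<And>X. X \<in> H \<Longrightarrow> x X \<noteq> 0 \<Longrightarrow> m X = (\<Sum>i\<in>I. c i * chi X (B i))"
    and c: "(\<Sum>i\<in>I. cmod (c i)) \<le> C"
  shows "glob s (C * e) (\<lambda>X. m X * x X)"
proof -
  have "glob s (\<Sum>i\<in>I. cmod (c i) * e) (\<lambda>X. \<Sum>i\<in>I. c i * (chi X (B i) * x X))"
    by (intro glob_sum glob_scale glob_shift x B assms)
  moreover have "(\<Sum>i\<in>I. c i * (chi X (B i) * x X)) = m X * x X" if "X \<in> H" for X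
    using m[OF that] by (cases "x X = 0") (auto simp: sum_distrib_right mult.assoc)
  ultimately have "glob s (\<Sum>i\<in>I. cmod (c i) * e) (\<lambda>X. m X * x X)"
    by (simp cong: glob_cong)
  moreover have "(\<Sum>i\<in>I. cmod (c i) * e) \<le> C * e"
    unfolding sum_distrib_right[symmetric] by (rule mult_right_mono[OF c glob_nonneg[OF x]])
  ultimately show ?thesis
    using glob_mono by blast
qed

lemma card_kernel_comp_le:
  fixes f :: "'a::ab_group_add \<Rightarrow> 'b::ab_group_add" and g :: "'b \<Rightarrow> 'c::ab_group_add"
  assumes fin: "finite (UNIV::'a set)" "finite (UNIV::'b set)"
    and f: "\<And>u v. f (u + v) = f u + f v" and g: "\<And>u v. g (u + v) = g u + g v"
  shows "card {u. (g \<circ> f) u = 0} \<le> card {v. g v = 0} * card {u. f u = 0}"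
proof -
  have fd: "f (u - v) = f u - f v" for u v
    using f[of "u - v" v] by simp
  have gd: "g (u - v) = g u - g v" for u v
    using g[of "u - v" v] by simp
  have finA: "finite S" for S :: "'a set"
    by (rule finite_subset[OF subset_UNIV fin(1)])
  have finB: "finite S" for S :: "'b set"
    by (rule finite_subset[OF subset_UNIV fin(2)])
  have "card {u. (g \<circ> f) u = 0} = card (f ` {u. (g \<circ> f) u = 0}) * card {u\<in>{u. (g \<circ> f) u = 0}. f u = 0}"
    by (rule card_image_times_card_kernel) (auto simp: fd gd f finA)
  also have "\<dots> \<le> card {v. g v = 0} * card {u. f u = 0}"
    by (intro mult_mono card_mono finA finB) auto
  finally show ?thesis .
qed

text \<open>Kernel sizes at most multiply under composition, so a restriction of size q uses up one
  unit of globalness and leaves e unchanged.\<close>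

lemma glob_res:
  assumes x: "glob (Suc s) e x" and 1: "\<pi>' \<in> EV" "\<rho>' \<in> EW" "T' \<in> G"
    and c: "card {v. \<pi>' v = 0} * card {w. \<rho>' w = 0} \<le> CARD('k)"
  shows "glob s e (res \<pi>' \<rho>' T' x)"
proof (rule globI)
  fix \<pi> \<rho> T
  assume a: "\<pi> \<in> EV" "\<rho> \<in> EW" "T \<in> G" "card {v. \<pi> v = 0} * card {w. \<rho> w = 0} \<le> CARD('k) ^ s"
  have "card {v. (\<pi> \<circ> \<pi>') v = 0} \<le> card {v. \<pi> v = 0} * card {v. \<pi>' v = 0}"
    by (rule card_kernel_comp_le) (use a 1 in \<open>auto simp: linmaps_add\<close>)
  moreover have "card {v. (\<rho>' \<circ> \<rho>) v = 0} \<le> card {v. \<rho>' v = 0} * card {v. \<rho> v = 0}"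
    by (rule card_kernel_comp_le) (use a 1 in \<open>auto simp: linmaps_add\<close>)
  ultimately have "card {v. (\<pi> \<circ> \<pi>') v = 0} * card {v. (\<rho>' \<circ> \<rho>) v = 0} \<le>
      (card {v. \<pi> v = 0} * card {v. \<pi>' v = 0}) * (card {v. \<rho>' v = 0} * card {v. \<rho> v = 0})"
    by (intro mult_mono) auto
  also have "\<dots> = (card {v. \<pi> v = 0} * card {w. \<rho> w = 0}) * (card {v. \<pi>' v = 0} * card {w. \<rho>' w = 0})"
    by (simp add: mult_ac)
  also have "\<dots> \<le> CARD('k) ^ s * CARD('k)"
    by (intro mult_mono a c) auto
  finally have le: "card {v. (\<pi> \<circ> \<pi>') v = 0} * card {v. (\<rho>' \<circ> \<rho>) v = 0} \<le> CARD('k) ^ Suc s"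
    by (simp add: mult.commute)
  show "L2_set (\<lambda>X. cmod (res \<pi> \<rho> T (res \<pi>' \<rho>' T' x) X)) H \<le> e"
    unfolding res_res[OF a(1-3) 1]
    by (rule globD[OF x linmaps_comp[OF a(1) 1(1)] linmaps_comp[OF 1(2) a(2)]
          linear_closed(1)[OF linmaps_comp[OF linmaps_comp[OF 1(2) a(3)] 1(1)] 1(3)] le])
qed

lemma res_nonzero:
  assumes "res \<pi> \<rho> T x X' \<noteq> 0"
  obtains X where "X \<in> H" "\<pi> \<circ> X \<circ> \<rho> = X'" "x X \<noteq> 0"
proof -
  have "\<exists>X\<in>{X\<in>H. \<pi> \<circ> X \<circ> \<rho> = X'}. x X * chi X T \<noteq> 0"
    using assms unfolding res_def by (meson sum.neutral)
  thus ?thesis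
    using that by auto
qed

end

section \<open>Derivatives\<close>

context bilinear_scheme
begin

text \<open>Both conditions are written as character sums: the sum over c detects \<xi> v = 1, the
  sum over u detects vanishing on U. In the other order of summation only c = 0 and u = 0 survive,
  since v \<notin> U.\<close>

lemma card_functionals_one:
  assumes U: "V.subspace U" and v: "v \<notin> U"
  shows "q * real (card U) * real (card {\<xi>\<in>DV. \<xi> v = 1 \<and> (\<forall>u\<in>U. \<xi> u = 0)}) = real (card DV)"
proof -
  let ?S = "\<Sum>\<xi>\<in>DV. \<Sum>c\<in>UNIV. \<Sum>u\<in>U. \<phi> (- c) * \<phi> (\<xi> (sV c v + u))"
  have "?S = (\<Sum>\<xi>\<in>DV. if \<xi> v = 1 \<and> (\<forall>u\<in>U. \<xi> u = 0) then of_real q * of_nat (card U) else 0)"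
  proof (rule sum.cong[OF refl])
    fix \<xi> assume \<xi>: "\<xi> \<in> DV"
    have "(\<Sum>c\<in>UNIV. \<Sum>u\<in>U. \<phi> (- c) * \<phi> (\<xi> (sV c v + u))) =
        (\<Sum>c\<in>UNIV. \<Sum>u\<in>U. \<phi> (c * (\<xi> v - 1)) * \<phi> (\<xi> u))"
      using \<xi> by (intro sum.cong refl) (simp add: linmaps_add linmaps_scale algebra_simps flip: phi_add)
    also have "\<dots> = (\<Sum>c\<in>UNIV. \<phi> (c * (\<xi> v - 1))) * (\<Sum>u\<in>U. \<phi> (\<xi> u))"
      by (simp add: sum_product)
    also have "\<dots> = (if \<xi> v = 1 \<and> (\<forall>u\<in>U. \<xi> u = 0) then of_real q * of_nat (card U) else 0)"
      unfolding sum_phi_mult sum_annihilator[OF V.vector_space_axioms U \<xi>] by simp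
    finally show "(\<Sum>c\<in>UNIV. \<Sum>u\<in>U. \<phi> (- c) * \<phi> (\<xi> (sV c v + u))) = \<dots>" .
  qed
  also have "\<dots> = of_real (q * real (card U) * real (card {\<xi>\<in>DV. \<xi> v = 1 \<and> (\<forall>u\<in>U. \<xi> u = 0)}))"
    by (simp add: sum.If_cases Int_def)
  finally have 1: "?S = \<dots>" .
  have "?S = (\<Sum>c\<in>UNIV. \<Sum>u\<in>U. \<phi> (- c) * (\<Sum>\<xi>\<in>DV. \<phi> (\<xi> (sV c v + u))))"
    by (subst sum.swap, intro sum.cong refl, subst sum.swap) (simp add: sum_distrib_left)
  also have "\<dots> = (\<Sum>c\<in>(UNIV::'k set). \<Sum>u\<in>U. if c = 0 \<and> u = 0 then of_nat (card DV) else 0)"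
  proof (intro sum.cong refl)
    fix c u assume u: "u \<in> U"
    have "sV c v + u \<noteq> 0" if "c \<noteq> 0"
    proof
      assume "sV c v + u = 0"
      hence "sV c v = - u"
        by (simp add: eq_neg_iff_add_eq_0)
      hence "sV (inverse c) (sV c v) = sV (inverse c) (- u)"
        by (rule arg_cong)
      hence "v = sV (inverse c) (- u)"
        using that by simp
      thus False
        using v u U by (metis V.subspace_neg V.subspace_scale)
    qed
    thus "\<phi> (- c) * (\<Sum>\<xi>\<in>DV. \<phi> (\<xi> (sV c v + u))) = (if c = 0 \<and> u = 0 then of_nat (card DV) else 0)"
      by (cases "c = 0") (auto simp: sum_DV phi_0)
  qed
  also have "\<dots> = (\<Sum>c\<in>(UNIV::'k set). if c = 0 then of_nat (card DV) else 0)"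
    using V.subspace_0[OF U] by (intro sum.cong refl) (auto simp: sum.delta)
  also have "\<dots> = of_real (real (card DV))"
    by simp
  finally show ?thesis
    unfolding 1 by (simp only: of_real_eq_iff)
qed

lemma subspace_kernel: "X \<in> H \<Longrightarrow> W.subspace {w. X w = 0}"
  by (auto intro!: W.subspaceI simp: linmaps_zero linmaps_add linmaps_scale)

text \<open>Since \<eta> \<notin> \<open>cim X\<close>, it is a nonzero functional on the kernel of
  X, and such a functional takes each value equally often.\<close>

lemma card_kernel_one:
  assumes X: "X \<in> H" and \<eta>: "\<eta> \<in> DW" "\<eta> \<notin> cim X"
  shows "q * real (card {t. X t = 0 \<and> \<eta> t = 1}) = real (card {t. X t = 0})"
proof -
  let ?K = "{t. X t = 0}"
  let ?S = "\<Sum>t\<in>?K. \<Sum>c\<in>UNIV. \<phi> (c * (\<eta> t - 1))"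
  have "?S = (\<Sum>t\<in>?K. if \<eta> t = 1 then of_real q else 0)"
    by (simp add: sum_phi_mult)
  also have "\<dots> = of_real (q * real (card {t. X t = 0 \<and> \<eta> t = 1}))"
    by (simp add: sum.If_cases Int_def)
  finally have 1: "?S = \<dots>" .
  have "?S = (\<Sum>c\<in>UNIV. \<phi> (- c) * (\<Sum>t\<in>?K. \<phi> (c * \<eta> t)))"
    by (subst sum.swap) (simp add: sum_distrib_left algebra_simps flip: phi_add)
  also have "\<dots> = (\<Sum>c\<in>UNIV. \<phi> (- c) * (if c = 0 then of_nat (card ?K) else 0))"
  proof (intro sum.cong refl arg_cong2[where f = "(*)"])
    fix c :: 'k
    have "(\<lambda>t. c * \<eta> t) \<in> DW"
      using \<eta>(1) unfolding lin_iff by (auto simp: algebra_simps)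
    moreover obtain t where "X t = 0" "\<eta> t \<noteq> 0"
      using \<eta> by (auto simp: cim_def)
    ultimately show "(\<Sum>t\<in>?K. \<phi> (c * \<eta> t)) = (if c = 0 then of_nat (card ?K) else 0)"
      using sum_annihilator[OF W.vector_space_axioms subspace_kernel[OF X], of "\<lambda>t. c * \<eta> t"] by auto
  qed
  also have "\<dots> = of_real (real (card ?K))"
    by (simp add: phi_0 if_distrib[of "(*) _"] cong: if_cong)
  finally show ?thesis
    unfolding 1 by (simp only: of_real_eq_iff)
qed

lemma card_W_pos: "card (UNIV::'w set) > 0"
  by (simp add: card_gt_0_iff)

lemma mask_bound: "1 + q ^ (a + 1) \<le> q ^ (a + 2)"
proof -
  have "1 + q ^ (a + 1) \<le> q ^ (a + 1) + q ^ (a + 1)"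
    using q_ge_1 by (intro add_right_mono one_le_power)
  also have "\<dots> = 2 * q ^ (a + 1)"
    by simp
  also have "\<dots> \<le> q * q ^ (a + 1)"
    using q_ge_2 by (intro mult_right_mono) auto
  finally show ?thesis by simp
qed

text \<open>The indicator that is directly an average of translations is that of the complement;
  passing back adds the mass 1 of the identity, and 1 + q^(a+1) \<le> q^(a+2).\<close>

lemma glob_mask_complement:
  assumes "glob s e x" "glob s (q ^ (a + 1) * e) (\<lambda>X. (if P X then 0 else 1) * x X)"
  shows "glob s (q ^ (a + 2) * e) (\<lambda>X. if P X then x X else 0)"
proof -
  have "glob s (e + cmod (- 1) * (q ^ (a + 1) * e))
      (\<lambda>X. x X + (- 1) * ((if P X then 0 else 1) * x X))"
    by (intro glob_add glob_scale assms)
  also have "(\<lambda>X. x X + (- 1) * ((if P X then 0 else 1) * x X)) = (\<lambda>X. if P X then x X else 0)"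
    by auto
  finally show ?thesis
    using mult_right_mono[OF mask_bound glob_nonneg[OF assms(1)], of a]
    by (elim glob_mono[OF _ order_refl]) (simp add: algebra_simps)
qed

text \<open>On maps of rank \<open>a\<close> the indicator of \<open>v \<notin> range X\<close> is the Fourier transform of a measure of
  total mass at most \<open>q\<^sup>a\<^sup>+\<^sup>1\<close>: averaging over the translations by \<open>outer sW t \<xi>\<close> projects onto the
  maps \<open>X\<close> with \<open>\<xi> \<circ> X = 0\<close>, and a functional with \<open>\<xi> v = 1\<close> that kills \<open>range X\<close> exists iff
  \<open>v \<notin> range X\<close>.\<close>

lemma glob_mask_range:
  assumes x: "glob s e x" and rk: "\<And>X. X \<in> H \<Longrightarrow> x X \<noteq> 0 \<Longrightarrow> rk X = a"
  shows "glob s (q ^ (a + 2) * e) (\<lambda>X. if v \<in> range X then x X else 0)"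
proof (rule glob_mask_complement[OF x])
  define w where "w = real (card (UNIV::'w set))"
  define n where "n = real (card DV)"
  have pos: "w > 0" "n > 0"
    using card_W_pos card_DV_pos by (simp_all add: w_def n_def)
  \<comment> \<open>For v outside the range, n / q^(a+1) functionals qualify and each contributes w
    translations; c normalises the total to 1.\<close>
  define c where "c = q ^ (a + 1) / (n * w)"
  show "glob s (q ^ (a + 1) * e) (\<lambda>X. (if v \<in> range X then 0 else 1) * x X)"
  proof (rule glob_multiplier[OF x, where I = "{\<xi>\<in>DV. \<xi> v = 1} \<times> UNIV" and c = "\<lambda>_. of_real c"
        and B = "\<lambda>(\<xi>, t). outer sW t \<xi>"])
    fix X assume X: "X \<in> H" "x X \<noteq> 0"
    have "(\<Sum>i\<in>{\<xi>\<in>DV. \<xi> v = 1} \<times> UNIV. of_real c * chi X (case i of (\<xi>, t) \<Rightarrow> outer sW t \<xi>)) =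
      (\<Sum>\<xi>\<in>{\<xi>\<in>DV. \<xi> v = 1}. of_real c * (\<Sum>t\<in>UNIV. \<phi> ((\<xi> \<circ> X) t)))"
      unfolding sum_distrib_left sum.cartesian_product
      by (rule sum.cong) (auto simp: chi_outer X)
    also have "\<dots> = (\<Sum>\<xi>\<in>{\<xi>\<in>DV. \<xi> v = 1}. if \<forall>u\<in>range X. \<xi> u = 0 then of_real (c * w) else 0)"
    proof (rule sum.cong[OF refl])
      fix \<xi> assume "\<xi> \<in> {\<xi>\<in>DV. \<xi> v = 1}"
      hence "\<xi> \<circ> X \<in> DW"
        using X(1) by (auto intro: linmaps_comp)
      from sum_annihilator[OF W.vector_space_axioms W.subspace_UNIV this]
      show "of_real c * (\<Sum>t\<in>UNIV. \<phi> ((\<xi> \<circ> X) t)) = (if \<forall>u\<in>range X. \<xi> u = 0 then of_real (c * w) else 0)"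
        by (auto simp: w_def)
    qed
    also have "\<dots> = of_real (c * w * real (card {\<xi>\<in>DV. \<xi> v = 1 \<and> (\<forall>u\<in>range X. \<xi> u = 0)}))"
      by (simp add: sum.If_cases Int_def conj_assoc)
    also have "\<dots> = (if v \<in> range X then 0 else 1)"
    proof (cases "v \<in> range X")
      case True
      hence "\<And>\<xi>. \<forall>u\<in>range X. \<xi> u = 0 \<Longrightarrow> \<xi> v = 0"
        by blast
      hence "{\<xi>\<in>DV. \<xi> v = 1 \<and> (\<forall>u\<in>range X. \<xi> u = 0)} = {}"
        using zero_neq_one by (metis (mono_tags, lifting) Collect_empty_eq)
      thus ?thesis
        using True by (metis card.empty mult_zero_right of_nat_0 of_real_0)
    next
      case False
      define N where "N = real (card {\<xi>\<in>DV. \<xi> v = 1 \<and> (\<forall>u\<in>range X. \<xi> u = 0)})"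
      have "n = q * q ^ a * N"
        using card_functionals_one[OF subspace_range[OF X(1)] False] rk[OF X]
        by (simp only: real_card_range[OF X(1)] n_def N_def)
      hence "c * w * N = 1"
        using pos by (auto simp: c_def divide_simps mult_ac)
      thus ?thesis
        using False unfolding N_def by (metis of_real_1)
    qed
    finally show "(if v \<in> range X then 0 else 1) =
      (\<Sum>i\<in>{\<xi>\<in>DV. \<xi> v = 1} \<times> UNIV. of_real c * chi X (case i of (\<xi>, t) \<Rightarrow> outer sW t \<xi>))"
      by simp
  next
    have c0: "c \<ge> 0"
      using pos q_gt_0 by (simp add: c_def)
    have "real (card {\<xi>\<in>DV. \<xi> v = 1}) \<le> n"
      unfolding n_def by (intro of_nat_mono card_mono) auto
    hence "real (card {\<xi>\<in>DV. \<xi> v = 1}) * w * c \<le> n * w * c"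
      using pos c0 by (intro mult_right_mono) auto
    also have "\<dots> = q ^ (a + 1)"
      using pos by (simp add: c_def)
    finally show "(\<Sum>i\<in>{\<xi>\<in>DV. \<xi> v = 1} \<times> (UNIV::'w set). cmod (of_real c)) \<le> q ^ (a + 1)"
      using c0 by (simp add: card_cartesian_product w_def)
  qed (auto simp: linear_closed)
qed

text \<open>Dual averaging: the sum over \<xi> keeps the vectors t with X t = 0 and \<eta> t = 1,
  which exist iff \<eta> \<notin> \<open>cim X\<close>. By \<open>card_kernel_one\<close> there are
  then w / q^(a+1) of them.\<close>

lemma glob_mask_cim:
  assumes x: "glob s e x" and rk: "\<And>X. X \<in> H \<Longrightarrow> x X \<noteq> 0 \<Longrightarrow> rk X = a" and \<eta>: "\<eta> \<in> DW"
  shows "glob s (q ^ (a + 2) * e) (\<lambda>X. if \<eta> \<in> cim X then x X else 0)"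
proof (rule glob_mask_complement[OF x])
  define w where "w = real (card (UNIV::'w set))"
  define n where "n = real (card DV)"
  have pos: "w > 0" "n > 0"
    using card_W_pos card_DV_pos by (simp_all add: w_def n_def)
  define c where "c = q ^ (a + 1) / (n * w)"
  show "glob s (q ^ (a + 1) * e) (\<lambda>X. (if \<eta> \<in> cim X then 0 else 1) * x X)"
  proof (rule glob_multiplier[OF x, where I = "{t. \<eta> t = 1} \<times> DV" and c = "\<lambda>_. of_real c"
        and B = "\<lambda>(t, \<xi>). outer sW t \<xi>"])
    fix X assume X: "X \<in> H" "x X \<noteq> 0"
    have "(\<Sum>i\<in>{t. \<eta> t = 1} \<times> DV. of_real c * chi X (case i of (t, \<xi>) \<Rightarrow> outer sW t \<xi>)) =
      (\<Sum>t\<in>{t. \<eta> t = 1}. of_real c * (\<Sum>\<xi>\<in>DV. \<phi> (\<xi> (X t))))"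
      unfolding sum_distrib_left sum.cartesian_product
      by (rule sum.cong) (auto simp: chi_outer X)
    also have "\<dots> = (\<Sum>t\<in>{t. \<eta> t = 1}. if X t = 0 then of_real (c * n) else 0)"
      by (rule sum.cong) (simp_all add: sum_DV n_def)
    also have "\<dots> = of_real (c * n * real (card {t. X t = 0 \<and> \<eta> t = 1}))"
      by (simp add: sum.If_cases Int_def conj_commute)
    also have "\<dots> = (if \<eta> \<in> cim X then 0 else 1)"
    proof (cases "\<eta> \<in> cim X")
      case True
      hence "{t. X t = 0 \<and> \<eta> t = 1} = {}"
        by (auto simp: cim_def)
      thus ?thesis
        using True by (metis card.empty mult_zero_right of_nat_0 of_real_0)
    next
      case False
      define N where "N = real (card {t. X t = 0 \<and> \<eta> t = 1})"
      have "w = q ^ a * (q * N)"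
        unfolding N_def card_kernel_one[OF X(1) \<eta> False] w_def card_W_eq[OF X(1)]
        using rk[OF X] real_card_range[OF X(1)] by simp
      hence "c * n * N = 1"
        using pos by (auto simp: c_def divide_simps mult_ac)
      thus ?thesis
        using False unfolding N_def by (metis of_real_1)
    qed
    finally show "(if \<eta> \<in> cim X then 0 else 1) =
      (\<Sum>i\<in>{t. \<eta> t = 1} \<times> DV. of_real c * chi X (case i of (t, \<xi>) \<Rightarrow> outer sW t \<xi>))"
      by simp
  next
    have c0: "c \<ge> 0"
      using pos q_gt_0 by (simp add: c_def)
    have "real (card {t. \<eta> t = 1}) \<le> w"
      unfolding w_def by (intro of_nat_mono card_mono) auto
    hence "real (card {t. \<eta> t = 1}) * n * c \<le> w * n * c"
      using pos c0 by (intro mult_right_mono) auto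
    also have "\<dots> = q ^ (a + 1)"
      using pos by (simp add: c_def)
    finally show "(\<Sum>i\<in>{t. \<eta> t = 1} \<times> DV. cmod (of_real c)) \<le> q ^ (a + 1)"
      using c0 by (simp add: card_cartesian_product n_def)
  qed (auto simp: linear_closed)
qed

text \<open>The restricted maps, over all i and with multiplicity, cover G uniformly. Testing
  against arbitrary real functions expresses this without a description of the fibres.\<close>

definition fibration :: "('v \<Rightarrow> 'v) \<Rightarrow> ('w \<Rightarrow> 'w) \<Rightarrow> 'i set \<Rightarrow> ('i \<Rightarrow> 'v \<Rightarrow> 'w) \<Rightarrow> bool" where
  "fibration \<pi> \<rho> I T \<longleftrightarrow> \<pi> \<in> EV \<and> \<rho> \<in> EW \<and> finite I \<and> I \<noteq> {} \<and> (\<forall>i\<in>I. T i \<in> G) \<and>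
     (\<forall>\<Phi>::_ \<Rightarrow> real. (\<Sum>i\<in>I. \<Sum>A\<in>G. \<Phi> ((\<rho> \<circ> A \<circ> \<pi>) + T i)) = real (card I) * (\<Sum>A\<in>G. \<Phi> A))"

lemma fibrationD:
  fixes \<Phi> :: "_ \<Rightarrow> real"
  assumes "fibration \<pi> \<rho> I T"
  shows "(\<Sum>i\<in>I. \<Sum>A\<in>G. \<Phi> ((\<rho> \<circ> A \<circ> \<pi>) + T i)) = real (card I) * (\<Sum>A\<in>G. \<Phi> A)"
  using assms unfolding fibration_def by simp

lemma fibration_nsq:
  assumes "fibration \<pi> \<rho> I T"
  shows "(\<Sum>i\<in>I. nsq (res \<pi> \<rho> (T i) y)) = real (card I) * nsq y"
proof -
  have "real (card G) * (\<Sum>i\<in>I. nsq (res \<pi> \<rho> (T i) y)) =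
      (\<Sum>i\<in>I. \<Sum>A\<in>G. (cmod (F y ((\<rho> \<circ> A \<circ> \<pi>) + T i)))\<^sup>2)"
    unfolding sum_distrib_left parseval[symmetric]
    using assms by (intro sum.cong refl) (simp add: F_res fibration_def)
  also have "\<dots> = real (card I) * (\<Sum>A\<in>G. (cmod (F y A))\<^sup>2)"
    by (rule fibrationD[OF assms])
  also have "\<dots> = real (card G) * (real (card I) * nsq y)"
    unfolding parseval by simp
  finally show ?thesis
    using card_G_pos by (auto simp: card_gt_0_iff)
qed

lemma fibration_conv:
  assumes "fibration \<pi> \<rho> I T"
  shows "(\<Sum>i\<in>I. nsq (conv (res \<pi> \<rho> (T i) x) (res \<pi> \<rho> (T i) y))) = real (card I) * nsq (conv x y)"
proof -
  have "real (card G) * (\<Sum>i\<in>I. nsq (conv (res \<pi> \<rho> (T i) x) (res \<pi> \<rho> (T i) y))) =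
      (\<Sum>i\<in>I. \<Sum>A\<in>G. (cmod (F x ((\<rho> \<circ> A \<circ> \<pi>) + T i) * F y ((\<rho> \<circ> A \<circ> \<pi>) + T i)))\<^sup>2)"
    unfolding sum_distrib_left parseval[symmetric]
    using assms by (intro sum.cong refl) (simp add: F_res F_conv fibration_def)
  also have "\<dots> = real (card I) * (\<Sum>A\<in>G. (cmod (F x A * F y A))\<^sup>2)"
    by (rule fibrationD[OF assms])
  also have "\<dots> = real (card I) * (\<Sum>A\<in>G. (cmod (F (conv x y) A))\<^sup>2)"
    by (simp add: F_conv cong: sum.cong_simp)
  also have "\<dots> = real (card G) * (real (card I) * nsq (conv x y))"
    unfolding parseval by simp
  finally show ?thesis
    using card_G_pos by (auto simp: card_gt_0_iff)
qed

text \<open>The index shift \<open>g A\<close> records what A loses when it is replaced by \<rho> A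
  \<pi>. Reindexing I by it, and then G by \<open>T i\<close>, turns the double sum into card I
  copies of the plain one.\<close>

lemma fibrationI:
  assumes "\<pi> \<in> EV" "\<rho> \<in> EW" "finite I" "I \<noteq> {}" "\<And>i. i \<in> I \<Longrightarrow> T i \<in> G"
    and eq: "\<And>A i. A \<in> G \<Longrightarrow> i \<in> I \<Longrightarrow> (\<rho> \<circ> A \<circ> \<pi>) + T i = A + T (i - g A)"
    and bij: "\<And>A i. A \<in> G \<Longrightarrow> i \<in> I \<Longrightarrow> i - g A \<in> I \<and> i + g A \<in> I"
  shows "fibration \<pi> \<rho> (I::'i::ab_group_add set) T"
proof -
  have "(\<Sum>i\<in>I. \<Sum>A\<in>G. \<Phi> ((\<rho> \<circ> A \<circ> \<pi>) + T i)) = real (card I) * (\<Sum>A\<in>G. \<Phi> A)" for \<Phi> :: "_ \<Rightarrow> real"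
  proof -
    have "(\<Sum>i\<in>I. \<Sum>A\<in>G. \<Phi> ((\<rho> \<circ> A \<circ> \<pi>) + T i)) = (\<Sum>A\<in>G. \<Sum>i\<in>I. \<Phi> (A + T (i - g A)))"
      by (subst sum.swap) (intro sum.cong refl, simp add: eq)
    also have "\<dots> = (\<Sum>A\<in>G. \<Sum>i\<in>I. \<Phi> (A + T i))"
    proof (rule sum.cong[OF refl])
      fix A assume "A \<in> G"
      with bij show "(\<Sum>i\<in>I. \<Phi> (A + T (i - g A))) = (\<Sum>i\<in>I. \<Phi> (A + T i))"
        by (intro sum.reindex_bij_witness[of _ "\<lambda>i. i + g A" "\<lambda>i. i - g A"]) auto
    qed
    also have "\<dots> = (\<Sum>i\<in>I. \<Sum>A\<in>G. \<Phi> (A + T i))"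
      by (rule sum.swap)
    also have "\<dots> = (\<Sum>i\<in>I. \<Sum>A\<in>G. \<Phi> A)"
    proof (rule sum.cong[OF refl])
      fix i assume "i \<in> I"
      hence "T i \<in> G"
        using assms by blast
      thus "(\<Sum>A\<in>G. \<Phi> (A + T i)) = (\<Sum>A\<in>G. \<Phi> A)"
        by (intro sum.reindex_bij_witness[of _ "\<lambda>A. A - T i" "\<lambda>A. A + T i"]) (auto simp: linear_closed)
    qed
    finally show ?thesis by simp
  qed
  with assms show ?thesis
    unfolding fibration_def by blast
qed

lemma fibration_projV:
  assumes "\<xi> \<in> DV"
  shows "fibration (projV v \<xi>) id (UNIV::'w set) (\<lambda>t. outer sW t \<xi>)"
proof (rule fibrationI[where g = "\<lambda>A. A v"])
  fix A t assume A: "A \<in> G"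
  show "(id \<circ> A \<circ> projV v \<xi>) + outer sW t \<xi> = A + outer sW (t - A v) \<xi>"
    using A by (auto simp: fun_eq_iff projV_apply outer_def linmaps_diff linmaps_scale scale_simps)
qed (use assms in \<open>auto simp: projV_linear linear_closed\<close>)

lemma fibration_projW:
  assumes "\<eta> \<in> DW"
  shows "fibration id (projW t \<eta>) DV (\<lambda>\<xi>. outer sW t \<xi>)"
proof (rule fibrationI[where g = "\<lambda>A. \<eta> \<circ> A"])
  fix A \<xi> assume A: "A \<in> G"
  show "(projW t \<eta> \<circ> A \<circ> id) + outer sW t \<xi> = A + outer sW t (\<xi> - (\<eta> \<circ> A))"
    by (auto simp: fun_eq_iff projW_apply outer_def scale_simps)
  assume "\<xi> \<in> DV"
  thus "\<xi> - (\<eta> \<circ> A) \<in> DV \<and> \<xi> + (\<eta> \<circ> A) \<in> DV"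
    using linmaps_comp[OF assms A] by (auto simp: linear_closed)
next
  show "DV \<noteq> {}"
    using linear_closed(9) by blast
qed (use assms in \<open>auto simp: projW_linear linear_closed\<close>)

section \<open>Lowering the rank along a list\<close>

lemma rk_comp_le:
  assumes "X \<in> H" "\<pi> \<in> EV" "\<rho> \<in> EW"
  shows "rk (\<pi> \<circ> X \<circ> \<rho>) \<le> rk X"
proof -
  have "range (\<pi> \<circ> X \<circ> \<rho>) \<subseteq> \<pi> ` range X"
    by auto
  hence "card (range (\<pi> \<circ> X \<circ> \<rho>)) \<le> card (range X)"
    by (rule surj_card_le[rotated]) simp
  moreover have "\<pi> \<circ> X \<circ> \<rho> \<in> H"
    using assms by (auto intro!: linmaps_comp)
  ultimately show ?thesis
    unfolding card_range[OF assms(1)] by (simp only: card_range CARD_power_le_iff)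
qed

text \<open>The claim of the induction on the rank a. Only the rank bound and the norm of y enter,
  so a restricted or masked y stays admissible.\<close>

definition product_bound :: "nat \<Rightarrow> real \<Rightarrow> nat \<Rightarrow> bool" where
  "product_bound D \<beta> a \<longleftrightarrow> (\<forall>x y e. glob a e x \<longrightarrow> (\<forall>X\<in>H. x X \<noteq> 0 \<longrightarrow> rk X = a) \<longrightarrow>
     (\<forall>Y\<in>H. y Y \<noteq> 0 \<longrightarrow> rk Y \<le> D) \<longrightarrow> nsq (conv x y) \<le> \<beta> * e\<^sup>2 * nsq y)"

text \<open>The constant C is the same on every fibre, which is what globalness of x provides; the
  norms of the restrictions of y vary but average to \<open>nsq y\<close>.\<close>

lemma fibration_product_bound:
  assumes fib: "fibration \<pi> \<rho> I T"
    and le: "\<And>i. i \<in> I \<Longrightarrow> nsq (conv (res \<pi> \<rho> (T i) x) (res \<pi> \<rho> (T i) y)) \<le> C * nsq (res \<pi> \<rho> (T i) y)"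
  shows "nsq (conv x y) \<le> C * nsq y"
proof -
  have "real (card I) * nsq (conv x y) \<le> (\<Sum>i\<in>I. C * nsq (res \<pi> \<rho> (T i) y))"
    unfolding fibration_conv[OF fib, symmetric] by (intro sum_mono le)
  also have "\<dots> = real (card I) * (C * nsq y)"
    by (simp add: fibration_nsq[OF fib] flip: sum_distrib_left)
  finally show ?thesis
    using fib by (auto simp: fibration_def card_gt_0_iff)
qed

lemma card_kernel_id: "card {v. id v = (0::'v)} = 1" "card {w. id w = (0::'w)} = 1"
  by simp_all

text \<open>Each v of the list lies in every image met by x. Projecting along v therefore lowers the
  rank on the support of x by exactly one, uses one unit of globalness and never raises the ranks
  for y. After the whole list the pure rank a remains, still with bound e.\<close>

lemma product_bound_range:
  assumes pb: "product_bound D \<beta> a"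
    and "VF.indep_list vs" "length vs = n" "glob (a + n) e x"
    and "\<And>X. X \<in> H \<Longrightarrow> x X \<noteq> 0 \<Longrightarrow> rk X = a + n \<and> set vs \<subseteq> range X"
    and "\<And>Y. Y \<in> H \<Longrightarrow> y Y \<noteq> 0 \<Longrightarrow> rk Y \<le> D"
  shows "nsq (conv x y) \<le> \<beta> * e\<^sup>2 * nsq y"
  using assms(2-)
proof (induction n arbitrary: vs x y)
  case 0
  thus ?case
    using pb unfolding product_bound_def by auto
next
  case (Suc n)
  then obtain v ws where vs: "vs = v # ws" "length ws = n"
    by (cases vs) auto
  have "v \<notin> V.span (set ws)"
    using Suc.prems(1) vs by simp
  hence "v \<noteq> 0"
    using V.span_zero by blast
  then obtain \<xi> where \<xi>: "\<xi> \<in> DV" "\<xi> v = 1"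
    using V.ex_linear_functional by blast
  show ?case
  proof (rule fibration_product_bound[OF fibration_projV[OF \<xi>(1), of v]])
    fix t :: 'w
    let ?R = "res (projV v \<xi>) id (outer sW t \<xi>)"
    show "nsq (conv (?R x) (?R y)) \<le> \<beta> * e\<^sup>2 * nsq (?R y)"
    proof (rule Suc.IH)
      show "VF.indep_list (map (projV v \<xi>) ws)"
        using VF.indep_list_eliminate[of v ws \<xi>] Suc.prems(1) vs
        by (simp add: projV_apply[abs_def])
      show "length (map (projV v \<xi>) ws) = n"
        by (simp add: vs)
      show "glob (a + n) e (?R x)"
        by (rule glob_res)
           (use Suc.prems(3) \<xi> in \<open>auto simp: projV_linear linear_closed card_projV_kernel card_kernel_id\<close>)
    next
      fix X' assume "?R x X' \<noteq> 0"
      then obtain X where X: "X \<in> H" "projV v \<xi> \<circ> X \<circ> id = X'" "x X \<noteq> 0"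
        by (rule res_nonzero)
      have *: "rk X = a + Suc n" "set vs \<subseteq> range X"
        using Suc.prems(4)[OF X(1,3)] by auto
      show "rk X' = a + n \<and> set (map (projV v \<xi>) ws) \<subseteq> range X'"
        using rk_projV[OF X(1) \<xi>] * vs X(2) by auto
    next
      fix X' assume "?R y X' \<noteq> 0"
      then obtain X where X: "X \<in> H" "projV v \<xi> \<circ> X \<circ> id = X'" "y X \<noteq> 0"
        by (rule res_nonzero)
      show "rk X' \<le> D"
        using rk_comp_le[OF X(1) projV_linear[OF \<xi>(1), of v] linear_closed(18)] Suc.prems(5)[OF X(1,3)] X(2)
        by simp
    qed
  qed
qed

text \<open>Transposed version of \<open>product_bound_range\<close>: one restricts to the
  hyperplane \<eta> = 0, and the rest of the list is pulled back along the projection onto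
  it.\<close>

lemma product_bound_cim:
  assumes pb: "product_bound D \<beta> a"
    and "DF.indep_list es" "length es = n" "set es \<subseteq> DW" "glob (a + n) e x"
    and "\<And>X. X \<in> H \<Longrightarrow> x X \<noteq> 0 \<Longrightarrow> rk X = a + n \<and> set es \<subseteq> cim X"
    and "\<And>Y. Y \<in> H \<Longrightarrow> y Y \<noteq> 0 \<Longrightarrow> rk Y \<le> D"
  shows "nsq (conv x y) \<le> \<beta> * e\<^sup>2 * nsq y"
  using assms(2-)
proof (induction n arbitrary: es x y)
  case 0
  thus ?case
    using pb unfolding product_bound_def by auto
next
  case (Suc n)
  then obtain \<eta> fs where es: "es = \<eta> # fs" "length fs = n"
    by (cases es) auto
  have "\<eta> \<notin> DF.span (set fs)"
    using Suc.prems(1) es by simp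
  hence "\<eta> \<noteq> 0"
    using DF.span_zero by blast
  then obtain t0 where t0: "\<eta> t0 \<noteq> 0"
    by (auto simp: fun_eq_iff)
  \<comment> \<open>Scaled so that \<eta> t = 1, as the projection requires.\<close>
  define t where "t = sW (inverse (\<eta> t0)) t0"
  have \<eta>: "\<eta> \<in> DW"
    using Suc.prems(3) es by simp
  have \<eta>t: "\<eta> t = 1"
    using \<eta> t0 by (simp add: t_def linmaps_scale)
  show ?case
  proof (rule fibration_product_bound[OF fibration_projW[OF \<eta>, of t]])
    fix \<xi> :: "'v \<Rightarrow> 'k" assume \<xi>: "\<xi> \<in> DV"
    let ?R = "res id (projW t \<eta>) (outer sW t \<xi>)"
    show "nsq (conv (?R x) (?R y)) \<le> \<beta> * e\<^sup>2 * nsq (?R y)"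
    proof (rule Suc.IH)
      \<comment> \<open>The pullback is an elimination step for functionals, with evaluation at t as
        coefficient.\<close>
      have *: "\<eta>' \<circ> projW t \<eta> = \<eta>' - sD (\<eta>' t) \<eta>" if "\<eta>' \<in> set fs" for \<eta>'
      proof -
        have "\<eta>' \<in> DW"
          using that Suc.prems(3) es by auto
        thus ?thesis
          by (auto simp: fun_eq_iff projW_apply linmaps_diff linmaps_scale mult.commute)
      qed
      have "map (\<lambda>\<eta>'. \<eta>' \<circ> projW t \<eta>) fs = map (\<lambda>\<eta>'. \<eta>' - sD (\<eta>' t) \<eta>) fs"
        using * by (intro map_cong refl)
      thus "DF.indep_list (map (\<lambda>\<eta>'. \<eta>' \<circ> projW t \<eta>) fs)"
        using DF.indep_list_eliminate[of \<eta> fs "\<lambda>\<eta>'. \<eta>' t"] Suc.prems(1) es by (simp only:)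
      show "length (map (\<lambda>\<eta>'. \<eta>' \<circ> projW t \<eta>) fs) = n"
        by (simp add: es)
      show "set (map (\<lambda>\<eta>'. \<eta>' \<circ> projW t \<eta>) fs) \<subseteq> DW"
        using Suc.prems(3) es projW_linear[OF \<eta>] by (auto intro!: linmaps_comp)
      show "glob (a + n) e (?R x)"
        by (rule glob_res)
           (use Suc.prems(4) \<xi> \<eta> \<eta>t in
             \<open>auto simp: projW_linear linear_closed card_projW_kernel card_kernel_id\<close>)
    next
      fix X' assume "?R x X' \<noteq> 0"
      then obtain X where X: "X \<in> H" "id \<circ> X \<circ> projW t \<eta> = X'" "x X \<noteq> 0"
        by (rule res_nonzero)
      have *: "rk X = a + Suc n" "set es \<subseteq> cim X"
        using Suc.prems(5)[OF X(1,3)] by auto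
      show "rk X' = a + n \<and> set (map (\<lambda>\<eta>'. \<eta>' \<circ> projW t \<eta>) fs) \<subseteq> cim X'"
        using rk_projW[where X = X and \<eta> = \<eta> and t = t, OF X(1) \<eta>t] * es X(2) cim_projW[OF \<eta>, of _ X t] by auto
    next
      fix X' assume "?R y X' \<noteq> 0"
      then obtain X where X: "X \<in> H" "id \<circ> X \<circ> projW t \<eta> = X'" "y X \<noteq> 0"
        by (rule res_nonzero)
      show "rk X' \<le> D"
        using rk_comp_le[OF X(1) linear_closed(17) projW_linear[OF \<eta>, of t]] Suc.prems(6)[OF X(1,3)] X(2)
        by simp
    qed
  qed
qed

end

section \<open>Triples without common directions\<close>

lemma cauchy_schwarz_sum:
  fixes a b :: "'a \<Rightarrow> real"
  shows "(\<Sum>i\<in>I. a i * b i)\<^sup>2 \<le> (\<Sum>i\<in>I. (a i)\<^sup>2) * (\<Sum>i\<in>I. (b i)\<^sup>2)"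
proof -
  have "\<bar>\<Sum>i\<in>I. a i * b i\<bar> \<le> (\<Sum>i\<in>I. \<bar>a i\<bar> * \<bar>b i\<bar>)"
    unfolding abs_mult[symmetric] by (rule sum_abs)
  also have "\<dots> \<le> L2_set a I * L2_set b I"
    by (rule L2_set_mult_ineq)
  finally have "\<bar>\<Sum>i\<in>I. a i * b i\<bar>\<^sup>2 \<le> (L2_set a I * L2_set b I)\<^sup>2"
    by (rule power_mono) simp
  thus ?thesis
    by (simp add: power_mult_distrib L2_set_def sum_nonneg)
qed

lemma sum_square_le_card:
  fixes f :: "'a \<Rightarrow> real"
  shows "(\<Sum>i\<in>I. f i)\<^sup>2 \<le> real (card I) * (\<Sum>i\<in>I. (f i)\<^sup>2)"
  using cauchy_schwarz_sum[of "\<lambda>_. 1" f I] by simp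

lemma (in vector_space) ex_functional_separating:
  assumes S: "subspace S" and w: "w \<notin> S"
  shows "\<exists>\<xi>\<in>linmaps scale (*). \<xi> w = 1 \<and> (\<forall>u\<in>S. \<xi> u = 0)"
proof -
  interpret F: vector_space "(*) :: 'a \<Rightarrow> 'a \<Rightarrow> 'a"
    by (rule vector_space_field)
  interpret vector_space_pair scale "(*)" ..
  obtain B where B: "B \<subseteq> S" "independent B" "S \<subseteq> span B"
    by (rule maximal_independent_subset[of S])
  have sB: "span B = S"
    by (rule span_subspace[OF B(1,3) S])
  have "w \<notin> span B"
    using w sB by simp
  hence "independent (insert w B)"
    by (rule independent_insertI[OF _ B(2)])
  then obtain \<xi> where \<xi>: "Vector_Spaces.linear scale (*) \<xi>"
      "\<And>x. x \<in> insert w B \<Longrightarrow> \<xi> x = (if x = w then 1 else 0)"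
    using linear_independent_extend[of "insert w B" "\<lambda>x. if x = w then 1 else 0"] by blast
  have "\<xi> u = 0" if "u \<in> S" for u
  proof (rule module_hom.eq_0_on_span[where f = \<xi> and b = B])
    show "module_hom scale (*) \<xi>"
      using \<xi>(1) by (simp add: module_hom_iff_linear)
    show "\<xi> x = 0" if "x \<in> B" for x
      using that \<xi>(2)[of x] w B(1) by auto
    show "u \<in> span B"
      using that sB by simp
  qed
  moreover have "\<xi> w = 1"
    using \<xi>(2)[of w] by simp
  ultimately show ?thesis
    using \<xi>(1) by (auto simp: linmaps_def)
qed

context bilinear_scheme
begin

definition good :: "('w \<Rightarrow> 'v) \<Rightarrow> ('w \<Rightarrow> 'v) \<Rightarrow> bool" where
  "good X Y \<longleftrightarrow> range X \<inter> range Y \<inter> range (X + Y) = {0} \<and> cim X \<inter> cim Y \<inter> cim (X + Y) = {0}"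

text \<open>The elements of range Z \<otimes> cim Z of rank at most r. Their number is bounded in
  terms of the ranks, whatever the dimensions of V and W.\<close>

definition summands :: "('w \<Rightarrow> 'v) \<Rightarrow> nat \<Rightarrow> ('w \<Rightarrow> 'v) set" where
  "summands Z r = {\<alpha>\<in>H. range \<alpha> \<subseteq> range Z \<and> (\<forall>w. Z w = 0 \<longrightarrow> \<alpha> w = 0) \<and> rk \<alpha> \<le> r}"

lemma rk_mono:
  assumes "X \<in> H" "Y \<in> H" "range X \<subseteq> range Y"
  shows "rk X \<le> rk Y"
proof -
  have "card (range X) \<le> card (range Y)"
    by (rule card_mono) (use assms in auto)
  thus ?thesis
    by (simp only: card_range assms CARD_power_le_iff)
qed

text \<open>If the three images have no common direction, then \<open>range X\<close> is the direct sum of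
  \<open>range X \<inter> range Y\<close> and \<open>range X \<inter> range (X + Y)\<close> as soon as the three kernels span. The map
  \<open>\<alpha>\<close> is the second component of \<open>X\<close>.\<close>

lemma good_decomposition:
  assumes X: "X \<in> H" and Y: "Y \<in> H" and good: "good X Y" and r: "rk X \<le> r"
  shows "\<exists>\<alpha>. \<alpha> \<in> summands X r \<and> \<alpha> \<in> summands (X + Y) r \<and> X - \<alpha> \<in> summands Y r"
proof -
  define Z where "Z = X + Y"
  define P where "P = range X \<inter> range Y"
  define Q where "Q = range X \<inter> range Z"
  have Z: "Z \<in> H"
    unfolding Z_def by (rule linear_closed(4)[OF X Y])
  have P: "V.subspace P" and Q: "V.subspace Q"
    unfolding P_def Q_def using X Y Z by (auto intro!: V.subspace_inter subspace_range)
  have PQ: "P \<inter> Q = {0}"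
    using good unfolding good_def P_def Q_def Z_def by blast
  \<comment> \<open>The sum of the three kernels. A functional that kills it lies in all three
    coimages and is 0, so S is the whole of W.\<close>
  define S where "S = {u + w | u w. u \<in> {a + b | a b. a \<in> {w. X w = 0} \<and> b \<in> {w. Y w = 0}} \<and> w \<in> {w. Z w = 0}}"
  have S: "W.subspace S"
    unfolding S_def using X Y Z by (intro W.subspace_sums subspace_kernel)
  have "w \<in> S" for w
  proof (rule ccontr)
    assume "w \<notin> S"
    then obtain \<eta> where \<eta>: "\<eta> \<in> DW" "\<eta> w = 1" "\<And>u. u \<in> S \<Longrightarrow> \<eta> u = 0"
      using W.ex_functional_separating[OF S] by blast
    have "{u. X u = 0} \<subseteq> S" "{u. Y u = 0} \<subseteq> S" "{u. Z u = 0} \<subseteq> S"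
    proof -
      have *: "a + b + c \<in> S" if "X a = 0" "Y b = 0" "Z c = 0" for a b c
        unfolding S_def using that by blast
      show "{u. X u = 0} \<subseteq> S"
        using *[of _ 0 0] linmaps_zero[OF Y] linmaps_zero[OF Z] by auto
      show "{u. Y u = 0} \<subseteq> S"
        using *[of 0 _ 0] linmaps_zero[OF X] linmaps_zero[OF Z] by auto
      show "{u. Z u = 0} \<subseteq> S"
        using *[of 0 0] linmaps_zero[OF X] linmaps_zero[OF Y] by auto
    qed
    hence "\<eta> \<in> cim X \<inter> cim Y \<inter> cim Z"
      using \<eta> by (auto simp: cim_def)
    hence "\<eta> = 0"
      using good by (auto simp: good_def Z_def)
    thus False
      using \<eta>(2) by simp
  qed
  hence split: "\<exists>a b c. w = a + b + c \<and> X a = 0 \<and> Y b = 0 \<and> Z c = 0" for w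
    unfolding S_def by blast
  have ex: "\<exists>a. a \<in> Q \<and> X w - a \<in> P" for w
  proof -
    obtain a b c where abc: "w = a + b + c" "X a = 0" "Y b = 0" "Z c = 0"
      using split by blast
    \<comment> \<open>On ker Y the map X agrees with Z, on ker Z with - Y; so X b and X c are the
      components in Q and P.\<close>
    have "X b = Z b"
      using abc(3) by (simp add: Z_def)
    hence "X b \<in> Q"
      unfolding Q_def by (metis IntI rangeI)
    moreover have "X c = Y (- c)"
      using abc(4) unfolding module_hom.neg[OF linmaps_module_hom[OF Y]]
      by (simp add: Z_def eq_neg_iff_add_eq_0)
    hence "X c \<in> P"
      unfolding P_def by (metis IntI rangeI)
    moreover have "X w - X b = X c"
      using abc X by (simp add: linmaps_add)
    ultimately show ?thesis by metis
  qed
  \<comment> \<open>The choice is harmless: P \<inter> Q = {0} makes the component in Q unique, and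
    linearity follows from uniqueness.\<close>
  define \<alpha> where "\<alpha> = (\<lambda>w. SOME a. a \<in> Q \<and> X w - a \<in> P)"
  have \<alpha>: "\<alpha> w \<in> Q" "X w - \<alpha> w \<in> P" for w
    using someI_ex[OF ex[of w]] by (auto simp: \<alpha>_def)
  have uniq: "\<alpha> w = a" if "a \<in> Q" "X w - a \<in> P" for w a
  proof -
    have "\<alpha> w - a \<in> Q"
      by (rule V.subspace_diff[OF Q \<alpha>(1) that(1)])
    moreover have "(X w - a) - (X w - \<alpha> w) \<in> P"
      by (rule V.subspace_diff[OF P that(2) \<alpha>(2)])
    hence "\<alpha> w - a \<in> P"
      by simp
    ultimately have "\<alpha> w - a \<in> P \<inter> Q"
      by (rule IntI[rotated])
    thus ?thesis
      unfolding PQ by simp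
  qed
  have lin: "\<alpha> \<in> H"
    unfolding lin_iff
  proof (intro conjI allI)
    fix w w' show "\<alpha> (w + w') = \<alpha> w + \<alpha> w'"
    proof (rule uniq)
      show "\<alpha> w + \<alpha> w' \<in> Q"
        by (rule V.subspace_add[OF Q \<alpha>(1) \<alpha>(1)])
      have "(X w - \<alpha> w) + (X w' - \<alpha> w') \<in> P"
        by (rule V.subspace_add[OF P \<alpha>(2) \<alpha>(2)])
      thus "X (w + w') - (\<alpha> w + \<alpha> w') \<in> P"
        using X by (simp add: linmaps_add algebra_simps)
    qed
  next
    fix c w show "\<alpha> (sW c w) = sV c (\<alpha> w)"
    proof (rule uniq)
      show "sV c (\<alpha> w) \<in> Q"
        by (rule V.subspace_scale[OF Q \<alpha>(1)])
      have "sV c (X w - \<alpha> w) \<in> P"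
        by (rule V.subspace_scale[OF P \<alpha>(2)])
      thus "X (sW c w) - sV c (\<alpha> w) \<in> P"
        using X by (simp add: linmaps_scale scale_simps)
    qed
  qed
  have 0: "0 \<in> P" "0 \<in> Q"
    using PQ by auto
  have kX: "\<alpha> w = 0" if "X w = 0" for w
    by (rule uniq) (use that 0 in auto)
  have kZ: "\<alpha> w = 0" if "Z w = 0" for w
  proof (rule uniq)
    have "X w = Y (- w)"
      using that unfolding module_hom.neg[OF linmaps_module_hom[OF Y]]
      by (simp add: Z_def eq_neg_iff_add_eq_0)
    thus "X w - 0 \<in> P"
      unfolding P_def diff_zero by (metis IntI rangeI)
  qed (rule 0)
  have kY: "\<alpha> w = X w" if "Y w = 0" for w
  proof (rule uniq)
    have "X w = Z w"
      using that by (simp add: Z_def)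
    thus "X w \<in> Q"
      unfolding Q_def by (metis IntI rangeI)
  qed (use 0 in simp)
  have ra: "range \<alpha> \<subseteq> range X" "range \<alpha> \<subseteq> range Z"
    using \<alpha>(1) by (auto simp: Q_def)
  have rb: "range (X - \<alpha>) \<subseteq> range X" "range (X - \<alpha>) \<subseteq> range Y"
    using \<alpha>(2) by (auto simp: P_def)
  have Xa: "X - \<alpha> \<in> H"
    by (rule linear_closed(5)[OF X lin])
  have "rk \<alpha> \<le> r" "rk (X - \<alpha>) \<le> r"
    using rk_mono[OF lin X ra(1)] rk_mono[OF Xa X rb(1)] r by auto
  thus ?thesis
    using lin Xa ra rb kX kY kZ unfolding summands_def Z_def[symmetric] by (intro exI[of _ \<alpha>]) auto
qed

section \<open>Counting summands and bounding the good part\<close>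

lemma rk_eq_0:
  assumes "X \<in> H" "rk X = 0"
  shows "X = 0"
proof -
  have "card (range X) = 1"
    using assms by (simp add: card_range)
  then obtain y where "range X = {y}"
    by (auto simp: card_1_singleton_iff)
  hence "X w = y" for w
    by (metis rangeI singletonD)
  thus ?thesis
    using linmaps_zero[OF assms(1)] by (auto simp: fun_eq_iff)
qed

text \<open>A summand of rank r + 1 loses one rank when projected along a vector v of its image. The
  difference is \<open>outer sV v (\<xi> \<circ> \<alpha>)\<close>, with v in \<open>range Z\<close>
  and \<xi> \<circ> \<alpha> in \<open>cim Z\<close>, which leaves card (range Z) * card (cim Z)
  choices per rank.\<close>

lemma card_summands_le:
  assumes Z: "Z \<in> H"
  shows "card (summands Z r) \<le> (card (range Z) * card (cim Z)) ^ r"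
proof (induction r)
  case 0
  have "summands Z 0 \<subseteq> {0}"
    by (auto simp: summands_def intro: rk_eq_0)
  hence "card (summands Z 0) \<le> card {0 :: 'w \<Rightarrow> 'v}"
    by (intro card_mono) auto
  thus ?case by simp
next
  case (Suc r)
  have "summands Z (Suc r) \<subseteq>
    (\<lambda>(\<alpha>, v, \<eta>). \<alpha> + outer sV v \<eta>) ` (summands Z r \<times> (range Z \<times> cim Z))"
  proof
    fix \<alpha> assume "\<alpha> \<in> summands Z (Suc r)"
    hence \<alpha>: "\<alpha> \<in> H" "range \<alpha> \<subseteq> range Z" "\<And>w. Z w = 0 \<Longrightarrow> \<alpha> w = 0" "rk \<alpha> \<le> Suc r"
      by (auto simp: summands_def)
    show "\<alpha> \<in> (\<lambda>(\<alpha>, v, \<eta>). \<alpha> + outer sV v \<eta>) ` (summands Z r \<times> (range Z \<times> cim Z))"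
    proof (cases "rk \<alpha> \<le> r")
      case True
      hence "\<alpha> \<in> summands Z r"
        using \<alpha> by (auto simp: summands_def)
      moreover have "0 \<in> cim Z"
        by (simp add: cim_def linear_closed)
      moreover have "0 \<in> range Z"
        using linmaps_zero[OF Z] by (metis rangeI)
      ultimately show ?thesis
        by (intro image_eqI[of _ _ "(\<alpha>, 0, 0)"]) (auto simp: outer_def fun_eq_iff)
    next
      case False
      have "rk (0 :: 'w \<Rightarrow> 'v) \<le> 0"
        using card_range[OF linear_closed(6)] CARD_power_le_iff[of "rk (0 :: 'w \<Rightarrow> 'v)" 0]
        by (simp add: image_constant_conv)
      with False have "\<alpha> \<noteq> 0"
        by auto
      hence "\<exists>w. \<alpha> w \<noteq> 0"
        by (auto simp: fun_eq_iff)
      then obtain w where w: "\<alpha> w \<noteq> 0" ..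
      define v where "v = \<alpha> w"
      obtain \<xi> where \<xi>: "\<xi> \<in> DV" "\<xi> v = 1"
        using V.ex_linear_functional[of v 1] w by (auto simp: v_def)
      have "rk \<alpha> = Suc (rk (projV v \<xi> \<circ> \<alpha>))"
        by (rule rk_projV[OF \<alpha>(1) \<xi>]) (simp add: v_def)
      moreover have "projV v \<xi> \<circ> \<alpha> \<in> H"
        using \<alpha>(1) projV_linear[OF \<xi>(1)] by (rule linmaps_comp[rotated])
      moreover have v: "v \<in> range Z"
        using \<alpha>(2) by (auto simp: v_def)
      have "range (projV v \<xi> \<circ> \<alpha>) \<subseteq> range Z"
      proof
        fix u assume "u \<in> range (projV v \<xi> \<circ> \<alpha>)"
        then obtain t where "u = \<alpha> t - sV (\<xi> (\<alpha> t)) v"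
          by (auto simp: projV_apply)
        thus "u \<in> range Z"
          using \<alpha>(2) v subspace_range[OF Z] by (auto intro!: V.subspace_diff V.subspace_scale)
      qed
      moreover have "(projV v \<xi> \<circ> \<alpha>) t = 0" if "Z t = 0" for t
        using \<alpha>(3)[OF that] linmaps_zero[OF \<xi>(1)] by (simp add: projV_apply)
      ultimately have 1: "projV v \<xi> \<circ> \<alpha> \<in> summands Z r"
        using \<alpha>(4) by (auto simp: summands_def)
      have "\<xi> \<circ> \<alpha> \<in> DW"
        by (rule linmaps_comp[OF \<xi>(1) \<alpha>(1)])
      hence 2: "\<xi> \<circ> \<alpha> \<in> cim Z"
        using \<alpha>(3) linmaps_zero[OF \<xi>(1)] by (auto simp: cim_def)
      have "\<alpha> = (projV v \<xi> \<circ> \<alpha>) + outer sV v (\<xi> \<circ> \<alpha>)"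
        by (auto simp: fun_eq_iff projV_apply outer_def)
      with 1 2 v show ?thesis
        by (intro image_eqI[of _ _ "(projV v \<xi> \<circ> \<alpha>, v, \<xi> \<circ> \<alpha>)"]) auto
    qed
  qed
  hence "card (summands Z (Suc r)) \<le> card (summands Z r \<times> (range Z \<times> cim Z))"
    by (rule surj_card_le[rotated]) simp
  also have "\<dots> \<le> (card (range Z) * card (cim Z)) ^ r * (card (range Z) * card (cim Z))"
    unfolding card_cartesian_product by (intro mult_mono Suc.IH) auto
  finally show ?case
    by (simp add: mult.commute)
qed

lemma real_card_summands_le:
  assumes Z: "Z \<in> H" and "rk Z \<le> R"
  shows "real (card (summands Z r)) \<le> q ^ (2 * R * r)"
proof -
  have "real (card (summands Z r)) \<le> (real (card (range Z)) * real (card (cim Z))) ^ r"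
    using card_summands_le[OF Z, of r] by (metis of_nat_le_iff of_nat_mult of_nat_power)
  also have "\<dots> \<le> (q ^ R * q ^ R) ^ r"
  proof (intro power_mono mult_mono)
    show "real (card (range Z)) \<le> q ^ R"
      using assms by (simp add: real_card_range)
    show "real (card (cim Z)) \<le> q ^ R"
      using real_card_cim_le[OF Z] assms(2) q_power_le_iff order_trans by blast
  qed (use q_gt_0 in auto)
  also have "\<dots> = q ^ (2 * R * r)"
    by (simp add: mult_2 flip: power_add power_mult)
  finally show ?thesis .
qed

definition gconv where
  "gconv x y Z = (\<Sum>X\<in>H. if good X (Z - X) then x X * (y (Z - X) :: complex) else 0)" for x :: "('w \<Rightarrow> 'v) \<Rightarrow> complex"

text \<open>For fixed Z and \<alpha>, Cauchy-Schwarz in X separates the two factors: one condition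
  involves only X and \<alpha>, the other only Y = Z - X and \<beta> = Z - \<alpha>, because \<beta>
  - Y = X - \<alpha>. The sum over Z then factorises. The exponent is 2(a + D)a for the \<alpha>
  available at Z, plus 2 a^2 and 2 D a for the summands of X and of Y.\<close>

lemma nsq_gconv_le:
  assumes x: "\<And>X. X \<in> H \<Longrightarrow> x X \<noteq> 0 \<Longrightarrow> rk X \<le> a"
    and y: "\<And>Y. Y \<in> H \<Longrightarrow> y Y \<noteq> 0 \<Longrightarrow> rk Y \<le> D"
  shows "nsq (gconv x y) \<le> q ^ (4 * a\<^sup>2 + 4 * a * D) * nsq x * nsq y"
proof -
  define p where "p X = cmod (x X)" for X
  define r where "r Y = cmod (y Y)" for Y
  define a1 where "a1 \<alpha> = (\<Sum>X\<in>H. if \<alpha> \<in> summands X a then (p X)\<^sup>2 else 0)" for \<alpha>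
  define b1 where "b1 \<beta> = (\<Sum>Y\<in>H. if \<beta> - Y \<in> summands Y a then (r Y)\<^sup>2 else 0)" for \<beta>
  have pr: "p X \<ge> 0" "r X \<ge> 0" for X
    by (auto simp: p_def r_def)
  have ab: "a1 \<alpha> \<ge> 0" "b1 \<alpha> \<ge> 0" for \<alpha>
    by (auto simp: a1_def b1_def intro!: sum_nonneg)
  define M where "M = q ^ (2 * (a + D) * a)"
  have M0: "M \<ge> 0"
    using q_gt_0 by (simp add: M_def)
  have pointwise: "(cmod (gconv x y Z))\<^sup>2 \<le> M * (\<Sum>\<alpha>\<in>H. a1 \<alpha> * b1 (Z - \<alpha>))" if Z: "Z \<in> H" for Z
  proof (cases "rk Z \<le> a + D")
    case False
    have "x X * y (Z - X) = 0" if "X \<in> H" for X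
    proof (rule ccontr)
      assume "x X * y (Z - X) \<noteq> 0"
      hence "rk X \<le> a" "rk (Z - X) \<le> D"
        using x y that Z linear_closed(5) by auto
      moreover have "rk (X + (Z - X)) \<le> rk X + rk (Z - X)"
        by (rule rk_add_le) (use that Z in \<open>auto simp: linear_closed\<close>)
      ultimately show False
        using False by simp
    qed
    hence "gconv x y Z = 0"
      unfolding gconv_def by (intro sum.neutral) auto
    thus ?thesis
      using M0 ab by (simp add: sum_nonneg)
  next
    case True
    define K where "K X \<alpha> \<longleftrightarrow> \<alpha> \<in> summands X a \<and> X - \<alpha> \<in> summands (Z - X) a" for X \<alpha>
    define s where "s \<alpha> = (\<Sum>X\<in>H. if K X \<alpha> then p X * r (Z - X) else 0)" for \<alpha>
    have s0: "s \<alpha> \<ge> 0" for \<alpha>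
      unfolding s_def using pr by (intro sum_nonneg) auto
    have "cmod (gconv x y Z) \<le> (\<Sum>X\<in>H. if good X (Z - X) then p X * r (Z - X) else 0)"
      unfolding gconv_def by (intro sum_norm_le) (auto simp: p_def r_def norm_mult)
    \<comment> \<open>Every good X with x X \<noteq> 0 has an admissible \<alpha>, and it lies in
      \<open>summands Z a\<close>. Overcounting is allowed since all terms are nonnegative.\<close>
    also have "\<dots> \<le> (\<Sum>X\<in>H. \<Sum>\<alpha>\<in>summands Z a. if K X \<alpha> then p X * r (Z - X) else 0)"
    proof (rule sum_mono)
      fix X assume X: "X \<in> H"
      show "(if good X (Z - X) then p X * r (Z - X) else 0) \<le>
        (\<Sum>\<alpha>\<in>summands Z a. if K X \<alpha> then p X * r (Z - X) else 0)"
      proof (cases "good X (Z - X) \<and> x X \<noteq> 0")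
        case True
        then obtain \<alpha> where \<alpha>: "\<alpha> \<in> summands X a" "\<alpha> \<in> summands (X + (Z - X)) a" "X - \<alpha> \<in> summands (Z - X) a"
          using good_decomposition[OF X linear_closed(5)[OF Z X], of a] x[OF X] by blast
        have "(if good X (Z - X) then p X * r (Z - X) else 0) = (if K X \<alpha> then p X * r (Z - X) else 0)"
          using True \<alpha> by (simp add: K_def)
        also have "\<dots> \<le> (\<Sum>\<alpha>\<in>summands Z a. if K X \<alpha> then p X * r (Z - X) else 0)"
          by (rule member_le_sum[of \<alpha>]) (use \<alpha> pr in auto)
        finally show ?thesis .
      next
        case False
        hence "(if good X (Z - X) then p X * r (Z - X) else 0) = 0"
          by (auto simp: p_def)
        also have "\<dots> \<le> (\<Sum>\<alpha>\<in>summands Z a. if K X \<alpha> then p X * r (Z - X) else 0)"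
          using pr by (intro sum_nonneg) auto
        finally show ?thesis .
      qed
    qed
    also have "\<dots> = (\<Sum>\<alpha>\<in>summands Z a. s \<alpha>)"
      unfolding s_def by (rule sum.swap)
    finally have "(cmod (gconv x y Z))\<^sup>2 \<le> (\<Sum>\<alpha>\<in>summands Z a. s \<alpha>)\<^sup>2"
      by (rule power_mono) simp
    also have "\<dots> \<le> real (card (summands Z a)) * (\<Sum>\<alpha>\<in>summands Z a. (s \<alpha>)\<^sup>2)"
      by (rule sum_square_le_card)
    also have "\<dots> \<le> M * (\<Sum>\<alpha>\<in>H. a1 \<alpha> * b1 (Z - \<alpha>))"
    proof (rule mult_mono)
      show "real (card (summands Z a)) \<le> M"
        unfolding M_def by (rule real_card_summands_le[OF Z True])
      have "(\<Sum>\<alpha>\<in>summands Z a. (s \<alpha>)\<^sup>2) \<le> (\<Sum>\<alpha>\<in>H. (s \<alpha>)\<^sup>2)"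
        by (rule sum_mono2) (auto simp: summands_def)
      also have "\<dots> \<le> (\<Sum>\<alpha>\<in>H. a1 \<alpha> * b1 (Z - \<alpha>))"
      proof (rule sum_mono)
        fix \<alpha> assume "\<alpha> \<in> H"
        have "(s \<alpha>)\<^sup>2 = (\<Sum>X\<in>H. (if \<alpha> \<in> summands X a then p X else 0) *
            (if X - \<alpha> \<in> summands (Z - X) a then r (Z - X) else 0))\<^sup>2"
          unfolding s_def K_def by (intro arg_cong[where f = "\<lambda>u. u\<^sup>2"] sum.cong) auto
        also have "\<dots> \<le> (\<Sum>X\<in>H. (if \<alpha> \<in> summands X a then p X else 0)\<^sup>2) *
            (\<Sum>X\<in>H. (if X - \<alpha> \<in> summands (Z - X) a then r (Z - X) else 0)\<^sup>2)"
          by (rule cauchy_schwarz_sum)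
        also have "(\<Sum>X\<in>H. (if \<alpha> \<in> summands X a then p X else 0)\<^sup>2) = a1 \<alpha>"
          unfolding a1_def by (intro sum.cong) auto
        also have "(\<Sum>X\<in>H. (if X - \<alpha> \<in> summands (Z - X) a then r (Z - X) else 0)\<^sup>2) = b1 (Z - \<alpha>)"
          unfolding b1_def
          by (rule sum.reindex_bij_witness[of _ "\<lambda>Y. Z - Y" "\<lambda>X. Z - X"])
             (use Z in \<open>auto simp: linear_closed algebra_simps\<close>)
        finally show "(s \<alpha>)\<^sup>2 \<le> a1 \<alpha> * b1 (Z - \<alpha>)" .
      qed
      finally show "(\<Sum>\<alpha>\<in>summands Z a. (s \<alpha>)\<^sup>2) \<le> (\<Sum>\<alpha>\<in>H. a1 \<alpha> * b1 (Z - \<alpha>))" .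
    qed (use M0 in \<open>auto intro!: sum_nonneg\<close>)
    finally show ?thesis .
  qed
  have A: "(\<Sum>\<alpha>\<in>H. a1 \<alpha>) \<le> q ^ (2 * a * a) * nsq x"
  proof -
    have "(\<Sum>\<alpha>\<in>H. a1 \<alpha>) = (\<Sum>X\<in>H. \<Sum>\<alpha>\<in>H. if \<alpha> \<in> summands X a then (p X)\<^sup>2 else 0)"
      unfolding a1_def by (rule sum.swap)
    also have "\<dots> \<le> (\<Sum>X\<in>H. q ^ (2 * a * a) * (p X)\<^sup>2)"
    proof (rule sum_mono)
      fix X assume X: "X \<in> H"
      have "(\<Sum>\<alpha>\<in>H. if \<alpha> \<in> summands X a then (p X)\<^sup>2 else 0) = real (card (H \<inter> summands X a)) * (p X)\<^sup>2"
        by (simp add: sum.If_cases)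
      also have "H \<inter> summands X a = summands X a"
        by (auto simp: summands_def)
      also have "real (card (summands X a)) * (p X)\<^sup>2 \<le> q ^ (2 * a * a) * (p X)\<^sup>2"
      proof (cases "x X = 0")
        case False
        thus ?thesis
          using real_card_summands_le[OF X x[OF X False], of a] by (intro mult_right_mono) auto
      qed (simp add: p_def)
      finally show "(\<Sum>\<alpha>\<in>H. if \<alpha> \<in> summands X a then (p X)\<^sup>2 else 0) \<le> q ^ (2 * a * a) * (p X)\<^sup>2" .
    qed
    finally show ?thesis
      by (simp add: nsq_def p_def sum_distrib_left)
  qed
  have B: "(\<Sum>\<beta>\<in>H. b1 \<beta>) \<le> q ^ (2 * D * a) * nsq y"
  proof -
    have "(\<Sum>\<beta>\<in>H. b1 \<beta>) = (\<Sum>Y\<in>H. \<Sum>\<beta>\<in>H. if \<beta> - Y \<in> summands Y a then (r Y)\<^sup>2 else 0)"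
      unfolding b1_def by (rule sum.swap)
    also have "\<dots> \<le> (\<Sum>Y\<in>H. q ^ (2 * D * a) * (r Y)\<^sup>2)"
    proof (rule sum_mono)
      fix Y assume Y: "Y \<in> H"
      have "(\<Sum>\<beta>\<in>H. if \<beta> - Y \<in> summands Y a then (r Y)\<^sup>2 else 0) =
          (\<Sum>\<gamma>\<in>H. if \<gamma> \<in> summands Y a then (r Y)\<^sup>2 else 0)"
        by (rule sum.reindex_bij_witness[of _ "\<lambda>\<gamma>. \<gamma> + Y" "\<lambda>\<beta>. \<beta> - Y"])
           (use Y in \<open>auto simp: linear_closed\<close>)
      also have "\<dots> = real (card (H \<inter> summands Y a)) * (r Y)\<^sup>2"
        by (simp add: sum.If_cases)
      also have "H \<inter> summands Y a = summands Y a"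
        by (auto simp: summands_def)
      also have "real (card (summands Y a)) * (r Y)\<^sup>2 \<le> q ^ (2 * D * a) * (r Y)\<^sup>2"
      proof (cases "y Y = 0")
        case False
        thus ?thesis
          using real_card_summands_le[OF Y y[OF Y False], of a] by (intro mult_right_mono) auto
      qed (simp add: r_def)
      finally show "(\<Sum>\<beta>\<in>H. if \<beta> - Y \<in> summands Y a then (r Y)\<^sup>2 else 0) \<le> q ^ (2 * D * a) * (r Y)\<^sup>2" .
    qed
    finally show ?thesis
      by (simp add: nsq_def r_def sum_distrib_left)
  qed
  have "nsq (gconv x y) \<le> (\<Sum>Z\<in>H. M * (\<Sum>\<alpha>\<in>H. a1 \<alpha> * b1 (Z - \<alpha>)))"
    unfolding nsq_def by (rule sum_mono) (rule pointwise)
  also have "\<dots> = M * (\<Sum>\<alpha>\<in>H. \<Sum>Z\<in>H. a1 \<alpha> * b1 (Z - \<alpha>))"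
    by (subst sum.swap) (simp add: sum_distrib_left)
  also have "(\<Sum>\<alpha>\<in>H. \<Sum>Z\<in>H. a1 \<alpha> * b1 (Z - \<alpha>)) = (\<Sum>\<alpha>\<in>H. \<Sum>\<beta>\<in>H. a1 \<alpha> * b1 \<beta>)"
  proof (rule sum.cong[OF refl])
    fix \<alpha> assume "\<alpha> \<in> H"
    thus "(\<Sum>Z\<in>H. a1 \<alpha> * b1 (Z - \<alpha>)) = (\<Sum>\<beta>\<in>H. a1 \<alpha> * b1 \<beta>)"
      by (intro sum.reindex_bij_witness[of _ "\<lambda>\<beta>. \<beta> + \<alpha>" "\<lambda>Z. Z - \<alpha>"]) (auto simp: linear_closed)
  qed
  also have "\<dots> = (\<Sum>\<alpha>\<in>H. a1 \<alpha>) * (\<Sum>\<beta>\<in>H. b1 \<beta>)"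
    by (simp add: sum_product)
  also have "M * ((\<Sum>\<alpha>\<in>H. a1 \<alpha>) * (\<Sum>\<beta>\<in>H. b1 \<beta>)) \<le>
      M * ((q ^ (2 * a * a) * nsq x) * (q ^ (2 * D * a) * nsq y))"
    using M0 ab q_gt_0 by (intro mult_left_mono mult_mono A B sum_nonneg mult_nonneg_nonneg) auto
  also have "\<dots> = (M * q ^ (2 * a * a) * q ^ (2 * D * a)) * nsq x * nsq y"
    by (simp add: mult_ac)
  also have "M * q ^ (2 * a * a) * q ^ (2 * D * a) = q ^ (4 * a\<^sup>2 + 4 * a * D)"
    unfolding M_def power_add[symmetric] by (rule arg_cong[where f = "\<lambda>n. q ^ n"]) (simp add: algebra_simps power2_eq_square)
  finally show ?thesis .
qed

end

section \<open>Products with a function of pure degree\<close>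

context vector_space_over_finite_field
begin

definition indep_lists_upto :: "'b set \<Rightarrow> nat \<Rightarrow> 'b list set" where
  "indep_lists_upto S a = {vs. length vs \<le> a \<and> set vs \<subseteq> S \<and> indep_list vs}"

lemma finite_indep_lists_upto:
  assumes "finite S"
  shows "finite (indep_lists_upto S a)"
proof -
  have "indep_lists_upto S a = (\<Union>k\<le>a. indep_lists S k)"
    by (auto simp: indep_lists_upto_def indep_lists_def)
  thus ?thesis
    using finite_indep_lists[OF assms] by simp
qed

lemma sum_indep_lists_upto:
  fixes f :: "nat \<Rightarrow> real"
  assumes "finite S" "U \<subseteq> S"
  shows "(\<Sum>vs\<in>indep_lists_upto S a. if set vs \<subseteq> U then f (length vs) else 0) =
    (\<Sum>k\<le>a. f k * real (card (indep_lists U k)))"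
proof -
  have "(\<Sum>vs\<in>indep_lists_upto S a. if set vs \<subseteq> U then f (length vs) else 0) =
      (\<Sum>k\<le>a. \<Sum>vs\<in>{vs\<in>indep_lists_upto S a. length vs = k}. if set vs \<subseteq> U then f (length vs) else 0)"
    using finite_indep_lists_upto[OF assms(1), of a]
    by (intro sum.group[symmetric]) (auto simp: indep_lists_upto_def)
  also have "\<dots> = (\<Sum>k\<le>a. f k * real (card (indep_lists U k)))"
  proof (rule sum.cong[OF refl])
    fix k assume "k \<in> {..a}"
    hence eq: "{vs\<in>indep_lists_upto S a. length vs = k} \<inter> {vs. set vs \<subseteq> U} = indep_lists U k"
      using assms(2) by (auto simp: indep_lists_upto_def indep_lists_def)
    have "(\<Sum>vs\<in>{vs\<in>indep_lists_upto S a. length vs = k}. if set vs \<subseteq> U then f (length vs) else 0) =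
        (\<Sum>vs\<in>{vs\<in>indep_lists_upto S a. length vs = k}. if set vs \<subseteq> U then f k else 0)"
      by (rule sum.cong) auto
    also have "\<dots> = f k * real (card (indep_lists U k))"
      by (simp add: sum.If_cases finite_indep_lists_upto assms(1) eq)
    finally show "(\<Sum>vs\<in>{vs\<in>indep_lists_upto S a. length vs = k}. if set vs \<subseteq> U then f (length vs) else 0) = \<dots>" .
  qed
  finally show ?thesis .
qed

end

lemma geometric_sum_le:
  fixes z :: real
  assumes "0 \<le> z" "z < 1"
  shows "(\<Sum>k\<le>n. z ^ k) \<le> 1 / (1 - z)"
proof -
  have "(1 - z) * (\<Sum>k\<le>n. z ^ k) = 1 - z ^ Suc n"
    by (rule sum_gp_basic)
  also have "\<dots> \<le> 1"
    using assms by simp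
  finally show ?thesis
    using assms by (simp add: field_simps)
qed

section \<open>Tests by lists of vectors and functionals\<close>

context bilinear_scheme
begin

text \<open>Lengths may be cut off at a: when rk X \<le> a, the common vectors and the common
  functionals form spaces of dimension at most a.\<close>

definition tests :: "nat \<Rightarrow> ('v list \<times> ('w \<Rightarrow> 'k) list) set" where
  "tests a = VF.indep_lists_upto UNIV a \<times> DF.indep_lists_upto DW a"

definition passes :: "('v list \<times> ('w \<Rightarrow> 'k) list) \<Rightarrow> ('w \<Rightarrow> 'v) \<Rightarrow> bool" where
  "passes i X \<longleftrightarrow> set (fst i) \<subseteq> range X \<and> set (snd i) \<subseteq> cim X"

definition len :: "('v list \<times> ('w \<Rightarrow> 'k) list) \<Rightarrow> nat" where
  "len i = length (fst i) + length (snd i)"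

definition test_coeff :: "('v list \<times> ('w \<Rightarrow> 'k) list) \<Rightarrow> real" where
  "test_coeff i = moebius_coeff q (length (fst i)) * moebius_coeff q (length (snd i))"

definition mask where
  "mask i x X = (if passes i X then x X else (0::complex))" for x :: "('w \<Rightarrow> 'v) \<Rightarrow> complex"

lemma finite_tests [simp]: "finite (tests a)"
  unfolding tests_def
  by (intro finite_cartesian_product VF.finite_indep_lists_upto DF.finite_indep_lists_upto) simp_all

lemma cim_subset: "cim X \<subseteq> DW"
  by (auto simp: cim_def)

lemma Nil_in_tests: "([], []) \<in> tests a"
  by (simp add: tests_def VF.indep_lists_upto_def DF.indep_lists_upto_def)

lemma abs_test_coeff_le_1: "\<bar>test_coeff i\<bar> \<le> 1"
  unfolding test_coeff_def abs_mult using abs_moebius_coeff_le_1[OF q_ge_2]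
  by (simp add: mult_le_one)

lemma sum_tests_product:
  fixes f g :: "nat \<Rightarrow> real"
  assumes "C \<subseteq> DW"
  shows "(\<Sum>i\<in>tests a. if set (fst i) \<subseteq> U \<and> set (snd i) \<subseteq> C then f (length (fst i)) * g (length (snd i)) else 0) =
    (\<Sum>k\<le>a. f k * real (card (VF.indep_lists U k))) * (\<Sum>k\<le>a. g k * real (card (DF.indep_lists C k)))"
proof -
  have "(\<Sum>i\<in>tests a. if set (fst i) \<subseteq> U \<and> set (snd i) \<subseteq> C then f (length (fst i)) * g (length (snd i)) else 0) =
     (\<Sum>vs\<in>VF.indep_lists_upto UNIV a. if set vs \<subseteq> U then f (length vs) else 0) *
     (\<Sum>es\<in>DF.indep_lists_upto DW a. if set es \<subseteq> C then g (length es) else 0)"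
    unfolding tests_def sum_product sum.cartesian_product by (rule sum.cong) (auto split: if_splits)
  also have "\<dots> = (\<Sum>k\<le>a. f k * real (card (VF.indep_lists U k))) * (\<Sum>k\<le>a. g k * real (card (DF.indep_lists C k)))"
    using assms by (simp add: VF.sum_indep_lists_upto DF.sum_indep_lists_upto)
  finally show ?thesis .
qed

text \<open>Two independent inversions are multiplied, one for the common vectors and one for the
  common functionals; both subspaces have dimension at most a, being contained in
  \<open>range X\<close> and \<open>cim X\<close>.\<close>

lemma good_eq_sum_tests:
  assumes X: "X \<in> H" and Y: "Y \<in> H" and r: "rk X \<le> a"
  shows "(if good X Y then 1 else 0) =
    (\<Sum>i\<in>tests a. if passes i X \<and> passes i Y \<and> passes i (X + Y) then test_coeff i else 0)"
proof -
  define U where "U = range X \<inter> range Y \<inter> range (X + Y)"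
  define C where "C = cim X \<inter> cim Y \<inter> cim (X + Y)"
  have XY: "X + Y \<in> H"
    by (rule linear_closed(4)[OF X Y])
  have U: "V.subspace U"
    unfolding U_def by (intro V.subspace_inter subspace_range X Y XY)
  have C: "DF.subspace C"
    unfolding C_def by (intro DF.subspace_inter subspace_cim)
  have "card U \<le> CARD('k) ^ a"
  proof -
    have "card U \<le> card (range X)"
      by (rule card_mono) (auto simp: U_def)
    thus ?thesis
      using r unfolding card_range[OF X] by (meson CARD_power_le_iff order_trans)
  qed
  hence dU: "V.dim U \<le> a"
    unfolding VF.card_subspace[OF finite_V_set U] by simp
  have "card C \<le> CARD('k) ^ a"
  proof -
    have "card C \<le> card (cim X)"
      by (rule card_mono) (auto simp: C_def)
    thus ?thesis
      using r card_cim_le[OF X] by (meson CARD_power_le_iff order_trans)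
  qed
  hence dC: "DF.dim C \<le> a"
    unfolding DF.card_subspace[OF finite_WK C] by simp
  have "(\<Sum>i\<in>tests a. if passes i X \<and> passes i Y \<and> passes i (X + Y) then test_coeff i else 0) =
    (\<Sum>i\<in>tests a. if set (fst i) \<subseteq> U \<and> set (snd i) \<subseteq> C
      then moebius_coeff q (length (fst i)) * moebius_coeff q (length (snd i)) else 0)"
    by (rule sum.cong) (auto simp: passes_def U_def C_def test_coeff_def)
  also have "\<dots> = (\<Sum>k\<le>a. moebius_coeff q k * real (card (VF.indep_lists U k))) *
      (\<Sum>k\<le>a. moebius_coeff q k * real (card (DF.indep_lists C k)))"
    by (rule sum_tests_product) (auto simp: C_def cim_def)
  also have "\<dots> = (if U = {0} then 1 else 0) * (if C = {0} then 1 else 0)"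
    unfolding q_def
    by (simp only: VF.sum_moebius_indep_lists[OF finite_V_set U VF.card_subspace[OF finite_V_set U] dU]
        DF.sum_moebius_indep_lists[OF finite_WK C DF.card_subspace[OF finite_WK C] dC])
  also have "\<dots> = (if good X Y then 1 else 0)"
    by (simp add: good_def U_def C_def)
  finally show ?thesis by simp
qed

text \<open>The conditions on X and Z - X become masks, but the one on Z stays outside the
  convolution: it limits the tests that contribute at a given Z.\<close>

lemma gconv_eq:
  assumes x: "\<And>X. X \<in> H \<Longrightarrow> x X \<noteq> 0 \<Longrightarrow> rk X \<le> a" and Z: "Z \<in> H"
  shows "gconv x y Z =
    (\<Sum>i\<in>tests a. if passes i Z then of_real (test_coeff i) * conv (mask i x) (mask i y) Z else 0)"
proof -
  have "gconv x y Z = (\<Sum>X\<in>H. \<Sum>i\<in>tests a.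
      if passes i Z then of_real (test_coeff i) * (mask i x X * mask i y (Z - X)) else 0)"
    unfolding gconv_def
  proof (rule sum.cong[OF refl])
    fix X assume X: "X \<in> H"
    show "(if good X (Z - X) then x X * y (Z - X) else 0) = (\<Sum>i\<in>tests a.
      if passes i Z then of_real (test_coeff i) * (mask i x X * mask i y (Z - X)) else 0)"
    proof (cases "x X = 0")
      case True
      thus ?thesis
        by (simp add: mask_def cong: if_cong)
    next
      case False
      have "(if good X (Z - X) then x X * y (Z - X) else 0) =
          of_real (if good X (Z - X) then 1 else 0) * (x X * y (Z - X))"
        by simp
      also have "\<dots> = (\<Sum>i\<in>tests a. of_real (if passes i X \<and> passes i (Z - X) \<and> passes i (X + (Z - X))
          then test_coeff i else 0) * (x X * y (Z - X)))"
        unfolding good_eq_sum_tests[OF X linear_closed(5)[OF Z X] x[OF X False]]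
        by (simp only: of_real_sum sum_distrib_right)
      also have "\<dots> = (\<Sum>i\<in>tests a.
          if passes i Z then of_real (test_coeff i) * (mask i x X * mask i y (Z - X)) else 0)"
        by (rule sum.cong) (auto simp: mask_def)
      finally show ?thesis .
    qed
  qed
  also have "\<dots> = (\<Sum>i\<in>tests a. \<Sum>X\<in>H.
      if passes i Z then of_real (test_coeff i) * (mask i x X * mask i y (Z - X)) else 0)"
    by (rule sum.swap)
  also have "\<dots> = (\<Sum>i\<in>tests a. if passes i Z then of_real (test_coeff i) * conv (mask i x) (mask i y) Z else 0)"
    by (rule sum.cong) (auto simp: conv_def sum_distrib_left)
  finally show ?thesis .
qed

text \<open>At most q^(r k) lists of length k fit into the image or the coimage of X, so the weight
  leaves a geometric series of ratio q^-t; the square accounts for the two kinds of lists.\<close>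

lemma sum_passes_le:
  assumes X: "X \<in> H" and r: "rk X \<le> r" and t: "t \<ge> 1"
  shows "(\<Sum>i\<in>tests a. if passes i X then (1 / q ^ (r + t)) ^ len i else 0) \<le> (1 / (1 - 1 / q ^ t))\<^sup>2"
proof -
  define z where "z = 1 / q ^ (r + t)"
  have z0: "z \<ge> 0"
    using q_gt_0 by (simp add: z_def)
  have zq: "z * q ^ r = 1 / q ^ t"
    using q_neq_0 by (simp add: z_def power_add)
  have "q ^ 1 \<le> q ^ t"
    using q_ge_1 t by (intro power_increasing) auto
  hence t2: "q ^ t \<ge> 2"
    using q_ge_2 by simp
  have geo: "(\<Sum>k\<le>a. z ^ k * N k) \<le> 1 / (1 - 1 / q ^ t)" if N: "\<And>k. N k \<le> (q ^ r) ^ k" for N :: "nat \<Rightarrow> real"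
  proof -
    have "(\<Sum>k\<le>a. z ^ k * N k) \<le> (\<Sum>k\<le>a. z ^ k * (q ^ r) ^ k)"
      using N z0 by (intro sum_mono mult_left_mono) auto
    also have "\<dots> = (\<Sum>k\<le>a. (1 / q ^ t) ^ k)"
      by (simp only: power_mult_distrib[symmetric] zq)
    also have "\<dots> \<le> 1 / (1 - 1 / q ^ t)"
      using t2 by (intro geometric_sum_le) auto
    finally show ?thesis .
  qed
  have 1: "real (card (VF.indep_lists (range X) k)) \<le> (q ^ r) ^ k" for k
  proof -
    have "real (card (VF.indep_lists (range X) k)) \<le> real (card (range X)) ^ k"
      using VF.card_indep_lists_le[of "range X" k] by (metis finite_V_set of_nat_le_iff of_nat_power)
    also have "\<dots> \<le> (q ^ r) ^ k"
      using r q_gt_0 by (intro power_mono) (simp_all add: real_card_range[OF X])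
    finally show ?thesis .
  qed
  have 2: "real (card (DF.indep_lists (cim X) k)) \<le> (q ^ r) ^ k" for k
  proof -
    have "real (card (DF.indep_lists (cim X) k)) \<le> real (card (cim X)) ^ k"
      using DF.card_indep_lists_le[of "cim X" k] by (metis finite_WK of_nat_le_iff of_nat_power)
    also have "\<dots> \<le> (q ^ r) ^ k"
      using r real_card_cim_le[OF X] by (intro power_mono) (meson q_power_le_iff order_trans, simp)
    finally show ?thesis .
  qed
  have "(\<Sum>i\<in>tests a. if passes i X then z ^ len i else 0) =
    (\<Sum>i\<in>tests a. if set (fst i) \<subseteq> range X \<and> set (snd i) \<subseteq> cim X
       then z ^ length (fst i) * z ^ length (snd i) else 0)"
    by (rule sum.cong) (auto simp: passes_def len_def power_add)
  also have "\<dots> = (\<Sum>k\<le>a. z ^ k * real (card (VF.indep_lists (range X) k))) *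
      (\<Sum>k\<le>a. z ^ k * real (card (DF.indep_lists (cim X) k)))"
    by (rule sum_tests_product[OF cim_subset])
  also have "\<dots> \<le> (1 / (1 - 1 / q ^ t)) * (1 / (1 - 1 / q ^ t))"
    using z0 t2 by (intro mult_mono geo 1 2 sum_nonneg mult_nonneg_nonneg zero_le_power) auto
  finally show ?thesis
    unfolding z_def power2_eq_square .
qed

text \<open>Masking keeps the support inside rank a, so the single mask can be iterated at the same
  cost per vector.\<close>

lemma glob_mask_ranges:
  assumes x: "glob s e x" and rk: "\<And>X. X \<in> H \<Longrightarrow> x X \<noteq> 0 \<Longrightarrow> rk X = a"
  shows "glob s ((q ^ (a + 2)) ^ length vs * e) (\<lambda>X. if set vs \<subseteq> range X then x X else 0)"
proof (induction vs)
  case (Cons v vs)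
  have "glob s (q ^ (a + 2) * ((q ^ (a + 2)) ^ length vs * e))
      (\<lambda>X. if v \<in> range X then (if set vs \<subseteq> range X then x X else 0) else 0)"
    by (rule glob_mask_range[OF Cons.IH]) (auto split: if_splits intro: rk)
  moreover have "(\<lambda>X. if v \<in> range X then (if set vs \<subseteq> range X then x X else 0) else 0) =
      (\<lambda>X. if set (v # vs) \<subseteq> range X then x X else 0)"
    by (auto simp: fun_eq_iff)
  ultimately show ?case
    by (simp only: list.size power_Suc mult.assoc add_0_right add_Suc_right)
qed (simp add: x)

lemma glob_mask_cims:
  assumes x: "glob s e x" and rk: "\<And>X. X \<in> H \<Longrightarrow> x X \<noteq> 0 \<Longrightarrow> rk X = a" and "set es \<subseteq> DW"
  shows "glob s ((q ^ (a + 2)) ^ length es * e) (\<lambda>X. if set es \<subseteq> cim X then x X else 0)"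
  using assms(3)
proof (induction es)
  case (Cons \<eta> es)
  have "glob s (q ^ (a + 2) * ((q ^ (a + 2)) ^ length es * e))
      (\<lambda>X. if \<eta> \<in> cim X then (if set es \<subseteq> cim X then x X else 0) else 0)"
    by (rule glob_mask_cim) (use Cons in \<open>auto split: if_splits intro: rk\<close>)
  moreover have "(\<lambda>X. if \<eta> \<in> cim X then (if set es \<subseteq> cim X then x X else 0) else 0) =
      (\<lambda>X. if set (\<eta> # es) \<subseteq> cim X then x X else 0)"
    by (auto simp: fun_eq_iff)
  ultimately show ?case
    by (simp only: list.size power_Suc mult.assoc add_0_right add_Suc_right)
qed (simp add: x)

lemma glob_mask:
  assumes x: "glob s e x" and rk: "\<And>X. X \<in> H \<Longrightarrow> x X \<noteq> 0 \<Longrightarrow> rk X = a" and i: "i \<in> tests a'"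
  shows "glob s ((q ^ (a + 2)) ^ len i * e) (mask i x)"
proof -
  have "set (snd i) \<subseteq> DW"
    using i by (auto simp: tests_def DF.indep_lists_upto_def)
  hence "glob s ((q ^ (a + 2)) ^ length (snd i) * ((q ^ (a + 2)) ^ length (fst i) * e))
      (\<lambda>X. if set (snd i) \<subseteq> cim X then (if set (fst i) \<subseteq> range X then x X else 0) else 0)"
    by (intro glob_mask_cims glob_mask_ranges x) (auto split: if_splits intro: rk)
  also have "(\<lambda>X. if set (snd i) \<subseteq> cim X then (if set (fst i) \<subseteq> range X then x X else 0) else 0) = mask i x"
    by (auto simp: mask_def passes_def fun_eq_iff)
  finally show ?thesis
    by (simp add: len_def power_add mult_ac)
qed

lemma conv_support:
  assumes x: "\<And>X. X \<in> H \<Longrightarrow> x X \<noteq> 0 \<Longrightarrow> rk X \<le> a"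
    and y: "\<And>Y. Y \<in> H \<Longrightarrow> y Y \<noteq> 0 \<Longrightarrow> rk Y \<le> D"
    and Z: "Z \<in> H" "conv x y Z \<noteq> 0"
  shows "rk Z \<le> a + D"
proof -
  have "\<exists>X\<in>H. x X * y (Z - X) \<noteq> 0"
    using Z(2) unfolding conv_def by (meson sum.neutral)
  then obtain X where X: "X \<in> H" "x X \<noteq> 0" "y (Z - X) \<noteq> 0"
    by auto
  have ZX: "Z - X \<in> H"
    by (rule linear_closed(5)[OF Z(1) X(1)])
  have "rk (X + (Z - X)) \<le> rk X + rk (Z - X)"
    by (rule rk_add_le[OF X(1) ZX])
  also have "\<dots> \<le> a + D"
    by (intro add_mono x y X ZX)
  finally show ?thesis by simp
qed

text \<open>The empty test contributes \<open>conv x y\<close> itself with coefficient 1, so the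
  convolution equals \<open>gconv x y\<close> minus the nonempty tests. Weighted Cauchy-Schwarz then
  needs only the tests passed by Z, whose inverse weights sum to at most (1 / (1 - 1/q))^2 \<le>
  4.\<close>

lemma nsq_conv_le_tests:
  assumes x: "\<And>X. X \<in> H \<Longrightarrow> x X \<noteq> 0 \<Longrightarrow> rk X \<le> a"
    and y: "\<And>Y. Y \<in> H \<Longrightarrow> y Y \<noteq> 0 \<Longrightarrow> rk Y \<le> D"
  shows "nsq (conv x y) \<le> 4 * (nsq (gconv x y) +
    (\<Sum>i\<in>tests a - {([], [])}. (q ^ (a + D + 1)) ^ len i * nsq (conv (mask i x) (mask i y))))"
proof -
  \<comment> \<open>The exponent is the maximal rank a + D of Z plus 1, the case t = 1 of
    \<open>sum_passes_le\<close>.\<close>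
  define \<omega> where "\<omega> i = (q ^ (a + D + 1)) ^ len i" for i
  have \<omega>: "\<omega> i > 0" for i
    using q_gt_0 by (simp add: \<omega>_def)
  let ?e = "([], []) :: 'v list \<times> ('w \<Rightarrow> 'k) list"
  define T where "T Z i = (if i = ?e then gconv x y Z else
     if passes i Z then - (of_real (test_coeff i) * conv (mask i x) (mask i y) Z) else 0)" for Z i
  have "(cmod (conv x y Z))\<^sup>2 \<le> 4 * (\<Sum>i\<in>tests a. \<omega> i * (cmod (T Z i))\<^sup>2)" if Z: "Z \<in> H" for Z
  proof (cases "conv x y Z = 0")
    case True
    thus ?thesis
      using \<omega> by (simp add: sum_nonneg less_imp_le)
  next
    case False
    hence rZ: "rk Z \<le> a + D"
      using conv_support[of x a y D Z] x y Z by blast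
    define S where "S i = (if passes i Z then of_real (test_coeff i) * conv (mask i x) (mask i y) Z else 0)" for i
    have "gconv x y Z = (\<Sum>i\<in>tests a. S i)"
      unfolding S_def by (rule gconv_eq[OF x Z])
    also have "\<dots> = S ?e + (\<Sum>i\<in>tests a - {?e}. S i)"
      by (rule sum.remove) (simp_all add: Nil_in_tests)
    finally have "gconv x y Z = S ?e + (\<Sum>i\<in>tests a - {?e}. S i)" .
    moreover have "S ?e = conv x y Z"
    proof -
      have "mask ?e z = z" for z
        by (simp add: mask_def passes_def fun_eq_iff)
      thus ?thesis
        by (simp add: S_def passes_def test_coeff_def moebius_coeff_def)
    qed
    moreover have "(\<Sum>i\<in>tests a. T Z i) = T Z ?e + (\<Sum>i\<in>tests a - {?e}. T Z i)"
      by (rule sum.remove) (simp_all add: Nil_in_tests)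
    moreover have "(\<Sum>i\<in>tests a - {?e}. T Z i) = - (\<Sum>i\<in>tests a - {?e}. S i)"
      unfolding sum_negf[symmetric] by (rule sum.cong) (auto simp: T_def S_def)
    ultimately have eq: "conv x y Z = (\<Sum>i\<in>tests a. T Z i)"
      by (simp add: T_def)
    have "cmod (conv x y Z) \<le> (\<Sum>i\<in>tests a. (if passes i Z then sqrt (1 / \<omega> i) else 0) * (sqrt (\<omega> i) * cmod (T Z i)))"
      unfolding eq
    proof (rule sum_norm_le)
      fix i
      have "passes i Z \<or> T Z i = 0"
        by (auto simp: T_def passes_def)
      moreover have "sqrt (1 / \<omega> i) * sqrt (\<omega> i) = 1"
        using \<omega>[of i] by (simp add: real_sqrt_divide)
      ultimately show "cmod (T Z i) \<le> (if passes i Z then sqrt (1 / \<omega> i) else 0) * (sqrt (\<omega> i) * cmod (T Z i))"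
        by (auto simp: mult.assoc[symmetric])
    qed
    hence "(cmod (conv x y Z))\<^sup>2 \<le>
        (\<Sum>i\<in>tests a. (if passes i Z then sqrt (1 / \<omega> i) else 0) * (sqrt (\<omega> i) * cmod (T Z i)))\<^sup>2"
      by (rule power_mono) simp
    also have "\<dots> \<le> (\<Sum>i\<in>tests a. (if passes i Z then sqrt (1 / \<omega> i) else 0)\<^sup>2) *
        (\<Sum>i\<in>tests a. (sqrt (\<omega> i) * cmod (T Z i))\<^sup>2)"
      by (rule cauchy_schwarz_sum)
    also have "\<dots> \<le> 4 * (\<Sum>i\<in>tests a. \<omega> i * (cmod (T Z i))\<^sup>2)"
    proof (rule mult_mono)
      have "(\<Sum>i\<in>tests a. (if passes i Z then sqrt (1 / \<omega> i) else 0)\<^sup>2) =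
          (\<Sum>i\<in>tests a. if passes i Z then (1 / q ^ (a + D + 1)) ^ len i else 0)"
        using \<omega> by (intro sum.cong) (auto simp: \<omega>_def power_one_over less_imp_le)
      also have "\<dots> \<le> (1 / (1 - 1 / q ^ 1))\<^sup>2"
        by (rule sum_passes_le[OF Z rZ]) simp
      also have "\<dots> \<le> 2\<^sup>2"
        using q_ge_2 by (intro power_mono) (auto simp: field_simps)
      finally show "(\<Sum>i\<in>tests a. (if passes i Z then sqrt (1 / \<omega> i) else 0)\<^sup>2) \<le> 4"
        by simp
      show "(\<Sum>i\<in>tests a. (sqrt (\<omega> i) * cmod (T Z i))\<^sup>2) \<le> (\<Sum>i\<in>tests a. \<omega> i * (cmod (T Z i))\<^sup>2)"
        using \<omega> by (simp add: power_mult_distrib less_imp_le)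
    qed (auto intro: sum_nonneg)
    finally show ?thesis .
  qed
  hence "nsq (conv x y) \<le> (\<Sum>Z\<in>H. 4 * (\<Sum>i\<in>tests a. \<omega> i * (cmod (T Z i))\<^sup>2))"
    unfolding nsq_def by (rule sum_mono)
  also have "\<dots> = 4 * (\<Sum>i\<in>tests a. \<omega> i * (\<Sum>Z\<in>H. (cmod (T Z i))\<^sup>2))"
    unfolding sum_distrib_left[symmetric] by (subst sum.swap) (simp add: sum_distrib_left)
  also have "(\<Sum>i\<in>tests a. \<omega> i * (\<Sum>Z\<in>H. (cmod (T Z i))\<^sup>2)) =
      \<omega> ?e * (\<Sum>Z\<in>H. (cmod (T Z ?e))\<^sup>2) + (\<Sum>i\<in>tests a - {?e}. \<omega> i * (\<Sum>Z\<in>H. (cmod (T Z i))\<^sup>2))"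
    by (rule sum.remove) (simp_all add: Nil_in_tests)
  also have "\<omega> ?e * (\<Sum>Z\<in>H. (cmod (T Z ?e))\<^sup>2) = nsq (gconv x y)"
    by (simp add: \<omega>_def len_def T_def nsq_def)
  also have "(\<Sum>i\<in>tests a - {?e}. \<omega> i * (\<Sum>Z\<in>H. (cmod (T Z i))\<^sup>2)) \<le>
      (\<Sum>i\<in>tests a - {?e}. \<omega> i * nsq (conv (mask i x) (mask i y)))"
    unfolding nsq_def
  proof (intro sum_mono mult_left_mono)
    fix i Z assume i: "i \<in> tests a - {?e}"
    have "cmod (T Z i) \<le> \<bar>test_coeff i\<bar> * cmod (conv (mask i x) (mask i y) Z)"
      using i by (auto simp: T_def norm_mult)
    also have "\<dots> \<le> 1 * cmod (conv (mask i x) (mask i y) Z)"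
      by (intro mult_right_mono abs_test_coeff_le_1) simp
    finally show "(cmod (T Z i))\<^sup>2 \<le> (cmod (conv (mask i x) (mask i y) Z))\<^sup>2"
      by (intro power_mono) auto
  qed (use \<omega> in \<open>auto simp: less_imp_le\<close>)
  finally show ?thesis
    by (simp add: \<omega>_def)
qed

text \<open>This is \<open>sum_passes_le\<close> with t = 4, where the ratio is at most 1/16: the
  full sum is at most (16/15)^2 = 256/225 < 8/7, and the empty test accounts for 1 of it.\<close>

lemma sum_nsq_mask_le:
  assumes y: "\<And>Y. Y \<in> H \<Longrightarrow> y Y \<noteq> 0 \<Longrightarrow> rk Y \<le> D"
  shows "(\<Sum>i\<in>tests a - {([], [])}. (1 / q ^ (D + 4)) ^ len i * nsq (mask i y)) \<le> nsq y / 7"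
proof -
  let ?e = "([], []) :: 'v list \<times> ('w \<Rightarrow> 'k) list"
  define z where "z = 1 / q ^ (D + 4)"
  have "(\<Sum>i\<in>tests a - {?e}. z ^ len i * nsq (mask i y)) =
      (\<Sum>Y\<in>H. (\<Sum>i\<in>tests a - {?e}. if passes i Y then z ^ len i else 0) * (cmod (y Y))\<^sup>2)"
    unfolding nsq_def sum_distrib_left sum_distrib_right
    by (subst sum.swap, intro sum.cong refl) (auto simp: mask_def)
  also have "\<dots> \<le> (\<Sum>Y\<in>H. 1 / 7 * (cmod (y Y))\<^sup>2)"
  proof (rule sum_mono)
    fix Y assume Y: "Y \<in> H"
    show "(\<Sum>i\<in>tests a - {?e}. if passes i Y then z ^ len i else 0) * (cmod (y Y))\<^sup>2 \<le> 1 / 7 * (cmod (y Y))\<^sup>2"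
    proof (cases "y Y = 0")
      case False
      have "(\<Sum>i\<in>tests a. if passes i Y then z ^ len i else 0) \<le> (1 / (1 - 1 / q ^ 4))\<^sup>2"
        unfolding z_def by (rule sum_passes_le[OF Y y[OF Y False]]) simp
      also have "\<dots> \<le> (16 / 15)\<^sup>2"
      proof (intro power_mono)
        have "2 ^ 4 \<le> q ^ 4"
          using q_ge_2 by (intro power_mono) auto
        hence "15 / 16 \<le> 1 - 1 / q ^ 4"
          using q_gt_0 by (simp add: field_simps)
        thus "1 / (1 - 1 / q ^ 4) \<le> 16 / 15" "0 \<le> 1 / (1 - 1 / q ^ 4)"
          by (simp_all add: pos_divide_le_eq)
      qed
      also have "\<dots> \<le> 1 + 1 / 7"
        by (simp add: power2_eq_square)
      also have "(\<Sum>i\<in>tests a. if passes i Y then z ^ len i else 0) =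
          (if passes ?e Y then z ^ len ?e else 0) + (\<Sum>i\<in>tests a - {?e}. if passes i Y then z ^ len i else 0)"
        by (rule sum.remove) (simp_all add: Nil_in_tests)
      also have "(if passes ?e Y then z ^ len ?e else 0) = 1"
        by (simp add: passes_def len_def)
      finally show ?thesis
        by (intro mult_right_mono) auto
    qed simp
  qed
  also have "\<dots> = nsq y / 7"
    by (simp add: nsq_def sum_divide_distrib)
  finally show ?thesis
    by (simp add: z_def)
qed

text \<open>Only the longer of the two lists is projected away, which lowers the rank by its length;
  the other remains as a mask. The masks of x cost q^(a+2) per entry of both lists.\<close>

lemma nsq_conv_mask_le:
  assumes pb: "\<And>b. b < a \<Longrightarrow> product_bound D (\<beta> b) b"
    and x: "glob a e x" and rk: "\<And>X. X \<in> H \<Longrightarrow> x X \<noteq> 0 \<Longrightarrow> rk X = a"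
    and y: "\<And>Y. Y \<in> H \<Longrightarrow> y Y \<noteq> 0 \<Longrightarrow> rk Y \<le> D"
    and i: "i \<in> tests a" "i \<noteq> ([], [])"
  shows "nsq (conv (mask i x) (mask i y)) \<le>
    \<beta> (a - max (length (fst i)) (length (snd i))) * ((q ^ (a + 2)) ^ len i * e)\<^sup>2 * nsq (mask i y)"
proof -
  define k where "k = length (fst i)"
  define l where "l = length (snd i)"
  have kl: "k \<le> a" "l \<le> a" "VF.indep_list (fst i)" "DF.indep_list (snd i)" "set (snd i) \<subseteq> DW"
    using i(1) by (auto simp: tests_def k_def l_def VF.indep_lists_upto_def DF.indep_lists_upto_def)
  have gl: "glob a ((q ^ (a + 2)) ^ len i * e) (mask i x)"
    by (rule glob_mask[OF x rk i(1)])
  have supp: "rk X = a \<and> set (fst i) \<subseteq> range X \<and> set (snd i) \<subseteq> cim X" if "X \<in> H" "mask i x X \<noteq> 0" for X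
    using that rk[of X] by (auto simp: mask_def passes_def split: if_splits)
  have suppy: "rk Y \<le> D" if "Y \<in> H" "mask i y Y \<noteq> 0" for Y
    using that y[of Y] by (auto simp: mask_def split: if_splits)
  have pos: "k > 0 \<or> l > 0"
    using i(2) by (cases i) (auto simp: k_def l_def)
  show ?thesis
  proof (cases "k \<ge> l")
    case True
    hence "product_bound D (\<beta> (a - k)) (a - k)"
      using pos kl by (intro pb) auto
    from product_bound_range[OF this kl(3) k_def[symmetric], of _ "mask i x" "mask i y"] gl supp suppy
    have "nsq (conv (mask i x) (mask i y)) \<le> \<beta> (a - k) * ((q ^ (a + 2)) ^ len i * e)\<^sup>2 * nsq (mask i y)"
      using kl(1) by auto
    thus ?thesis
      using True by (simp add: max_def k_def l_def)
  next
    case False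
    hence "product_bound D (\<beta> (a - l)) (a - l)"
      using pos kl by (intro pb) auto
    from product_bound_cim[OF this kl(4) l_def[symmetric] kl(5), of _ "mask i x" "mask i y"] gl supp suppy
    have "nsq (conv (mask i x) (mask i y)) \<le> \<beta> (a - l) * ((q ^ (a + 2)) ^ len i * e)\<^sup>2 * nsq (mask i y)"
      using kl(2) by auto
    thus ?thesis
      using False by (simp add: max_def k_def l_def)
  qed
qed

text \<open>With C the constant of the good part and \<beta> a the claimed one, the recursion
  demands 4 C + (4/7) \<beta> a \<le> \<beta> a, which \<beta> a \<ge> 12 C ensures. The growth of
  \<beta> is dictated by \<open>key\<close>.\<close>

lemma product_bound_pure:
  assumes "a \<le> d"
  shows "product_bound D (12 * q ^ (4 * d\<^sup>2 + 4 * d * D) * (q ^ (6 * d + 4 * D + 18)) ^ a) a"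
  using assms
proof (induction a rule: less_induct)
  case (less a)
  define C where "C = q ^ (4 * d\<^sup>2 + 4 * d * D)"
  \<comment> \<open>Per list entry, D + 4 is reserved for the mask of y, a + D + 1 is the weight and
    2 (a + 2) the squared mask cost of x; the sum 3 a + 2 D + 9 is at most \<delta>. As
    \<open>len i\<close> \<le> 2 M, a drop of the rank by M has to gain q^(2 \<delta> M).\<close>
  define \<delta> where "\<delta> = 3 * d + 2 * D + 9"
  define \<beta> where "\<beta> b = 12 * C * (q ^ (2 * \<delta>)) ^ b" for b :: nat
  have C0: "C > 0"
    using q_gt_0 by (simp add: C_def)
  have \<beta>0: "\<beta> b \<ge> 12 * C" for b
    unfolding \<beta>_def using C0 q_ge_1 by (simp add: one_le_power)
  have IH: "product_bound D (\<beta> b) b" if "b < a" for b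
    using less.IH[OF that] that less.prems by (simp add: \<beta>_def C_def \<delta>_def algebra_simps)
  have "product_bound D (\<beta> a) a"
    unfolding product_bound_def
  proof (intro allI impI)
    fix x y :: "('w \<Rightarrow> 'v) \<Rightarrow> complex" and e
    assume x: "glob a e x" and rkx: "\<forall>X\<in>H. x X \<noteq> 0 \<longrightarrow> rk X = a" and rky: "\<forall>Y\<in>H. y Y \<noteq> 0 \<longrightarrow> rk Y \<le> D"
    let ?I = "tests a - {([], [])} :: ('v list \<times> ('w \<Rightarrow> 'k) list) set"
    have rk1: "rk X = a" if "X \<in> H" "x X \<noteq> 0" for X
      using rkx that by blast
    have rk2: "rk X \<le> a" if "X \<in> H" "x X \<noteq> 0" for X
      using rk1[OF that] by simp
    have rk3: "rk Y \<le> D" if "Y \<in> H" "y Y \<noteq> 0" for Y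
      using rky that by blast
    have good: "nsq (gconv x y) \<le> C * e\<^sup>2 * nsq y"
    proof -
      have "nsq (gconv x y) \<le> q ^ (4 * a\<^sup>2 + 4 * a * D) * nsq x * nsq y"
        by (rule nsq_gconv_le[OF rk2 rk3])
      also have "\<dots> \<le> C * e\<^sup>2 * nsq y"
      proof (intro mult_right_mono mult_mono)
        show "q ^ (4 * a\<^sup>2 + 4 * a * D) \<le> C"
          unfolding C_def using less.prems
          by (simp add: add_mono mult_mono power_mono)
      qed (use glob_nsq[OF x] C0 in auto)
      finally show ?thesis .
    qed
    have bad: "(q ^ (a + D + 1)) ^ len i * nsq (conv (mask i x) (mask i y)) \<le>
        \<beta> a * e\<^sup>2 * ((1 / q ^ (D + 4)) ^ len i * nsq (mask i y))" if i: "i \<in> ?I" for i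
    proof -
      define M where "M = max (length (fst i)) (length (snd i))"
      have M: "M \<le> a" "len i \<le> 2 * M"
        using i by (auto simp: M_def len_def tests_def VF.indep_lists_upto_def DF.indep_lists_upto_def)
      have key: "(q ^ (a + D + 1)) ^ len i * (\<beta> (a - M) * ((q ^ (a + 2)) ^ len i)\<^sup>2) \<le> \<beta> a * (1 / q ^ (D + 4)) ^ len i"
      proof -
        have "(q ^ (D + 4)) ^ len i * ((q ^ (a + D + 1)) ^ len i * ((q ^ (a + 2)) ^ len i)\<^sup>2) =
            q ^ ((3 * a + 2 * D + 9) * len i)"
          unfolding power_mult[symmetric] power_add[symmetric]
          by (rule arg_cong[where f = "\<lambda>n. q ^ n"]) (simp add: algebra_simps)
        also have "\<dots> \<le> q ^ (\<delta> * (2 * M))"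
          unfolding q_power_le_iff using less.prems M(2) by (intro mult_mono) (auto simp: \<delta>_def)
        also have "\<dots> = (q ^ (2 * \<delta>)) ^ M"
          by (simp add: mult_ac flip: power_mult)
        finally have "12 * C * (q ^ (2 * \<delta>)) ^ (a - M) *
            ((q ^ (D + 4)) ^ len i * ((q ^ (a + D + 1)) ^ len i * ((q ^ (a + 2)) ^ len i)\<^sup>2)) \<le>
            12 * C * (q ^ (2 * \<delta>)) ^ (a - M) * (q ^ (2 * \<delta>)) ^ M"
          using C0 q_gt_0 by (intro mult_left_mono) auto
        also have "\<dots> = \<beta> a"
          using M(1) by (simp add: \<beta>_def mult.assoc flip: power_add)
        finally have "(q ^ (a + D + 1)) ^ len i * (\<beta> (a - M) * ((q ^ (a + 2)) ^ len i)\<^sup>2) * (q ^ (D + 4)) ^ len i \<le> \<beta> a"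
          by (simp add: \<beta>_def mult_ac)
        thus ?thesis
          using q_gt_0 by (simp add: power_one_over divide_inverse[symmetric] pos_le_divide_eq)
      qed
      have "(q ^ (a + D + 1)) ^ len i * nsq (conv (mask i x) (mask i y)) \<le>
          (q ^ (a + D + 1)) ^ len i * (\<beta> (a - M) * ((q ^ (a + 2)) ^ len i * e)\<^sup>2 * nsq (mask i y))"
        unfolding M_def using i q_gt_0
        by (intro mult_left_mono nsq_conv_mask_le[OF IH x rk1 rk3]) auto
      also have "\<dots> = ((q ^ (a + D + 1)) ^ len i * (\<beta> (a - M) * ((q ^ (a + 2)) ^ len i)\<^sup>2)) * (e\<^sup>2 * nsq (mask i y))"
        by (simp add: power_mult_distrib mult_ac)
      also have "\<dots> \<le> (\<beta> a * (1 / q ^ (D + 4)) ^ len i) * (e\<^sup>2 * nsq (mask i y))"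
        by (intro mult_right_mono key) simp
      finally show ?thesis
        by (simp add: mult_ac)
    qed
    have "nsq (conv x y) \<le> 4 * (nsq (gconv x y) +
        (\<Sum>i\<in>?I. (q ^ (a + D + 1)) ^ len i * nsq (conv (mask i x) (mask i y))))"
      by (rule nsq_conv_le_tests[OF rk2 rk3])
    also have "\<dots> \<le> 4 * (C * e\<^sup>2 * nsq y + \<beta> a * e\<^sup>2 * (nsq y / 7))"
    proof (intro mult_left_mono add_mono good)
      have "(\<Sum>i\<in>?I. (q ^ (a + D + 1)) ^ len i * nsq (conv (mask i x) (mask i y))) \<le>
          (\<Sum>i\<in>?I. \<beta> a * e\<^sup>2 * ((1 / q ^ (D + 4)) ^ len i * nsq (mask i y)))"
        by (rule sum_mono) (rule bad)
      also have "\<dots> \<le> \<beta> a * e\<^sup>2 * (nsq y / 7)"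
        unfolding sum_distrib_left[symmetric] using \<beta>0[of a] C0
        by (intro mult_left_mono sum_nsq_mask_le rk3) auto
      finally show "(\<Sum>i\<in>?I. (q ^ (a + D + 1)) ^ len i * nsq (conv (mask i x) (mask i y))) \<le> \<beta> a * e\<^sup>2 * (nsq y / 7)" .
    qed simp
    also have "\<dots> = (4 * C + 4 / 7 * \<beta> a) * (e\<^sup>2 * nsq y)"
      by (simp add: algebra_simps)
    also have "\<dots> \<le> \<beta> a * (e\<^sup>2 * nsq y)"
      using \<beta>0[of a] C0 by (intro mult_right_mono) auto
    finally show "nsq (conv x y) \<le> \<beta> a * e\<^sup>2 * nsq y"
      by (simp add: mult_ac)
  qed
  moreover have "2 * \<delta> = 6 * d + 4 * D + 18"
    by (simp add: \<delta>_def)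
  ultimately show ?case
    by (simp only: \<beta>_def C_def)
qed

end

section \<open>Products with a function of low degree\<close>

text \<open>The step from q^-i to q^-(i+1) already loses at least half, so the difference is at
  least q^-(i+1), and i + 1 \<le> d.\<close>

lemma abs_diff_inverse_powers:
  fixes q :: real
  assumes q: "q \<ge> 2" and ij: "i < j" "j \<le> d"
  shows "1 / q ^ i - 1 / q ^ j \<ge> 1 / q ^ d"
proof -
  have "q ^ Suc i \<le> q ^ j" "q ^ j \<le> q ^ d"
    using q ij by (auto intro!: power_increasing simp del: power_Suc)
  hence le: "1 / q ^ j \<le> 1 / q ^ Suc i" "1 / q ^ d \<le> 1 / q ^ j"
    using q by (auto intro!: divide_left_mono mult_pos_pos simp del: power_Suc)
  have "2 * (1 / q ^ Suc i) \<le> 1 / q ^ i"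
    using q by (simp add: field_simps)
  with le show ?thesis by linarith
qed

context bilinear_scheme
begin

text \<open>q^-rk X is the probability that X kills a random vector t, and averaging over \<xi>
  detects this event.\<close>

lemma glob_rank_multiplier:
  assumes x: "glob s e x"
  shows "glob s e (\<lambda>X. of_real (1 / q ^ rk X) * x X)"
proof -
  define w where "w = real (card (UNIV::'w set))"
  define n where "n = real (card DV)"
  have pos: "w > 0" "n > 0"
    using card_W_pos card_DV_pos by (simp_all add: w_def n_def)
  have nn: "complex_of_nat (card DV) = of_real n"
    by (simp add: n_def)
  have "glob s (1 * e) (\<lambda>X. of_real (1 / q ^ rk X) * x X)"
  proof (rule glob_multiplier[OF x, where I = "UNIV \<times> DV" and c = "\<lambda>_. of_real (1 / (w * n))"
        and B = "\<lambda>(t, \<xi>). outer sW t \<xi>"])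
    fix X assume X: "X \<in> H"
    have w: "w = q ^ rk X * real (card {t. X t = 0})"
      unfolding w_def card_W_eq[OF X] using real_card_range[OF X] by simp
    have "(\<Sum>i\<in>UNIV \<times> DV. of_real (1 / (w * n)) * chi X (case i of (t, \<xi>) \<Rightarrow> outer sW t \<xi>)) =
        (\<Sum>t\<in>UNIV. of_real (1 / (w * n)) * (\<Sum>\<xi>\<in>DV. \<phi> (\<xi> (X t))))"
      unfolding sum_distrib_left sum.cartesian_product by (rule sum.cong) (auto simp: chi_outer X)
    also have "\<dots> = (\<Sum>t\<in>UNIV. if X t = 0 then of_real (1 / w) else 0)"
      using pos by (intro sum.cong refl) (simp add: sum_DV nn)
    also have "\<dots> = of_real (1 / w * real (card {t. X t = 0}))"
      by (simp add: sum.If_cases)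
    also have "1 / w * real (card {t. X t = 0}) = 1 / q ^ rk X"
      using pos(1) unfolding w by (auto simp: divide_simps)
    finally show "of_real (1 / q ^ rk X) =
        (\<Sum>i\<in>UNIV \<times> DV. of_real (1 / (w * n)) * chi X (case i of (t, \<xi>) \<Rightarrow> outer sW t \<xi>))"
      by simp
  next
    show "(\<Sum>i\<in>(UNIV::'w set) \<times> DV. cmod (of_real (1 / (w * n)))) \<le> 1"
      using pos by (simp add: card_cartesian_product w_def n_def norm_divide norm_mult)
  qed (auto simp: linear_closed)
  thus ?thesis by simp
qed

text \<open>Each factor is the difference of two operations that do not increase e, the multiplier
  q^-rk X and the scalar q^-j; hence the 2 per node.\<close>

lemma glob_rank_product:
  assumes x: "glob s e x" and "finite S"
  shows "glob s (2 ^ card S * e) (\<lambda>X. of_real (\<Prod>j\<in>S. 1 / q ^ rk X - 1 / q ^ j) * x X)"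
  using assms(2)
proof (induction S)
  case (insert j S)
  define z where "z X = of_real (\<Prod>j\<in>S. 1 / q ^ rk X - 1 / q ^ j) * x X" for X
  have z: "glob s (2 ^ card S * e) z"
    using insert.IH by (simp add: z_def[abs_def])
  have "glob s (2 ^ card S * e + cmod (of_real (- (1 / q ^ j))) * (2 ^ card S * e))
      (\<lambda>X. of_real (1 / q ^ rk X) * z X + of_real (- (1 / q ^ j)) * z X)"
    by (intro glob_add glob_scale glob_rank_multiplier z)
  also have "(\<lambda>X. of_real (1 / q ^ rk X) * z X + of_real (- (1 / q ^ j)) * z X) =
      (\<lambda>X. of_real (\<Prod>j\<in>insert j S. 1 / q ^ rk X - 1 / q ^ j) * x X)"
    using insert.hyps by (auto simp: z_def algebra_simps)
  finally show ?case
  proof (rule glob_mono)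
    have "cmod (of_real (- (1 / q ^ j))) \<le> 1"
      using q_ge_1 by (simp add: norm_divide norm_power one_le_power)
    from mult_right_mono[OF this glob_nonneg[OF z]]
    show "2 ^ card S * e + cmod (of_real (- (1 / q ^ j))) * (2 ^ card S * e) \<le> 2 ^ card (insert j S) * e"
      using insert.hyps by simp
  qed simp
qed (simp add: x)

text \<open>Averaging over all translations by maps of rank at most one multiplies the part of pure rank
  \<open>r\<close> by \<open>q\<^sup>-\<^sup>r\<close>. Lagrange interpolation at these distinct eigenvalues isolates each pure part.\<close>

lemma glob_pure_part:
  assumes x: "glob s e x" and rk: "\<And>X. X \<in> H \<Longrightarrow> x X \<noteq> 0 \<Longrightarrow> rk X \<le> d" and r: "r \<le> d"
  shows "glob s (q ^ (d\<^sup>2 + d) * e) (\<lambda>X. if rk X = r then x X else 0)"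
proof -
  define S where "S = {..d} - {r}"
  have S: "finite S" "card S = d"
    using r by (auto simp: S_def)
  define L where "L = (\<Prod>j\<in>S. 1 / q ^ r - 1 / q ^ j)"
  \<comment> \<open>There are d nodes besides r, each at distance at least q^-d from q^-r.\<close>
  have "(1 / q ^ d) ^ d \<le> \<bar>L\<bar>"
  proof -
    have "(\<Prod>j\<in>S. 1 / q ^ d) \<le> (\<Prod>j\<in>S. \<bar>1 / q ^ r - 1 / q ^ j\<bar>)"
    proof (rule prod_mono)
      fix j assume j: "j \<in> S"
      have "1 / q ^ d \<le> \<bar>1 / q ^ r - 1 / q ^ j\<bar>"
      proof (cases "r < j")
        case True
        thus ?thesis
          using abs_diff_inverse_powers[OF q_ge_2 True, of d] j by (simp add: S_def)
      next
        case False
        hence "j < r"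
          using j by (auto simp: S_def)
        thus ?thesis
          using abs_diff_inverse_powers[OF q_ge_2 _ r, of j] by simp
      qed
      thus "0 \<le> 1 / q ^ d \<and> 1 / q ^ d \<le> \<bar>1 / q ^ r - 1 / q ^ j\<bar>"
        using q_gt_0 by simp
    qed
    thus ?thesis
      by (simp add: L_def abs_prod S)
  qed
  hence L: "1 / q ^ (d * d) \<le> \<bar>L\<bar>"
    by (simp add: power_one_over power_mult)
  moreover have "0 < 1 / q ^ (d * d)"
    using q_gt_0 by simp
  ultimately have L0: "\<bar>L\<bar> > 0"
    by linarith
  have "1 / \<bar>L\<bar> \<le> q ^ (d * d)"
    using L L0 q_gt_0 by (simp add: field_simps)
  have "glob s (cmod (of_real (1 / L)) * (2 ^ card S * e))
      (\<lambda>X. of_real (1 / L) * (of_real (\<Prod>j\<in>S. 1 / q ^ rk X - 1 / q ^ j) * x X))"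
    by (intro glob_scale glob_rank_product x S)
  hence "glob s (q ^ (d\<^sup>2 + d) * e) (\<lambda>X. of_real (1 / L) * (of_real (\<Prod>j\<in>S. 1 / q ^ rk X - 1 / q ^ j) * x X))"
  proof (rule glob_mono)
    have "cmod (of_real (1 / L)) * 2 ^ d \<le> q ^ (d * d) * q ^ d"
    proof (rule mult_mono)
      show "cmod (of_real (1 / L)) \<le> q ^ (d * d)"
        using \<open>1 / \<bar>L\<bar> \<le> q ^ (d * d)\<close> by (simp only: norm_of_real abs_divide abs_one)
      show "2 ^ d \<le> q ^ d"
        using q_ge_2 by (rule power_mono) simp
    qed (use q_gt_0 in auto)
    from mult_right_mono[OF this glob_nonneg[OF x]]
    show "cmod (of_real (1 / L)) * (2 ^ card S * e) \<le> q ^ (d\<^sup>2 + d) * e"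
      unfolding S(2) power2_eq_square power_add by (simp only: mult.assoc)
  qed simp
  moreover have "of_real (1 / L) * (of_real (\<Prod>j\<in>S. 1 / q ^ rk X - 1 / q ^ j) * x X) =
      (if rk X = r then x X else 0)" if X: "X \<in> H" for X
  proof (cases "x X = 0 \<or> rk X = r")
    case True
    moreover have "complex_of_real (1 / L) * (of_real L * x X) = x X"
      using L0 by simp
    ultimately show ?thesis
      unfolding L_def by auto
  next
    case False
    hence "rk X \<in> S"
      using rk[OF X] by (auto simp: S_def)
    hence "(\<Prod>j\<in>S. 1 / q ^ rk X - 1 / q ^ j) = 0"
      using S(1) by (intro prod_zero) auto
    thus ?thesis
      using False by simp
  qed
  ultimately show ?thesis
    by (simp cong: glob_cong)
qed

text \<open>4 d^2 + 4 d D and d (6 d + 4 D + 18) come from \<open>product_bound_pure\<close>, 2 (d^2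
  + d) from isolating the pure parts, 2 d from their number and 4 from 12 \<le> q^4. The terms 22 d
  + 4 are absorbed by 26 d^2.\<close>

definition step_const :: "nat \<Rightarrow> nat \<Rightarrow> real" where
  "step_const d D = q ^ (38 * d\<^sup>2 + 8 * d * D)"

lemma nsq_conv_le:
  assumes x: "glob d e x" and rkx: "\<And>X. X \<in> H \<Longrightarrow> x X \<noteq> 0 \<Longrightarrow> rk X \<le> d"
    and rky: "\<And>Y. Y \<in> H \<Longrightarrow> y Y \<noteq> 0 \<Longrightarrow> rk Y \<le> D"
  shows "nsq (conv x y) \<le> step_const d D * e\<^sup>2 * nsq y"
\<comment> \<open>For d = 0 the factor 12 cannot be hidden in a power of q with exponent 0; but then
  x lives on X = 0 and the convolution is a scaling.\<close>
proof (cases "d = 0")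
  case True
  have x0: "x X = 0" if X: "X \<in> H" "X \<noteq> 0" for X
  proof (rule ccontr)
    assume "x X \<noteq> 0"
    hence "rk X = 0"
      using rkx[OF X(1)] True by simp
    with X show False
      using rk_eq_0 by blast
  qed
  have "conv x y Z = x 0 * y Z" if "Z \<in> H" for Z
  proof -
    have "conv x y Z = (\<Sum>X\<in>{0}. x X * y (Z - X))"
      unfolding conv_def
    proof (rule sum.mono_neutral_right)
      show "{0} \<subseteq> H"
        using linear_closed(6) by blast
    qed (use x0 in auto)
    thus ?thesis by simp
  qed
  hence "nsq (conv x y) = (cmod (x 0))\<^sup>2 * nsq y"
    unfolding nsq_def sum_distrib_left by (intro sum.cong refl) (simp add: norm_mult power_mult_distrib)
  also have "(cmod (x 0))\<^sup>2 \<le> nsq x"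
    unfolding nsq_def
    by (rule member_le_sum[of 0 H "\<lambda>X. (cmod (x X))\<^sup>2"]) (use linear_closed(6) in simp_all)
  also have "nsq x \<le> e\<^sup>2"
    by (rule glob_nsq[OF x])
  finally show ?thesis
    using True by (simp add: step_const_def mult_right_mono)
next
  case False
  define xr where "xr r X = (if rk X = r then x X else 0)" for r X
  define K where "K = 12 * q ^ (4 * d\<^sup>2 + 4 * d * D) * (q ^ (6 * d + 4 * D + 18)) ^ d"
  define e' where "e' = q ^ (d\<^sup>2 + d) * e"
  have "conv x y Z = (\<Sum>r\<le>d. conv (xr r) y Z)" for Z
  proof -
    have "(\<Sum>r\<le>d. xr r X) = x X" if "X \<in> H" for X
      using rkx[OF that] by (cases "x X = 0") (auto simp: xr_def sum.delta cong: if_cong)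
    hence "conv x y Z = (\<Sum>X\<in>H. \<Sum>r\<le>d. xr r X * y (Z - X))"
      unfolding conv_def sum_distrib_right[symmetric] by (intro sum.cong refl) simp
    thus ?thesis
      unfolding conv_def by (subst (asm) sum.swap)
  qed
  hence "nsq (conv x y) = (\<Sum>Z\<in>H. (cmod (\<Sum>r\<le>d. conv (xr r) y Z))\<^sup>2)"
    by (simp add: nsq_def)
  also have "\<dots> \<le> (\<Sum>Z\<in>H. real (Suc d) * (\<Sum>r\<le>d. (cmod (conv (xr r) y Z))\<^sup>2))"
  proof (rule sum_mono)
    fix Z
    have "(cmod (\<Sum>r\<le>d. conv (xr r) y Z))\<^sup>2 \<le> (\<Sum>r\<le>d. cmod (conv (xr r) y Z))\<^sup>2"
      by (intro power_mono norm_sum) simp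
    also have "\<dots> \<le> real (card {..d}) * (\<Sum>r\<le>d. (cmod (conv (xr r) y Z))\<^sup>2)"
      by (rule sum_square_le_card)
    finally show "(cmod (\<Sum>r\<le>d. conv (xr r) y Z))\<^sup>2 \<le> real (Suc d) * (\<Sum>r\<le>d. (cmod (conv (xr r) y Z))\<^sup>2)"
      by simp
  qed
  also have "\<dots> = real (Suc d) * (\<Sum>r\<le>d. nsq (conv (xr r) y))"
    unfolding sum_distrib_left[symmetric] nsq_def by (subst sum.swap) simp
  also have "\<dots> \<le> real (Suc d) * (\<Sum>r\<le>d. K * e'\<^sup>2 * nsq y)"
  proof (intro mult_left_mono sum_mono)
    fix r assume "r \<in> {..d}"
    hence r: "r \<le> d"
      by simp
    have "glob d e' (xr r)"
      using glob_pure_part[OF x rkx r] by (simp add: xr_def[abs_def] e'_def)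
    hence "glob r e' (xr r)"
      by (rule glob_mono) (use r in auto)
    hence "nsq (conv (xr r) y) \<le> 12 * q ^ (4 * d\<^sup>2 + 4 * d * D) * (q ^ (6 * d + 4 * D + 18)) ^ r * e'\<^sup>2 * nsq y"
      using product_bound_pure[OF r, of D] rky unfolding product_bound_def by (auto simp: xr_def)
    also have "\<dots> \<le> K * e'\<^sup>2 * nsq y"
      unfolding K_def using q_gt_0 q_ge_1 r
      by (intro mult_right_mono mult_left_mono power_increasing) (auto simp: one_le_power)
    finally show "nsq (conv (xr r) y) \<le> K * e'\<^sup>2 * nsq y" .
  qed simp
  \<comment> \<open>One factor \<open>Suc d\<close> stems from Cauchy-Schwarz over the pure parts,
    the other from adding their bounds.\<close>
  also have "\<dots> = (real (Suc d))\<^sup>2 * K * (q ^ (d\<^sup>2 + d))\<^sup>2 * (e\<^sup>2 * nsq y)"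
    by (simp add: e'_def power_mult_distrib power2_eq_square mult_ac)
  also have "\<dots> \<le> step_const d D * (e\<^sup>2 * nsq y)"
  proof (rule mult_right_mono)
    have "real (Suc d) \<le> 2 ^ d"
    proof -
      have "Suc d \<le> 2 ^ d"
        by (intro Suc_leI less_exp)
      thus ?thesis
        by (metis of_nat_le_iff of_nat_numeral of_nat_power)
    qed
    also have "\<dots> \<le> q ^ d"
      using q_ge_2 by (intro power_mono) auto
    finally have 1: "(real (Suc d))\<^sup>2 \<le> (q ^ d)\<^sup>2"
      by (intro power_mono) auto
    have "2 ^ 4 \<le> q ^ 4"
      using q_ge_2 by (intro power_mono) auto
    hence 2: "12 \<le> q ^ 4"
      by simp
    have K: "K \<le> q ^ 4 * q ^ (4 * d\<^sup>2 + 4 * d * D) * (q ^ (6 * d + 4 * D + 18)) ^ d"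
      unfolding K_def using 2 q_gt_0 by (intro mult_right_mono) auto
    have "(real (Suc d))\<^sup>2 * K * (q ^ (d\<^sup>2 + d))\<^sup>2 \<le>
        (q ^ d)\<^sup>2 * (q ^ 4 * q ^ (4 * d\<^sup>2 + 4 * d * D) * (q ^ (6 * d + 4 * D + 18)) ^ d) * (q ^ (d\<^sup>2 + d))\<^sup>2"
    proof (intro mult_right_mono mult_mono 1 K)
      show "0 \<le> K"
        unfolding K_def using q_gt_0 by (intro mult_nonneg_nonneg) auto
    qed auto
    also have "\<dots> = q ^ (2 * d + (4 + (4 * d\<^sup>2 + 4 * d * D) + (6 * d + 4 * D + 18) * d) + 2 * (d\<^sup>2 + d))"
      by (simp only: power_mult[symmetric] power_add[symmetric] mult.commute[of _ 2])
    also have "\<dots> \<le> q ^ (38 * d\<^sup>2 + 8 * d * D)"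
    proof -
      have "d \<le> d\<^sup>2" "1 \<le> d\<^sup>2"
        using False by (simp_all add: power2_eq_square)
      hence "4 + 22 * d \<le> 26 * d\<^sup>2"
        by linarith
      thus ?thesis
        unfolding q_power_le_iff by (simp add: algebra_simps power2_eq_square)
    qed
    finally show "(real (Suc d))\<^sup>2 * K * (q ^ (d\<^sup>2 + d))\<^sup>2 \<le> step_const d D"
      by (simp add: step_const_def)
  qed simp
  finally show ?thesis
    by (simp add: mult.assoc)
qed

text \<open>The index counts multiplications, so n stands for the power n + 1 of
  \<open>F x\<close>.\<close>

primrec conv_power :: "(('w \<Rightarrow> 'v) \<Rightarrow> complex) \<Rightarrow> nat \<Rightarrow> ('w \<Rightarrow> 'v) \<Rightarrow> complex" where
  "conv_power x 0 = x"
| "conv_power x (Suc n) = conv x (conv_power x n)"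

lemma F_conv_power: "A \<in> G \<Longrightarrow> F (conv_power x n) A = F x A ^ Suc n"
  by (induction n) (simp_all add: F_conv)

lemma conv_power_support:
  assumes rk: "\<And>X. X \<in> H \<Longrightarrow> x X \<noteq> 0 \<Longrightarrow> rk X \<le> d" and Z: "Z \<in> H" "conv_power x n Z \<noteq> 0"
  shows "rk Z \<le> Suc n * d"
  using Z
proof (induction n arbitrary: Z)
  case (Suc n)
  from conv_support[of x d "conv_power x n" "Suc n * d" Z] show ?case
    using Suc rk by simp
qed (use rk in simp)

text \<open>After k multiplications the ranks are at most (k + 1) d, so the exponents 38 d^2 + 8 d^2
  (k + 1) are added up for k < n; 8 d^2 n^2 covers the arithmetic series.\<close>

lemma nsq_conv_power_le:
  assumes x: "glob d e x" and rk: "\<And>X. X \<in> H \<Longrightarrow> x X \<noteq> 0 \<Longrightarrow> rk X \<le> d"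
  shows "nsq (conv_power x n) \<le> q ^ (38 * d\<^sup>2 * n + 8 * d\<^sup>2 * n\<^sup>2) * (e\<^sup>2) ^ n * nsq x"
proof (induction n)
  case (Suc n)
  have "nsq (conv_power x (Suc n)) \<le> step_const d (Suc n * d) * e\<^sup>2 * nsq (conv_power x n)"
    unfolding conv_power.simps by (rule nsq_conv_le[OF x rk conv_power_support[OF rk]])
  also have "\<dots> \<le> step_const d (Suc n * d) * e\<^sup>2 * (q ^ (38 * d\<^sup>2 * n + 8 * d\<^sup>2 * n\<^sup>2) * (e\<^sup>2) ^ n * nsq x)"
    using q_gt_0 by (intro mult_left_mono Suc.IH) (auto simp: step_const_def)
  also have "\<dots> = q ^ (38 * d\<^sup>2 + 8 * d * (Suc n * d) + (38 * d\<^sup>2 * n + 8 * d\<^sup>2 * n\<^sup>2)) * ((e\<^sup>2) ^ Suc n * nsq x)"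
    by (simp add: step_const_def power_add mult_ac)
  also have "\<dots> \<le> q ^ (38 * d\<^sup>2 * Suc n + 8 * d\<^sup>2 * (Suc n)\<^sup>2) * ((e\<^sup>2) ^ Suc n * nsq x)"
  proof (intro mult_right_mono)
    show "q ^ (38 * d\<^sup>2 + 8 * d * (Suc n * d) + (38 * d\<^sup>2 * n + 8 * d\<^sup>2 * n\<^sup>2)) \<le>
        q ^ (38 * d\<^sup>2 * Suc n + 8 * d\<^sup>2 * (Suc n)\<^sup>2)"
      unfolding q_power_le_iff by (simp add: algebra_simps power2_eq_square)
  qed simp
  finally show ?case
    by (simp add: mult_ac)
qed simp

end

section \<open>Globalness of the coefficient function\<close>

text \<open>A basis of K extends to one of S, and an intermediate set of n vectors spans the
  required space. It serves to bring a restriction to size exactly d.\<close>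

lemma (in vector_space) ex_subspace_between:
  assumes fin: "finite (UNIV :: 'b set)" and K: "subspace K" and S: "subspace S" and KS: "K \<subseteq> S"
    and n: "dim K \<le> n" "n \<le> dim S"
  shows "\<exists>T. subspace T \<and> K \<subseteq> T \<and> T \<subseteq> S \<and> dim T = n"
proof -
  have finB: "finite B" for B :: "'b set"
    by (rule finite_subset[OF subset_UNIV fin])
  obtain B where B: "B \<subseteq> K" "independent B" "K \<subseteq> span B"
    by (rule maximal_independent_subset[of K])
  have "B \<subseteq> S"
    using B(1) KS by (rule subset_trans)
  from maximal_independent_subset_extend[OF this B(2)]
  obtain C where C: "B \<subseteq> C" "C \<subseteq> S" "independent C" "S \<subseteq> span C"
    by metis
  have "card B \<le> n" "n \<le> card C"
    using n basis_card_eq_dim[OF B(1,3,2)] basis_card_eq_dim[OF C(2,4,3)] by simp_all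
  then obtain E where E: "B \<subseteq> E" "E \<subseteq> C" "card E = n"
    using exists_subset_between[OF _ _ C(1) finB] by metis
  have "dim (span E) = n"
    unfolding E(3)[symmetric] by (rule dim_span_eq_card_independent[OF independent_mono[OF C(3) E(2)]])
  moreover have "K \<subseteq> span E"
    using B(3) span_mono[OF E(1)] by (rule subset_trans)
  moreover have "span E \<subseteq> S"
    by (rule span_minimal[OF _ S]) (use E(2) C(2) in auto)
  ultimately show ?thesis
    by (intro exI[of _ "span E"]) simp
qed

context bilinear_scheme
begin

lemma ex_pseudo_inverse:
  fixes s :: "'k \<Rightarrow> 'x::ab_group_add \<Rightarrow> 'x"
  assumes s: "vector_space s" and f: "f \<in> linmaps s s"
  shows "\<exists>g\<in>linmaps s s. \<forall>x. f (g (f x)) = f x"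
proof -
  interpret S: vector_space s by (rule s)
  interpret vector_space_pair s s ..
  from linear_exists_right_inverse_on[of f UNIV] f show ?thesis
    by (auto simp: linmaps_def)
qed

text \<open>Sandwiching S between pseudo-inverses of \<rho> and \<pi> loses nothing under the two
  hypotheses. So the maps \<rho> A \<pi> exhaust those that vanish on ker \<pi> and have image in
  range \<rho>.\<close>

lemma ex_factorization:
  assumes \<pi>: "\<pi> \<in> EV" and \<rho>: "\<rho> \<in> EW" and S: "S \<in> G"
    and ker: "\<And>v. \<pi> v = 0 \<Longrightarrow> S v = 0" and ran: "range S \<subseteq> range \<rho>"
  shows "\<exists>A\<in>G. \<rho> \<circ> A \<circ> \<pi> = S"
proof -
  obtain \<pi>' where \<pi>': "\<pi>' \<in> EV" "\<And>v. \<pi> (\<pi>' (\<pi> v)) = \<pi> v"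
    using ex_pseudo_inverse[OF V.vector_space_axioms \<pi>] by blast
  obtain \<rho>' where \<rho>': "\<rho>' \<in> EW" "\<And>w. \<rho> (\<rho>' (\<rho> w)) = \<rho> w"
    using ex_pseudo_inverse[OF W.vector_space_axioms \<rho>] by blast
  have "\<rho> (\<rho>' (S (\<pi>' (\<pi> v)))) = S v" for v
  proof -
    have "\<pi> (\<pi>' (\<pi> v) - v) = 0"
      using \<pi>'(2) by (simp add: linmaps_diff[OF \<pi>])
    hence "S (\<pi>' (\<pi> v)) = S v"
      using ker linmaps_diff[OF S, of "\<pi>' (\<pi> v)" v] by simp
    moreover obtain w where "S v = \<rho> w"
      using ran by blast
    ultimately show ?thesis
      using \<rho>'(2) by simp
  qed
  thus ?thesis
    using \<pi>'(1) \<rho>'(1) S by (intro bexI[of _ "\<rho>' \<circ> S \<circ> \<pi>'"]) (auto intro!: linmaps_comp simp: fun_eq_iff)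
qed

text \<open>A restriction of size at most d is an average of restrictions of size d: enlarge ker
  \<pi> to V', shrink range \<rho> to W' and average over translations by L. Each such average is at
  most \<epsilon>, hence so is the mean over G. The bound on d leaves room for the
  enlargement.\<close>

lemma glob_if_global:
  assumes gl: "global sV sW d \<epsilon> f" and \<epsilon>: "\<epsilon> \<ge> 0"
    and d: "d \<le> V.dim UNIV + W.dim UNIV"
    and f: "\<And>A. A \<in> G \<Longrightarrow> f A = F x A"
  shows "glob d (sqrt \<epsilon>) x"
proof (rule globI)
  fix \<pi> \<rho> T
  assume \<pi>: "\<pi> \<in> EV" and \<rho>: "\<rho> \<in> EW" and T: "T \<in> G"
    and le: "card {v. \<pi> v = 0} * card {w. \<rho> w = 0} \<le> CARD('k) ^ d"
  define Kv where "Kv = {v. \<pi> v = 0}"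
  define Kw where "Kw = {w. \<rho> w = 0}"
  have Kv: "V.subspace Kv"
    unfolding Kv_def using \<pi> by (auto intro!: V.subspaceI simp: linmaps_zero linmaps_add linmaps_scale)
  have Kw: "W.subspace Kw"
    unfolding Kw_def using \<rho> by (auto intro!: W.subspaceI simp: linmaps_zero linmaps_add linmaps_scale)
  have R: "W.subspace (range \<rho>)"
    by (rule module_hom.subspace_image[OF linmaps_module_hom[OF \<rho>] W.subspace_UNIV])
  have "CARD('k) ^ (V.dim Kv + W.dim Kw) \<le> CARD('k) ^ d"
    using le VF.card_subspace[OF finite_V_set Kv] WF.card_subspace[OF finite_W_set Kw]
    by (simp only: Kv_def Kw_def power_add)
  hence ds: "V.dim Kv + W.dim Kw \<le> d"
    by simp
  have "card (UNIV::'w set) = card (range \<rho>) * card Kw"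
    unfolding Kw_def using card_image_times_card_kernel[of "UNIV::'w set" \<rho>] \<rho> by (simp add: linmaps_add)
  hence "CARD('k) ^ W.dim UNIV = CARD('k) ^ (W.dim (range \<rho>) + W.dim Kw)"
    using WF.card_subspace[OF finite_W_set W.subspace_UNIV] WF.card_subspace[OF finite_W_set R]
      WF.card_subspace[OF finite_W_set Kw]
    by (simp only: power_add)
  hence dW: "W.dim UNIV = W.dim (range \<rho>) + W.dim Kw"
    using CARD_power_le_iff by (metis le_antisym order_refl)
  have dKV: "V.dim Kv \<le> V.dim UNIV"
    by (rule V.dim_subset) simp
  have dKW: "W.dim Kw \<le> W.dim UNIV"
    using dW by simp
  \<comment> \<open>V' absorbs as much of d as possible; what is left for the codimension of W' is
    at least dim Kw and, by the bound on d, at most dim W.\<close>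
  define a where "a = min (V.dim UNIV) (d - W.dim Kw)"
  define b where "b = d - a"
  have ab: "V.dim Kv \<le> a" "a \<le> V.dim UNIV" "W.dim Kw \<le> b" "b \<le> W.dim UNIV" "a + b = d"
    using ds dKV dKW d unfolding a_def b_def by linarith+
  obtain V' where V': "V.subspace V'" "Kv \<subseteq> V'" "V.dim V' = a"
    using V.ex_subspace_between[OF finite_V Kv V.subspace_UNIV subset_UNIV ab(1,2)] by blast
  have "W.dim {0} \<le> W.dim UNIV - b" "W.dim UNIV - b \<le> W.dim (range \<rho>)"
    using ab dW by auto
  then obtain W' where W': "W.subspace W'" "W' \<subseteq> range \<rho>" "W.dim W' = W.dim UNIV - b"
    using W.ex_subspace_between[OF finite_W W.subspace_single_0 R, of "W.dim UNIV - b"] W.subspace_0[OF R]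
    by auto
  have cd: "V.dim V' + codim sW W' = d"
    using ab V'(3) W'(3) by (simp add: codim_def)
  define L where "L = restr_linmaps sV sW V' W'"
  have LG: "S \<in> G" if "S \<in> L" for S
    using that by (simp add: L_def restr_linmaps_def)
  have "0 \<in> L"
    using W.subspace_0[OF W'(1)] by (auto simp: L_def restr_linmaps_def linear_closed)
  hence cL: "card L > 0"
    by (auto simp: card_gt_0_iff)
  have bound: "(\<Sum>S\<in>L. (cmod (F x (S + T')))\<^sup>2) \<le> real (card L) * \<epsilon>" if T': "T' \<in> G" for T'
  proof -
    have "(Lnorm L 2 (restriction f T'))\<^sup>2 \<le> \<epsilon>"
      using gl V'(1) W'(1) T' cd unfolding global_def L_def by blast
    moreover have "restriction f T' S = F x (S + T')" if "S \<in> L" for S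
    proof -
      have "(\<lambda>v. S v + T' v) = S + T'"
        by (simp add: fun_eq_iff)
      thus ?thesis
        using f[OF linear_closed(1)[OF LG[OF that] T']] by (simp add: restriction_def)
    qed
    ultimately have "(root 2 ((\<Sum>S\<in>L. (cmod (F x (S + T')))\<^sup>2) / real (card L)))\<^sup>2 \<le> \<epsilon>"
      by (simp add: Lnorm_def expect_def cong: sum.cong_simp)
    hence "(\<Sum>S\<in>L. (cmod (F x (S + T')))\<^sup>2) / real (card L) \<le> \<epsilon>"
      by (simp add: sqrt_def[symmetric] sum_nonneg)
    thus ?thesis
      using cL by (simp add: field_simps)
  qed
  \<comment> \<open>S has the form \<rho> B \<pi>, so translating by it amounts to replacing A by A
    + B.\<close>
  have shift: "(\<Sum>A\<in>G. (cmod (F x (S + ((\<rho> \<circ> A \<circ> \<pi>) + T))))\<^sup>2) = (\<Sum>A\<in>G. (cmod (F x ((\<rho> \<circ> A \<circ> \<pi>) + T)))\<^sup>2)"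
    if S: "S \<in> L" for S
  proof -
    have "\<exists>B\<in>G. \<rho> \<circ> B \<circ> \<pi> = S"
      by (rule ex_factorization[OF \<pi> \<rho> LG[OF S]])
         (use S V'(2) W'(2) in \<open>auto simp: L_def restr_linmaps_def Kv_def\<close>)
    then obtain B where B: "B \<in> G" "\<rho> \<circ> B \<circ> \<pi> = S" ..
    have eq: "S + ((\<rho> \<circ> A \<circ> \<pi>) + T) = (\<rho> \<circ> (A + B) \<circ> \<pi>) + T" for A
      using B(2) by (auto simp: fun_eq_iff linmaps_add[OF \<rho>] add_ac)
    show ?thesis
      unfolding eq using B(1)
      by (intro sum.reindex_bij_witness[of _ "\<lambda>A. A - B" "\<lambda>A. A + B"]) (auto simp: linear_closed)
  qed
  have "real (card L) * (real (card G) * nsq (res \<pi> \<rho> T x)) =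
      (\<Sum>S\<in>L. \<Sum>A\<in>G. (cmod (F x ((\<rho> \<circ> A \<circ> \<pi>) + T)))\<^sup>2)"
    unfolding parseval[symmetric] by (simp add: F_res[OF \<pi> \<rho> T] cong: sum.cong_simp)
  also have "\<dots> = (\<Sum>S\<in>L. \<Sum>A\<in>G. (cmod (F x (S + ((\<rho> \<circ> A \<circ> \<pi>) + T))))\<^sup>2)"
    by (rule sum.cong[OF refl]) (simp only: shift)
  also have "\<dots> = (\<Sum>A\<in>G. \<Sum>S\<in>L. (cmod (F x (S + ((\<rho> \<circ> A \<circ> \<pi>) + T))))\<^sup>2)"
    by (rule sum.swap)
  also have "\<dots> \<le> (\<Sum>A\<in>G. real (card L) * \<epsilon>)"
  proof (intro sum_mono bound)
    fix A assume "A \<in> G"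
    thus "(\<rho> \<circ> A \<circ> \<pi>) + T \<in> G"
      using \<pi> \<rho> T by (intro linear_closed(1) linmaps_comp[OF _ \<pi>] linmaps_comp[OF \<rho>])
  qed
  also have "\<dots> = real (card L) * (real (card G) * \<epsilon>)"
    by simp
  finally have "nsq (res \<pi> \<rho> T x) \<le> \<epsilon>"
    using cL card_G_pos by simp
  thus "L2_set (\<lambda>X. cmod (res \<pi> \<rho> T x X)) H \<le> sqrt \<epsilon>"
    by (simp add: L2_set_def nsq_def)
qed

text \<open>The modulus to the power 2 (n + 1) is the squared modulus of the power n + 1, so
  Parseval applies to \<open>conv_power x n\<close>.\<close>

lemma expect_norm_power:
  assumes f: "\<And>A. A \<in> G \<Longrightarrow> f A = F x A"
  shows "Lnorm G (2 * Suc n) f ^ (2 * Suc n) = nsq (conv_power x n)"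
proof -
  have "expect G (\<lambda>A. cmod (f A) ^ (2 * Suc n)) = (\<Sum>A\<in>G. (cmod (F (conv_power x n) A))\<^sup>2) / real (card G)"
    unfolding expect_def
    by (intro arg_cong2[where f = "(/)"] sum.cong refl)
       (simp only: f F_conv_power norm_power power_mult[symmetric] mult.commute[of 2])
  also have "\<dots> = nsq (conv_power x n)"
    unfolding parseval using card_G_pos by (auto simp: card_gt_0_iff)
  finally show ?thesis
    by (simp add: Lnorm_def real_root_pow_pos2 del: power_Suc mult_Suc_right)
qed

end

theorem theorem1p13:
  fixes p m q d l :: nat
    and \<epsilon> :: real
    and sV :: "'k::{field,finite} \<Rightarrow> 'v::ab_group_add \<Rightarrow> 'v"
    and sW :: "'k \<Rightarrow> 'w::ab_group_add \<Rightarrow> 'w"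
    and BV :: "'v set" and BW :: "'w set"
    and f :: "('v \<Rightarrow> 'w) \<Rightarrow> complex"
  assumes "prime p" and "q = p ^ m" and "CARD('k) = q"
    and "finite_dimensional_vector_space sV BV"
    and "finite_dimensional_vector_space sW BW"
    and "d \<le> vector_space.dim sV UNIV + vector_space.dim sW UNIV"
    and "\<epsilon> > 0"
    and "global sV sW d \<epsilon> f"
    and "of_degree p m sV sW d f"
    and "l \<ge> 2" and "\<exists>k. l = 2 ^ k"
  shows "Lnorm (linmaps sV sW) l f ^ l
    \<le> real q ^ (200 * d\<^sup>2 * l\<^sup>2) * (Lnorm (linmaps sV sW) 2 f)\<^sup>2 * \<epsilon> powr (real l / 2 - 1)"
proof -
  have card: "CARD('k) = p ^ m"
    using assms(2,3) by simp
  interpret V: finite_dimensional_vector_space sV BV by fact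
  interpret W: finite_dimensional_vector_space sW BW by fact
  interpret S: bilinear_scheme sV BV sW BW "add_char p m"
    by unfold_locales
       (rule add_char_add[OF assms(1) card] norm_add_char[OF assms(1) card] add_char_nontrivial[OF assms(1) card])+
  \<comment> \<open>Truncation at rank d does not change the function, since f is of degree d, and
    builds the rank bound into x.\<close>
  define x where "x X = (if rank sV X \<le> d then fourier_coeff p m sV sW f X else 0)" for X
  have f: "f A = S.F x A" if "A \<in> linmaps sV sW" for A
  proof -
    have "f A = low_degree_part p m sV sW d f A"
      using assms(9) that by (simp add: of_degree_def)
    also have "\<dots> = S.F x A"
      unfolding low_degree_part_def S.F_def
      by (rule sum.mono_neutral_cong_left) (auto simp: x_def S.chi_def fourier_char_def)
    finally show ?thesis .
  qed
  have gl: "S.glob d (sqrt \<epsilon>) x"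
    by (rule S.glob_if_global[OF assms(8) _ assms(6) f]) (use assms(7) in auto)
  have rk: "rank sV X \<le> d" if "x X \<noteq> 0" for X
    using that by (auto simp: x_def split: if_splits)
  \<comment> \<open>Then n = l/2 - 1 is both the exponent of \<epsilon> and the number of
    multiplications by f.\<close>
  from assms(10,11) obtain n where l: "l = 2 * Suc n"
  proof -
    from assms(11) obtain k where k: "l = 2 ^ k" ..
    with assms(10) have "k > 0"
      by (cases k) auto
    hence "l = 2 * 2 ^ (k - 1)"
      using k by (simp add: power_eq_if)
    moreover have "(2::nat) ^ (k - 1) = Suc (2 ^ (k - 1) - 1)"
      by simp
    ultimately show ?thesis
      using that by metis
  qed
  have q: "S.q = real q"
    by (simp add: S.q_def assms(3))
  have "(Lnorm (linmaps sV sW) 2 f)\<^sup>2 = S.nsq x"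
    using S.expect_norm_power[OF f, of 0] by simp
  moreover have "\<epsilon> powr (real l / 2 - 1) = \<epsilon> ^ n"
  proof -
    have "real l / 2 - 1 = real n"
      by (simp add: l field_simps)
    thus ?thesis
      using assms(7) by (simp only: powr_realpow)
  qed
  moreover have "Lnorm (linmaps sV sW) l f ^ l \<le> real q ^ (38 * d\<^sup>2 * n + 8 * d\<^sup>2 * n\<^sup>2) * \<epsilon> ^ n * S.nsq x"
  proof -
    have "Lnorm (linmaps sV sW) l f ^ l = S.nsq (S.conv_power x n)"
      unfolding l by (rule S.expect_norm_power[OF f])
    thus ?thesis
      using S.nsq_conv_power_le[OF gl rk, of n] assms(7) by (simp add: q)
  qed
  moreover have "real q ^ (38 * d\<^sup>2 * n + 8 * d\<^sup>2 * n\<^sup>2) \<le> real q ^ (200 * d\<^sup>2 * l\<^sup>2)"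
  proof (rule power_increasing)
    have "38 * n + 8 * n\<^sup>2 \<le> 200 * l\<^sup>2"
      by (simp add: l power2_eq_square algebra_simps)
    hence "d\<^sup>2 * (38 * n + 8 * n\<^sup>2) \<le> d\<^sup>2 * (200 * l\<^sup>2)"
      by (rule mult_left_mono) simp
    thus "38 * d\<^sup>2 * n + 8 * d\<^sup>2 * n\<^sup>2 \<le> 200 * d\<^sup>2 * l\<^sup>2"
      by (simp add: algebra_simps)
    show "1 \<le> real q"
      using S.q_ge_1 q by simp
  qed
  hence "real q ^ (38 * d\<^sup>2 * n + 8 * d\<^sup>2 * n\<^sup>2) * (\<epsilon> ^ n * S.nsq x) \<le>
      real q ^ (200 * d\<^sup>2 * l\<^sup>2) * (\<epsilon> ^ n * S.nsq x)"
    using assms(7) by (intro mult_right_mono) auto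
  ultimately show ?thesis
    by (simp add: mult_ac)
qed

end
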